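(* Suppose that $\phi$ is slowly varying at infinity with $\lim_{s\to\infty}\phi(s)=\infty$. Let $a:\mathbb{R}^d\times\mathbb{R}^d\to\mathbb{R}$ be measurable and suppose there are $\rho_0,c_0\in(0,1)$ and $\alpha>0$ such that $a(x,z)\ge c_0$ for every $x\in\mathbb{R}^d$ and $|z|<\rho_0$, and $\|a(\cdot,z)\|_{C^\alpha_\rho}\le c_0^{-1}$ for every $z\in\mathbb{R}^d$. Let $$\mathcal{L}u(x)=\int_{\mathbb{R}^d}(u(x+z)-u(x))\,a(x,z)J(z)\,dz .$$ Then there exists a constant $\lambda_0>0$ such that for each $\lambda\ge 2\lambda_0$ and each $f\in C^\alpha_\rho$, the Poisson equation $$\lambda u-\mathcal{L}u=f$$ admits a unique solution $u$ in $C^{1+\alpha}_\rho$. Moreover, for any $\beta\in[0,\alpha]$, $$\lambda\|u\|_{C^\beta_\rho}+\|u\|_{C^{1+\beta}_\rho}\le C\|f\|_{C^\beta_\rho},$$ where $C$ only depends on $d,\psi,\rho_0,c_0,\alpha$ and $\beta$.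
   Context: $S=(S_t)_{t\ge0}$ is a driftless subordinator with Lévy measure $\Pi$ on $(0,\infty)$, $\int_0^\infty(1\wedge t)\,\Pi(dt)<\infty$, and Laplace exponent $\phi(s)=-\log\mathbf{E}e^{-sS_1}=\int_0^\infty(1-e^{-st})\,\Pi(dt)$. The function $J(z)=j(|z|)=\int_0^\infty(4\pi t)^{-d/2}e^{-|z|^2/(4t)}\,\Pi(dt)$ is the jump kernel of the subordinate Brownian motion $Z_t=\sqrt2B_{S_t}$ ($B$ a $d$-dimensional Brownian motion independent of $S$), whose Lévy exponent is $\phi(|\xi|^2)$. Put $\psi(r)=\phi(r^2)$ and $\rho(r)=1/\psi(r^{-1})$ for $r>0$. A measurable $f:(0,\infty)\to(0,\infty)$ is slowly varying at infinity if $\lim_{x\to\infty}f(bx)/f(x)=1$ for all $b>0$. For $s\ge0$ the generalized Hölder space $C^s_\rho$ consists of the measurable functions $f$ on $\mathbb{R}^d$ with finite norm $\|f\|_{C^s_\rho}=\|f\|_\infty+\sup_{x\ne y}\frac{|f(x)-f(y)|}{\rho^s(|x-y|)}$, where $\rho^s=(\rho)^s$ (for $s=0$ this norm is equivalent to the sup norm). *)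

theory Defs
  imports "HOL-Analysis.Analysis"
begin

definition levy_measure :: "real measure \<Rightarrow> bool" where
  "levy_measure \<nu> \<longleftrightarrow>
     sets \<nu> = sets (restrict_space borel {0<..}) \<and>
     (\<integral>\<^sup>+ t. ennreal (min 1 t) \<partial>\<nu>) < \<infinity>"

text \<open>The Laplace exponent of the driftless subordinator with Levy measure \<open>\<nu>\<close>,
  given by the Levy--Khintchine formula.\<close>

definition laplace_exponent :: "real measure \<Rightarrow> real \<Rightarrow> real" where
  "laplace_exponent \<nu> s = (\<integral>t. (1 - exp (- s * t)) \<partial>\<nu>)"

definition psi :: "real measure \<Rightarrow> real \<Rightarrow> real" where
  "psi \<nu> r = laplace_exponent \<nu> (r\<^sup>2)"

definition rho :: "real measure \<Rightarrow> real \<Rightarrow> real" where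
  "rho \<nu> r = 1 / psi \<nu> (inverse r)"

text \<open>The jump kernel on \<open>\<real>\<^sup>d\<close>, where \<open>d\<close> is the dimension of the type \<open>'a\<close>. At \<open>z = 0\<close> the
  defining integral may diverge, in which case the Bochner integral is \<open>0\<close>; this affects only a
  Lebesgue null set.\<close>

definition jump_kernel :: "real measure \<Rightarrow> 'a::euclidean_space \<Rightarrow> real" where
  "jump_kernel \<nu> z =
     (\<integral>t. (4 * pi * t) powr (- (real DIM('a) / 2)) * exp (- (norm z)\<^sup>2 / (4 * t)) \<partial>\<nu>)"

definition slowly_varying_at_infinity :: "(real \<Rightarrow> real) \<Rightarrow> bool" where
  "slowly_varying_at_infinity f \<longleftrightarrow>
     f \<in> borel_measurable (restrict_space borel {0<..}) \<and>
     (\<forall>x>0. f x > 0) \<and>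
     (\<forall>b>0. ((\<lambda>x. f (b * x) / f x) \<longlongrightarrow> 1) at_top)"

text \<open>The norm takes values in \<open>[0, \<infinity>]\<close>, so that the suprema are meaningful for every function.\<close>

definition holder_norm ::
  "(real \<Rightarrow> real) \<Rightarrow> real \<Rightarrow> ('a::euclidean_space \<Rightarrow> real) \<Rightarrow> ennreal" where
  "holder_norm \<rho> s f =
     (SUP x. ennreal \<bar>f x\<bar>) +
     (SUP (x, y)\<in>{(x, y). x \<noteq> y}. ennreal (\<bar>f x - f y\<bar> / \<rho> (norm (x - y)) powr s))"

definition holder_space ::
  "(real \<Rightarrow> real) \<Rightarrow> real \<Rightarrow> ('a::euclidean_space \<Rightarrow> real) set" where
  "holder_space \<rho> s = {f. f \<in> borel_measurable borel \<and> holder_norm \<rho> s f < \<infinity>}"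

definition nonlocal_integrand ::
  "real measure \<Rightarrow> ('a::euclidean_space \<Rightarrow> 'a \<Rightarrow> real) \<Rightarrow> ('a \<Rightarrow> real) \<Rightarrow> 'a \<Rightarrow> 'a \<Rightarrow> real" where
  "nonlocal_integrand \<nu> a u x z = (u (x + z) - u x) * a x z * jump_kernel \<nu> z"

definition nonlocal_op ::
  "real measure \<Rightarrow> ('a::euclidean_space \<Rightarrow> 'a \<Rightarrow> real) \<Rightarrow> ('a \<Rightarrow> real) \<Rightarrow> 'a \<Rightarrow> real" where
  "nonlocal_op \<nu> a u x = (\<integral>z. nonlocal_integrand \<nu> a u x z \<partial>lborel)"

text \<open>Convergence of the integral defining the operator is part of being a solution, because the
  Bochner integral of a non-integrable function is \<open>0\<close>.\<close>

definition poisson_solution ::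
  "real measure \<Rightarrow> ('a::euclidean_space \<Rightarrow> 'a \<Rightarrow> real) \<Rightarrow> real \<Rightarrow> ('a \<Rightarrow> real) \<Rightarrow> ('a \<Rightarrow> real) \<Rightarrow> bool"
where
  "poisson_solution \<nu> a l f u \<longleftrightarrow>
     (\<forall>x. integrable lborel (nonlocal_integrand \<nu> a u x) \<and> l * u x - nonlocal_op \<nu> a u x = f x)"

definition admissible_coefficient ::
  "(real \<Rightarrow> real) \<Rightarrow> real \<Rightarrow> real \<Rightarrow> real \<Rightarrow> ('a::euclidean_space \<Rightarrow> 'a \<Rightarrow> real) \<Rightarrow> bool" where
  "admissible_coefficient \<rho> \<rho>0 c0 \<alpha> a \<longleftrightarrow>
     (\<lambda>(x, z). a x z) \<in> borel_measurable (borel \<Otimes>\<^sub>M borel) \<and>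
     (\<forall>x z. norm z < \<rho>0 \<longrightarrow> a x z \<ge> c0) \<and>
     (\<forall>z. holder_norm \<rho> \<alpha> (\<lambda>x. a x z) \<le> ennreal (inverse c0))"

end

theory Submission
  imports Defs
begin

text \<open>
  The equation is solved by a discrete maximum principle in which two copies of the jump process
  are coupled. Write \<open>H r = \<phi> (1 / r\<^sup>2) = 1 / \<rho> r\<close>; for small \<open>r\<close> this is, up to constants, the
  mass that the jump kernel \<open>J\<close> gives to jumps longer than \<open>r\<close>. Slow variation says that
  changing \<open>r\<close> by a constant factor changes \<open>H r\<close> by a factor close to one, so that almost all
  of this mass sits on jumps much longer than \<open>r\<close>. Seen from two points at distance \<open>r\<close>, such a
  jump can be made to end at the same point: the heat kernel at time \<open>t\<close> and its translate by
  \<open>r\<close> differ in total variation by a multiple of \<open>r / sqrt t\<close> only (\<open>heat_shift_integral\<close>,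
  \<open>jump_part_coupling\<close>). Two copies that start at distance \<open>r\<close> hence merge at a rate comparable
  with \<open>H r\<close>, while the shorter jumps hardly change their distance on the scale of the modulus.
  For \<open>l u - L u = f\<close> with \<open>|f x - f y| \<le> F \<rho> r powr \<beta>\<close> this suggests, with \<open>r = |x - y|\<close>, \<open>|u x
  - u y| \<le> F M0 \<rho> r powr \<beta> / (l + H r)\<close>. As \<open>1 / (l + H r)\<close> is at most both \<open>1 / l\<close> and \<open>\<rho> r\<close>,
  this single modulus, called \<open>barrier\<close> below, yields both terms of the asserted estimate.

  The heuristic becomes a proof as follows. Keeping only the jumps of the subordinator larger
  than \<open>e\<^sup>2\<close> gives an operator \<open>L e\<close> with a kernel of finite mass. For small \<open>\<tau>\<close> the map \<open>v \<mapsto> v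
  + \<tau> (f - l v + L e v)\<close> is a contraction in the supremum norm; its fixed point solves the
  truncated equation. The map also preserves the set of functions with modulus \<open>barrier\<close>,
  provided the barrier is a supersolution of the coupled equation (\<open>jump_op_diff_le\<close>,
  \<open>euler_step_modulus\<close>). In the difference \<open>L e v x - L e v y\<close> the part \<open>\<kappa>\<close> of the kernel that
  is carried by the long jumps is coupled; the rest of \<open>min (a x z) (a y z) J z\<close> moves both
  points by the same \<open>z\<close> and, as the maximum principle shows, cannot push the difference above
  the modulus; and the excess \<open>|a x z - a y z| J z\<close> is controlled by the Hoelder regularity of
  \<open>a\<close> in \<open>x\<close>. The coefficient may be negative for \<open>|z| \<ge> \<rho>0\<close>, but there the kernel has finite
  mass, which \<open>l \<ge> 2 l0\<close> absorbs. That the barrier is a supersolution, with constants that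
  depend neither on \<open>e\<close> nor on \<open>l\<close> nor on the coefficient, is \<open>uniform_barrier_exists\<close>.

  Finally \<open>e\<close> tends to \<open>0\<close>. On functions with increments bounded by \<open>\<rho> powr (1 + \<alpha>)\<close> the
  truncation changes the operator by at most a multiple of the integral of \<open>\<rho> (sqrt t) powr (1 +
  \<alpha>)\<close> against the Levy measure over \<open>t \<le> e\<^sup>2\<close> (\<open>truncation_error\<close>). The integral over all \<open>t\<close> is
  finite because \<open>\<alpha> > 0\<close> (\<open>nn_integral_R_sqrt_finite\<close>), so this error vanishes. Together with
  the supremum bound for the truncated equations it makes the truncated solutions a Cauchy
  sequence, whose limit is the solution, and it makes the solution unique.
\<close>

section \<open>The heat kernel\<close>

lemma nn_integral_scaleR:
  fixes f :: "'a::euclidean_space \<Rightarrow> ennreal"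
  assumes [measurable]: "f \<in> borel_measurable borel" and c: "c > 0"
  shows "(\<integral>\<^sup>+z. f z \<partial>lborel) = ennreal (c ^ DIM('a)) * (\<integral>\<^sup>+z. f (c *\<^sub>R z) \<partial>lborel)"
  using c by (subst lborel_affine[of c 0])
     (simp_all add: nn_integral_density nn_integral_distr nn_integral_cmult)

lemma nn_integral_cmult_ennreal:
  assumes "c \<ge> 0" and [measurable]: "f \<in> borel_measurable M"
  shows "ennreal c * (\<integral>\<^sup>+z. ennreal (f z) \<partial>M) = (\<integral>\<^sup>+z. ennreal (c * f z) \<partial>M)"
proof -
  have "(\<integral>\<^sup>+z. ennreal (c * f z) \<partial>M) = (\<integral>\<^sup>+z. ennreal c * ennreal (f z) \<partial>M)"
    using assms(1) by (intro nn_integral_cong) (simp add: ennreal_mult')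
  also have "\<dots> = ennreal c * (\<integral>\<^sup>+z. ennreal (f z) \<partial>M)"
    by (intro nn_integral_cmult) simp
  finally show ?thesis by simp
qed

lemma power_le_fact_exp:
  fixes x :: real
  assumes "x \<ge> 0"
  shows "x ^ n \<le> fact n * exp x"
proof -
  have "x ^ n / fact n \<le> (\<Sum>k. x ^ k / fact k)"
  proof -
    have "(\<lambda>k. x ^ k / fact k) sums exp x"
      using exp_converges[of x] by (simp add: field_simps scaleR_conv_of_real)
    then have "sum (\<lambda>k. x ^ k / fact k) {n} \<le> (\<Sum>k. x ^ k / fact k)"
      using assms by (intro sum_le_suminf) (auto simp: sums_iff)
    then show ?thesis by simp
  qed
  also have "\<dots> = exp x"
    using exp_converges[of x] by (simp add: field_simps scaleR_conv_of_real sums_iff)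
  finally show ?thesis by (simp add: field_simps)
qed

text \<open>
  Integrability is checked on the unit shells \<open>n \<le> |z| < n + 1\<close>: the ball containing such a
  shell has volume polynomial in \<open>n\<close>.
\<close>

lemma nn_integral_exp_neg_norm_finite:
  "(\<integral>\<^sup>+(z::'a::euclidean_space). ennreal (exp (- norm z)) \<partial>lborel) < \<infinity>"
proof -
  let ?d = "DIM('a)"
  let ?V = "unit_ball_vol (real ?d)"
  let ?c = "\<lambda>n. ?V * exp 1 * fact (?d + 2) * (1 / real (Suc n) ^ 2)"
  have pt: "ennreal (exp (- norm z)) \<le> (\<Sum>n. ennreal (exp (- real n)) * indicator (cball 0 (real (Suc n))) z)"
    for z :: 'a
  proof -
    let ?f = "\<lambda>n. ennreal (exp (- real n)) * indicator (cball 0 (real (Suc n))) z"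
    define n where "n = nat \<lfloor>norm z\<rfloor>"
    have n: "real n \<le> norm z" "norm z \<le> real (Suc n)"
      unfolding n_def by (auto simp: of_nat_nat) linarith
    define F where "F = ?f"
    have "ennreal (exp (- norm z)) \<le> F n"
      using n by (simp add: ennreal_leI F_def)
    also have "\<dots> = sum F {n}" by simp
    also have "\<dots> \<le> (\<Sum>n. F n)"
      by (intro sum_le_suminf) auto
    finally show ?thesis unfolding F_def .
  qed
  have "(\<integral>\<^sup>+(z::'a). ennreal (exp (- norm z)) \<partial>lborel) \<le>
     (\<integral>\<^sup>+(z::'a). (\<Sum>n. ennreal (exp (- real n)) * indicator (cball 0 (real (Suc n))) z) \<partial>lborel)"
    by (intro nn_integral_mono pt)
  also have "\<dots> = (\<Sum>n. ennreal (exp (- real n)) * emeasure lborel (cball (0::'a) (real (Suc n))))"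
    by (subst nn_integral_suminf)
       (auto simp: nn_integral_cmult_indicator intro!: borel_measurable_times_ennreal borel_measurable_indicator)
  also have "\<dots> = (\<Sum>n. ennreal (exp (- real n) * (?V * real (Suc n) ^ ?d)))"
    by (intro suminf_cong) (simp add: emeasure_cball ennreal_mult del: of_nat_Suc)
  also have "\<dots> \<le> (\<Sum>n. ennreal (?c n))"
  proof (intro suminf_le ennreal_leI)
    fix n
    have "real (Suc n) ^ (?d + 2) \<le> fact (?d + 2) * exp (real (Suc n))"
      by (intro power_le_fact_exp) simp
    then have "real (Suc n) ^ ?d * real (Suc n) ^ 2 \<le> fact (?d + 2) * (exp 1 * exp (real n))"
      unfolding power_add by (simp add: exp_add [symmetric])
    then have "exp (- real n) * real (Suc n) ^ ?d \<le> exp 1 * fact (?d + 2) * (1 / real (Suc n) ^ 2)"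
      by (simp add: exp_minus field_simps del: of_nat_Suc fact_Suc)
    then have "?V * (exp (- real n) * real (Suc n) ^ ?d) \<le> ?V * (exp 1 * fact (?d + 2) * (1 / real (Suc n) ^ 2))"
      by (intro mult_left_mono) auto
    then show "exp (- real n) * (?V * real (Suc n) ^ ?d) \<le> ?c n"
      by (simp only: mult_ac)
  qed auto
  also have "\<dots> < \<infinity>"
  proof -
    have "summable (\<lambda>n. 1 / real (Suc n) ^ 2)"
      using inverse_power_summable[of 2, where 'a=real]
      by (subst summable_Suc_iff) (simp add: field_simps)
    then have "summable ?c" by (intro summable_mult)
    then have "(\<Sum>n. ennreal (?c n)) = ennreal (\<Sum>n. ?c n)"
      by (intro suminf_ennreal2) auto
    then show ?thesis by simp
  qed
  finally show ?thesis .
qed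

lemma nn_integral_gauss_moment_finite:
  "(\<integral>\<^sup>+(z::'a::euclidean_space). ennreal (max 1 (norm z) ^ p * exp (- (norm z)\<^sup>2 / 8)) \<partial>lborel) < \<infinity>"
proof -
  have "max 1 (norm z) ^ p * exp (- (norm z)\<^sup>2 / 8) \<le> fact p * exp 9 * exp (- norm z)" for z :: 'a
  proof -
    have "max 1 (norm z) ^ p \<le> fact p * exp (max 1 (norm z))"
      by (intro power_le_fact_exp) auto
    also have "\<dots> \<le> fact p * exp (1 + norm z)"
      by (intro mult_left_mono) auto
    finally have "max 1 (norm z) ^ p * exp (- (norm z)\<^sup>2 / 8) \<le> fact p * exp (1 + norm z) * exp (- (norm z)\<^sup>2 / 8)"
      by (intro mult_right_mono) auto
    also have "\<dots> = fact p * exp (1 + norm z - (norm z)\<^sup>2 / 8)"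
      by (simp add: exp_add [symmetric])
    also have "\<dots> \<le> fact p * exp (9 + - norm z)"
    proof -
      have "(norm z - 8)\<^sup>2 \<ge> 0" by simp
      then have "1 + norm z - (norm z)\<^sup>2 / 8 \<le> 9 + - norm z"
        by (simp add: power2_eq_square field_simps)
      then show ?thesis by (intro mult_left_mono) auto
    qed
    finally show ?thesis by (simp only: exp_add mult.assoc)
  qed
  then have "(\<integral>\<^sup>+(z::'a). ennreal (max 1 (norm z) ^ p * exp (- (norm z)\<^sup>2 / 8)) \<partial>lborel)
     \<le> (\<integral>\<^sup>+(z::'a). ennreal (fact p * exp 9) * ennreal (exp (- norm z)) \<partial>lborel)"
    by (intro nn_integral_mono) (simp add: ennreal_mult' [symmetric])
  also have "\<dots> < \<infinity>"
    using nn_integral_exp_neg_norm_finite[where 'a='a]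
    by (simp add: nn_integral_cmult ennreal_mult_less_top)
  finally show ?thesis .
qed

text \<open>
  The density at time \<open>t\<close> of the diffusion \<open>sqrt 2 B\<close>, which has variance \<open>2 t\<close> in each
  coordinate.
\<close>

definition heat :: "real \<Rightarrow> 'a::euclidean_space \<Rightarrow> real" where
  "heat t z = (4 * pi * t) powr (- (real DIM('a) / 2)) * exp (- (norm z)\<^sup>2 / (4 * t))"

lemma heat_nonneg [simp]: "heat t z \<ge> 0"
  by (simp add: heat_def)

lemma heat_measurable [measurable]:
  "(\<lambda>(t, z::'a::euclidean_space). heat t z) \<in> borel_measurable (borel \<Otimes>\<^sub>M borel)"
  unfolding heat_def by measurable

lemma heat_measurable_comp [measurable (raw)]:
  assumes [measurable]: "f \<in> borel_measurable M" "g \<in> borel_measurable M"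
  shows "(\<lambda>x. heat (f x) (g x :: 'a::euclidean_space)) \<in> borel_measurable M"
  using measurable_compose[OF measurable_Pair[OF assms] heat_measurable] by simp

lemma heat_scaleR:
  fixes y :: "'a::euclidean_space"
  assumes t: "t > 0"
  shows "sqrt t ^ DIM('a) * heat t (sqrt t *\<^sub>R y) = heat 1 y"
proof -
  have "sqrt t ^ DIM('a) = t powr (real DIM('a) / 2)"
    using t by (simp add: powr_half_sqrt [symmetric] powr_realpow [symmetric] powr_powr)
  moreover have "(4 * pi * t) powr (- (real DIM('a) / 2)) =
      (4 * pi) powr (- (real DIM('a) / 2)) * t powr (- (real DIM('a) / 2))"
    using t by (subst powr_mult) auto
  ultimately show ?thesis
    using t by (simp add: heat_def powr_minus power_mult_distrib field_simps)
qed

lemma nn_integral_heat_scale: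
  fixes g :: "'a::euclidean_space \<Rightarrow> real"
  assumes [measurable]: "g \<in> borel_measurable borel" and t: "t > 0"
  shows "(\<integral>\<^sup>+z. ennreal (g z * heat t z) \<partial>lborel) = (\<integral>\<^sup>+z. ennreal (g (sqrt t *\<^sub>R z) * heat 1 z) \<partial>lborel)"
proof -
  have "(\<integral>\<^sup>+z. ennreal (g z * heat t z) \<partial>lborel) =
     ennreal (sqrt t ^ DIM('a)) * (\<integral>\<^sup>+z. ennreal (g (sqrt t *\<^sub>R z) * heat t (sqrt t *\<^sub>R z)) \<partial>lborel)"
    using t by (intro nn_integral_scaleR) auto
  also have "\<dots> = (\<integral>\<^sup>+z. ennreal (g (sqrt t *\<^sub>R z) * (sqrt t ^ DIM('a) * heat t (sqrt t *\<^sub>R z))) \<partial>lborel)"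
    using t by (subst nn_integral_cmult_ennreal) (simp_all add: mult.left_commute)
  also have "\<dots> = (\<integral>\<^sup>+z. ennreal (g (sqrt t *\<^sub>R z) * heat 1 z) \<partial>lborel)"
    using t by (simp add: heat_scaleR)
  finally show ?thesis .
qed

lemma heat_1_le: "heat 1 (z::'a::euclidean_space) \<le> exp (- (norm z)\<^sup>2 / 8)"
proof -
  have "(4 * pi) powr (- (real DIM('a) / 2)) \<le> (4 * pi) powr 0"
    using pi_gt3 by (intro powr_mono) auto
  then have "heat 1 z \<le> 1 * exp (- (norm z)\<^sup>2 / (4 * 1))"
    using pi_gt3 unfolding heat_def by (intro mult_right_mono) auto
  also have "\<dots> \<le> exp (- (norm z)\<^sup>2 / 8)" by simp
  finally show ?thesis .
qed

text \<open>
  By scaling, \<open>heat_moment TYPE('a) 0\<close> is the mass of the heat kernel at every time, and the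
  higher moments bound the integrals of functions of \<open>|z| / sqrt t\<close> uniformly in \<open>t\<close>.
\<close>

definition heat_moment :: "'a::euclidean_space itself \<Rightarrow> nat \<Rightarrow> real" where
  "heat_moment _ p = enn2real (\<integral>\<^sup>+(z::'a). ennreal (max 1 (norm z) ^ p * heat 1 z) \<partial>lborel)"

lemma heat_moment:
  "(\<integral>\<^sup>+(z::'a::euclidean_space). ennreal (max 1 (norm z) ^ p * heat 1 z) \<partial>lborel) = ennreal (heat_moment TYPE('a) p)"
  and heat_moment_nonneg [simp]: "heat_moment TYPE('a) p \<ge> 0"
proof -
  have "(\<integral>\<^sup>+(z::'a). ennreal (max 1 (norm z) ^ p * heat 1 z) \<partial>lborel) \<le>
      (\<integral>\<^sup>+(z::'a::euclidean_space). ennreal (max 1 (norm z) ^ p * exp (- (norm z)\<^sup>2 / 8)) \<partial>lborel)"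
    by (intro nn_integral_mono ennreal_leI mult_left_mono heat_1_le) auto
  also have "\<dots> < \<infinity>" by (rule nn_integral_gauss_moment_finite)
  finally show "(\<integral>\<^sup>+(z::'a::euclidean_space). ennreal (max 1 (norm z) ^ p * heat 1 z) \<partial>lborel) = ennreal (heat_moment TYPE('a) p)"
    by (simp add: heat_moment_def ennreal_enn2real_if less_top)
qed (simp add: heat_moment_def)

lemma heat_moment_scaled:
  assumes t: "t > 0"
  shows "(\<integral>\<^sup>+(z::'a::euclidean_space). ennreal (max 1 (norm z / sqrt t) ^ p * heat t z) \<partial>lborel) = ennreal (heat_moment TYPE('a) p)"
  using t by (subst nn_integral_heat_scale) (auto simp: heat_moment)

lemma heat_mass:
  assumes t: "t > 0"
  shows "(\<integral>\<^sup>+(z::'a::euclidean_space). ennreal (heat t z) \<partial>lborel) = ennreal (heat_moment TYPE('a) 0)"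
  using heat_moment_scaled[OF t, where p=0 and 'a='a] by simp

lemma heat_mass_pos: "heat_moment TYPE('a::euclidean_space) 0 > 0"
proof (rule ccontr)
  assume "\<not> ?thesis"
  then have "heat_moment TYPE('a) 0 = 0" using heat_moment_nonneg[where 'a='a, of 0] by linarith
  then have "(\<integral>\<^sup>+(z::'a). ennreal (heat 1 z) \<partial>lborel) = 0" by (simp add: heat_mass)
  then have "AE z::'a in lborel. ennreal (heat 1 z) = 0"
    by (subst (asm) nn_integral_0_iff_AE) auto
  moreover have "heat 1 z > 0" for z :: 'a
    by (simp add: heat_def)
  then have "ennreal (heat 1 z) \<noteq> 0" for z :: 'a
    by (simp add: ennreal_eq_0_iff not_le)
  ultimately have "AE z::'a in lborel. False" by simp
  then have "emeasure lborel (UNIV::'a set) = 0"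
    using ae_filter_eq_bot_iff[of "lborel :: 'a measure"] by (simp add: trivial_limit_def)
  then show False by simp
qed

text \<open>
  The mean value bound for \<open>exp\<close>, together with \<open>|y + e|\<^sup>2 \<ge> |y|\<^sup>2 / 2 - |e|\<^sup>2\<close>, which keeps the
  Gaussian decay at the translated point.
\<close>

lemma heat_1_shift_bound:
  fixes y e :: "'a::euclidean_space"
  assumes e: "norm e \<le> 1"
  shows "\<bar>heat 1 y - heat 1 (y + e)\<bar> \<le> norm e * (2 * (max 1 (norm y) * exp (- (norm y)\<^sup>2 / 8)))"
proof -
  let ?a = "(norm y)\<^sup>2 / 4" and ?b = "(norm (y + e))\<^sup>2 / 4"
  let ?m = "exp (1/4 - (norm y)\<^sup>2 / 8)"
  have C: "(4 * pi) powr (- (real DIM('a) / 2)) \<le> 1"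
  proof -
    have "(4 * pi) powr (- (real DIM('a) / 2)) \<le> (4 * pi) powr 0"
      using pi_gt3 by (intro powr_mono) auto
    then show ?thesis using pi_gt3 by simp
  qed
  have lip: "\<bar>exp (- a) - exp (- b)\<bar> \<le> \<bar>a - b\<bar> * m"
    if "exp (- a) \<le> m" "exp (- b) \<le> m" for a b m :: real
  proof -
    have *: "exp (- a) - exp (- b) \<le> \<bar>a - b\<bar> * exp (- a)" for a b :: real
    proof -
      have "1 - exp (a - b) \<le> b - a"
        using exp_ge_add_one_self[of "a - b"] by linarith
      also have "\<dots> \<le> \<bar>a - b\<bar>" by linarith
      finally have "(1 - exp (a - b)) * exp (- a) \<le> \<bar>a - b\<bar> * exp (- a)"
        by (intro mult_right_mono) auto
      then show ?thesis by (simp add: left_diff_distrib exp_add [symmetric])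
    qed
    have "\<bar>a - b\<bar> * exp (- a) \<le> \<bar>a - b\<bar> * m" "\<bar>a - b\<bar> * exp (- b) \<le> \<bar>a - b\<bar> * m"
      using that by (auto intro: mult_left_mono)
    then show ?thesis using *[of a b] *[of b a] by (simp add: abs_minus_commute)
  qed
  have tri: "norm (y + e) \<ge> norm y - norm e" "norm (y + e) \<le> norm y + norm e"
    using norm_diff_ineq[of y e] norm_triangle_ineq[of y e] by auto
  have "(norm y)\<^sup>2 \<le> (norm (y + e) + norm e)\<^sup>2"
    using tri by (intro power_mono) auto
  also have "\<dots> \<le> 2 * (norm (y + e))\<^sup>2 + 2 * (norm e)\<^sup>2"
    using sum_squares_bound[of "norm (y + e)" "norm e"] by (simp add: power2_sum)
  also have "(norm e)\<^sup>2 \<le> 1"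
    using e by (simp add: power_le_one)
  finally have b: "exp (- ?b) \<le> ?m" by simp
  have "- ?a \<le> 1/4 - (norm y)\<^sup>2 / 8"
    using zero_le_power2[of "norm y"] by linarith
  then have a: "exp (- ?a) \<le> ?m" by simp
  have ab: "\<bar>?a - ?b\<bar> \<le> norm e * (3 * max 1 (norm y) / 4)"
  proof -
    have "\<bar>(norm y)\<^sup>2 - (norm (y + e))\<^sup>2\<bar> = \<bar>norm y - norm (y + e)\<bar> * (norm y + norm (y + e))"
    proof -
      have "(norm y)\<^sup>2 - (norm (y + e))\<^sup>2 = (norm y - norm (y + e)) * (norm y + norm (y + e))"
        by algebra
      then show ?thesis by (simp only: abs_mult abs_of_nonneg[OF add_nonneg_nonneg[OF norm_ge_zero norm_ge_zero]])
    qed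
    also have "\<dots> \<le> norm e * (3 * max 1 (norm y))"
      using tri e by (intro mult_mono) auto
    finally show ?thesis by (simp add: field_simps)
  qed
  have "\<bar>heat 1 y - heat 1 (y + e)\<bar> = (4 * pi) powr (- (real DIM('a) / 2)) * \<bar>exp (- ?a) - exp (- ?b)\<bar>"
    by (simp add: heat_def right_diff_distrib [symmetric] abs_mult)
  also have "\<dots> \<le> 1 * (\<bar>?a - ?b\<bar> * ?m)"
    using lip[OF a b] C by (intro mult_mono) auto
  also have "\<dots> \<le> norm e * (3 * max 1 (norm y) / 4) * ?m"
    using ab by (simp add: mult_right_mono)
  also have "?m = exp (1/4) * exp (- (norm y)\<^sup>2 / 8)"
    by (simp add: exp_add [symmetric])
  also have "norm e * (3 * max 1 (norm y) / 4) * (exp (1/4) * exp (- (norm y)\<^sup>2 / 8)) \<le>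
     norm e * (3 * max 1 (norm y) / 4) * (2 * exp (- (norm y)\<^sup>2 / 8))"
  proof -
    have "exp (1/4::real) \<le> 1 + 1/4 + (1/4)\<^sup>2" by (rule exp_bound) auto
    then have "exp (1/4::real) \<le> 2" by (simp add: power2_eq_square)
    then show ?thesis by (intro mult_left_mono mult_right_mono) auto
  qed
  also have "\<dots> \<le> norm e * (2 * (max 1 (norm y) * exp (- (norm y)\<^sup>2 / 8)))"
    by (simp add: field_simps mult_left_mono mult_nonneg_nonneg)
  finally show ?thesis .
qed

text \<open>
  This is the estimate behind the coupling: mass moved by a displacement at time \<open>t\<close> almost
  forgets a shift of the starting point that is short compared with \<open>sqrt t\<close>. The weight makes
  it applicable to a modulus of at most linear growth in place of a constant.
\<close>

lemma heat_shift_integral: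
  obtains C where "C > 0"
    "\<And>t h. t > 0 \<Longrightarrow> norm h \<le> sqrt t \<Longrightarrow>
      (\<integral>\<^sup>+(z::'a::euclidean_space). ennreal (max 1 (norm z / sqrt t) * \<bar>heat t z - heat t (z + h)\<bar>) \<partial>lborel)
        \<le> ennreal (C * (norm h / sqrt t))"
proof -
  define I where "I = (\<integral>\<^sup>+(z::'a). ennreal (max 1 (norm z) ^ 2 * exp (- (norm z)\<^sup>2 / 8)) \<partial>lborel)"
  define C where "C = 2 * enn2real I + 1"
  have I: "I = ennreal (enn2real I)"
    using nn_integral_gauss_moment_finite[of 2, where 'a='a] by (simp add: I_def ennreal_enn2real_if less_top)
  have "(\<integral>\<^sup>+(z::'a). ennreal (max 1 (norm z / sqrt t) * \<bar>heat t z - heat t (z + h)\<bar>) \<partial>lborel)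
        \<le> ennreal (C * (norm h / sqrt t))" if t: "t > 0" and h: "norm h \<le> sqrt t" for t h
  proof -
    define e where "e = h /\<^sub>R sqrt t"
    have e: "norm e = norm h / sqrt t" "norm e \<le> 1" and h_e: "h = sqrt t *\<^sub>R e"
      using t h by (auto simp: e_def field_simps)
    have "(\<integral>\<^sup>+(z::'a). ennreal (max 1 (norm z / sqrt t) * \<bar>heat t z - heat t (z + h)\<bar>) \<partial>lborel)
       = ennreal (sqrt t ^ DIM('a)) * (\<integral>\<^sup>+(z::'a). ennreal (max 1 (norm (sqrt t *\<^sub>R z) / sqrt t) * \<bar>heat t (sqrt t *\<^sub>R z) - heat t (sqrt t *\<^sub>R z + h)\<bar>) \<partial>lborel)"
      using t by (intro nn_integral_scaleR) auto
    also have "\<dots> = (\<integral>\<^sup>+(z::'a). ennreal (sqrt t ^ DIM('a) * (max 1 (norm (sqrt t *\<^sub>R z) / sqrt t) * \<bar>heat t (sqrt t *\<^sub>R z) - heat t (sqrt t *\<^sub>R z + h)\<bar>)) \<partial>lborel)"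
      using t by (intro nn_integral_cmult_ennreal) auto
    also have "\<dots> = (\<integral>\<^sup>+(z::'a). ennreal (max 1 (norm z) * \<bar>heat 1 z - heat 1 (z + e)\<bar>) \<partial>lborel)"
    proof (intro nn_integral_cong)
      fix z :: 'a
      have "sqrt t ^ DIM('a) * \<bar>heat t (sqrt t *\<^sub>R z) - heat t (sqrt t *\<^sub>R z + h)\<bar> =
        \<bar>sqrt t ^ DIM('a) * heat t (sqrt t *\<^sub>R z) - sqrt t ^ DIM('a) * heat t (sqrt t *\<^sub>R (z + e))\<bar>"
        using t by (simp add: h_e right_diff_distrib [symmetric] abs_mult scaleR_right_distrib)
      then show "ennreal (sqrt t ^ DIM('a) * (max 1 (norm (sqrt t *\<^sub>R z) / sqrt t) * \<bar>heat t (sqrt t *\<^sub>R z) - heat t (sqrt t *\<^sub>R z + h)\<bar>))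
         = ennreal (max 1 (norm z) * \<bar>heat 1 z - heat 1 (z + e)\<bar>)"
        using t by (simp add: heat_scaleR mult.left_commute)
    qed
    also have "\<dots> \<le> (\<integral>\<^sup>+(z::'a). ennreal (2 * norm e) * ennreal (max 1 (norm z) ^ 2 * exp (- (norm z)\<^sup>2 / 8)) \<partial>lborel)"
    proof (intro nn_integral_mono)
      fix z :: 'a
      have "max 1 (norm z) * \<bar>heat 1 z - heat 1 (z + e)\<bar> \<le> max 1 (norm z) * (norm e * (2 * (max 1 (norm z) * exp (- (norm z)\<^sup>2 / 8))))"
        using heat_1_shift_bound[OF e(2), of z] by (intro mult_left_mono) auto
      then show "ennreal (max 1 (norm z) * \<bar>heat 1 z - heat 1 (z + e)\<bar>) \<le> ennreal (2 * norm e) * ennreal (max 1 (norm z) ^ 2 * exp (- (norm z)\<^sup>2 / 8))"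
        by (simp add: ennreal_mult' [symmetric] power2_eq_square mult_ac ennreal_leI)
    qed
    also have "\<dots> = ennreal (2 * norm e) * I"
      unfolding I_def by (intro nn_integral_cmult) auto
    also have "\<dots> \<le> ennreal (C * norm e)"
      by (subst I) (auto simp: ennreal_mult' [symmetric] C_def algebra_simps intro!: ennreal_leI)
    finally show ?thesis by (simp add: e)
  qed
  then show ?thesis by (intro that[of C]) (auto simp: C_def add_nonneg_pos)
qed

section \<open>The Laplace exponent and its slow variation\<close>

lemma dyadic_level:
  fixes x :: real
  assumes "0 < x" "x \<le> 1"
  obtains n where "(1/2) ^ Suc n < x" "x \<le> (1/2) ^ n"
proof -
  obtain m where m: "(1/2) ^ m < x"
    using real_arch_pow_inv[of x "1/2"] assms by auto
  define n where "n = (LEAST m. (1/2) ^ m < x)"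
  have n: "(1/2) ^ n < x" unfolding n_def by (rule LeastI[of _ m]) (rule m)
  then have "n \<noteq> 0" using assms by (cases n) auto
  then obtain k where k: "n = Suc k" by (cases n) auto
  have "\<not> (1/2) ^ k < x"
    using not_less_Least[of k "\<lambda>m. (1/2) ^ m < x"] k unfolding n_def by auto
  then show ?thesis using n k that[of k] by auto
qed

lemma ennreal_le_suminf:
  fixes F :: "nat \<Rightarrow> ennreal"
  shows "F n \<le> (\<Sum>n. F n)"
proof -
  have "F n = sum F {n}" by simp
  also have "\<dots> \<le> (\<Sum>n. F n)" by (intro sum_le_suminf) auto
  finally show ?thesis .
qed

lemma one_minus_exp_scale:
  fixes c x :: real
  assumes "c \<ge> 1" "x \<ge> 0"
  shows "1 - exp (- (c * x)) \<le> c * (1 - exp (- x))"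
proof -
  have "c * x \<ge> x" using assms by (simp add: mult_right_mono[of 1 c x, simplified])
  define f where "f = (\<lambda>c::real. c * (1 - exp (- x)) - (1 - exp (- (c * x))))"
  have "exp (- (c * x)) = exp (- x) * exp (- ((c - 1) * x))"
    by (simp add: exp_add [symmetric] algebra_simps)
  moreover have "exp (- ((c - 1) * x)) \<ge> 1 - (c - 1) * x"
    using exp_ge_add_one_self[of "- ((c - 1) * x)"] by simp
  moreover have "exp (- x) * exp x = 1" by (simp add: exp_add [symmetric])
  moreover have "exp (- x) * (1 + x) \<le> exp (- x) * exp x"
    using exp_ge_add_one_self[of x] by (intro mult_left_mono) auto
  ultimately have *: "exp (- x) * (1 + x) \<le> 1"
     "exp (- x) * (1 - (c - 1) * x) \<le> exp (- (c * x))"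
    by (auto intro: mult_left_mono)
  have "c * (1 - exp (- x)) - 1 + exp (- x) * (1 - (c - 1) * x) = (c - 1) * (1 - exp (- x) * (1 + x))"
    by (simp add: algebra_simps)
  also have "\<dots> \<ge> 0" using * assms by (intro mult_nonneg_nonneg) auto
  finally show ?thesis using *(2) by linarith
qed

locale slowly_varying_levy =
  fixes \<nu> :: "real measure"
  assumes levy: "levy_measure \<nu>"
    and sv: "slowly_varying_at_infinity (laplace_exponent \<nu>)"
    and phi_at_top: "filterlim (laplace_exponent \<nu>) at_top at_top"
begin

abbreviation "\<phi> \<equiv> laplace_exponent \<nu>"

lemma sets_nu: "sets \<nu> = sets (restrict_space borel {0<..})"
  using levy by (simp add: levy_measure_def)

lemma space_nu [simp]: "space \<nu> = {0<..}"
  using sets_eq_imp_space_eq[OF sets_nu] by (simp add: space_restrict_space)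

lemma measurable_ident_nu [measurable]: "(\<lambda>t. t) \<in> borel_measurable \<nu>"
  by (simp add: measurable_cong_sets[OF sets_nu refl] measurable_restrict_space1)

lemma measurable_nu: "f \<in> measurable borel M \<Longrightarrow> f \<in> measurable \<nu> M"
  using measurable_compose[OF measurable_ident_nu] by blast

lemma Ioi_sets_nu [measurable]: "s \<ge> 0 \<Longrightarrow> {s<..} \<in> sets \<nu>"
  by (auto simp: sets_nu sets_restrict_space_iff)

lemma nn_integral_min_nu: "(\<integral>\<^sup>+ t. ennreal (min 1 t) \<partial>\<nu>) < \<infinity>"
  using levy by (simp add: levy_measure_def)

lemma integrable_phi:
  assumes "s \<ge> 0"
  shows "integrable \<nu> (\<lambda>t. 1 - exp (- s * t))"
proof (rule Bochner_Integration.integrable_bound)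
  show "integrable \<nu> (\<lambda>t. (1 + s) * min 1 t)"
    by (intro integrable_mult_right integrableI_nonneg AE_I2) (use nn_integral_min_nu in auto)
  show "AE t in \<nu>. norm (1 - exp (- s * t)) \<le> norm ((1 + s) * min 1 t)"
  proof (rule AE_I2)
    fix t assume "t \<in> space \<nu>"
    then have t: "t > 0" by simp
    have "1 - exp (- (s * t)) \<le> s * t" using exp_ge_add_one_self[of "- (s * t)"] by simp
    moreover have "1 - exp (- (s * t)) \<le> 1" by simp
    moreover have "1 - exp (- (s * t)) \<ge> 0" using t assms by simp
    moreover have "s * t \<le> (1 + s) * t" "1 \<le> 1 + s" using t assms by auto
    ultimately have "1 - exp (- (s * t)) \<le> (1 + s) * min 1 t" "1 - exp (- (s * t)) \<ge> 0"
      using exp_gt_zero[of "- (s * t)"] by (auto simp: min_def simp del: exp_gt_zero)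
    then show "norm (1 - exp (- s * t)) \<le> norm ((1 + s) * min 1 t)" by simp
  qed
qed auto

lemma nn_integral_phi:
  assumes "s \<ge> 0"
  shows "(\<integral>\<^sup>+ t. ennreal (1 - exp (- s * t)) \<partial>\<nu>) = ennreal (\<phi> s)"
  unfolding laplace_exponent_def using assms
  by (intro nn_integral_eq_integral integrable_phi AE_I2) auto

lemma phi_pos: "s > 0 \<Longrightarrow> \<phi> s > 0"
  using sv by (simp add: slowly_varying_at_infinity_def)

lemma phi_mono:
  assumes "0 \<le> s" "s \<le> s'"
  shows "\<phi> s \<le> \<phi> s'"
  unfolding laplace_exponent_def
proof (intro integral_mono integrable_phi)
  fix t assume "t \<in> space \<nu>"
  then show "1 - exp (- s * t) \<le> 1 - exp (- s' * t)"
    using assms by (simp add: mult_right_mono)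
qed (use assms in auto)

text \<open>
  Concavity of \<open>\<phi>\<close>. It bounds the variation of \<open>\<phi>\<close> at all scales, also where slow variation does
  not yet help.
\<close>

lemma phi_scale:
  assumes "0 \<le> s" "c \<ge> 1"
  shows "\<phi> (c * s) \<le> c * \<phi> s"
proof -
  have "\<phi> (c * s) \<le> (\<integral>t. c * (1 - exp (- s * t)) \<partial>\<nu>)"
    unfolding laplace_exponent_def
  proof (intro integral_mono integrable_mult_right integrable_phi)
    fix t assume "t \<in> space \<nu>"
    then show "1 - exp (- (c * s) * t) \<le> c * (1 - exp (- s * t))"
      using one_minus_exp_scale[of c "s * t"] assms by (simp add: mult.assoc)
  qed (use assms in auto)
  then show ?thesis by (simp add: laplace_exponent_def)
qed

lemma tail_upper:
  assumes s: "s > 0"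
  shows "emeasure \<nu> {s<..} \<le> ennreal (2 * \<phi> (1 / s))"
proof -
  have "emeasure \<nu> {s<..} = (\<integral>\<^sup>+ t. indicator {s<..} t \<partial>\<nu>)"
    using s by simp
  also have "\<dots> \<le> (\<integral>\<^sup>+ t. 2 * ennreal (1 - exp (- (1 / s) * t)) \<partial>\<nu>)"
  proof (intro nn_integral_mono)
    fix t assume "t \<in> space \<nu>"
    have "1 \<le> 2 * (1 - exp (- (1 / s) * t))" if "t > s"
    proof -
      have "exp (- (1 / s) * t) \<le> exp (-1)" using that s by (simp add: field_simps)
      also have "exp (-1 :: real) \<le> 1 / 2"
        using exp_ge_add_one_self[of 1] by (simp add: exp_minus field_simps)
      finally have "0 \<le> 1 / 2 - exp (- (1 / s) * t)" by (simp only: le_diff_eq add_0)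
      then show ?thesis by (simp add: algebra_simps)
    qed
    moreover have "2 * ennreal (1 - exp (- (1 / s) * t)) = ennreal (2 * (1 - exp (- (1 / s) * t)))"
      by (subst ennreal_mult') auto
    ultimately show "indicator {s<..} t \<le> 2 * ennreal (1 - exp (- (1 / s) * t))"
      by (cases "t > s") (simp_all only:, simp_all)
  qed
  also have "\<dots> = 2 * ennreal (\<phi> (1 / s))"
    using s nn_integral_phi[of "1 / s"] by (subst nn_integral_cmult) auto
  also have "\<dots> = ennreal (2 * \<phi> (1 / s))"
    by (simp add: ennreal_mult')
  finally show ?thesis .
qed

lemma tail_finite: "s > 0 \<Longrightarrow> emeasure \<nu> {s<..} < \<infinity>"
  using tail_upper[of s] by (simp add: le_less_trans)

lemma tail_finite' [simp]: "s > 0 \<Longrightarrow> emeasure \<nu> {s<..} \<noteq> \<infinity>"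
  using tail_finite[of s] by simp

lemma emeasure_tail: "s > 0 \<Longrightarrow> emeasure \<nu> {s<..} = ennreal (measure \<nu> {s<..})"
  using tail_finite[of s] by (intro emeasure_eq_ennreal_measure) auto

lemma measure_tail_upper: "s > 0 \<Longrightarrow> measure \<nu> {s<..} \<le> 2 * \<phi> (1 / s)"
  using tail_upper[of s] phi_pos[of "1/s"] by (simp add: emeasure_tail)

text \<open>
  Needed for exchanging integrals in \<open>t\<close> and \<open>z\<close>, as the Levy measure may be infinite near \<open>0\<close>.
\<close>

lemma sigma_finite_nu: "sigma_finite_measure \<nu>"
proof
  show "\<exists>A. countable A \<and> A \<subseteq> sets \<nu> \<and> \<Union>A = space \<nu> \<and> (\<forall>a\<in>A. emeasure \<nu> a \<noteq> \<infinity>)"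
  proof (intro exI[of _ "range (\<lambda>n. {1 / real (Suc n)<..})"] conjI)
    show "\<Union> (range (\<lambda>n. {1 / real (Suc n)<..})) = space \<nu>"
    proof (intro equalityI subsetI)
      fix x assume "x \<in> space \<nu>"
      then obtain n where "1 / real (Suc n) < x" using nat_approx_posE[of x] by auto
      then show "x \<in> \<Union> (range (\<lambda>n. {1 / real (Suc n)<..}))" by auto
    next
      fix x assume "x \<in> \<Union> (range (\<lambda>n. {1 / real (Suc n)<..}))"
      then obtain n where "1 / real (Suc n) < x" by auto
      moreover have "0 < 1 / real (Suc n)" by simp
      ultimately have "0 < x" by linarith
      then show "x \<in> space \<nu>" by simp
    qed
    have "emeasure \<nu> {1 / real (Suc n)<..} \<noteq> \<infinity>" for n
      by (intro tail_finite') simp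
    then show "\<forall>a\<in>range (\<lambda>n. {1 / real (Suc n)<..}). emeasure \<nu> a \<noteq> \<infinity>" by auto
  qed auto
qed

lemma phi_ratio: "b > 0 \<Longrightarrow> ((\<lambda>x. \<phi> (b * x) / \<phi> x) \<longlongrightarrow> 1) at_top"
  using sv by (simp add: slowly_varying_at_infinity_def)

lemma phi_ratio_le:
  assumes "b > 0" "q > 1"
  obtains s0 where "s0 > 0" "\<And>s. s \<ge> s0 \<Longrightarrow> \<phi> (b * s) \<le> q * \<phi> s"
proof -
  have "eventually (\<lambda>s. \<phi> (b * s) / \<phi> s < q) at_top"
    using phi_ratio[OF assms(1)] assms(2) by (rule order_tendstoD)
  then obtain N where N: "\<And>s. s \<ge> N \<Longrightarrow> \<phi> (b * s) / \<phi> s < q"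
    by (auto simp: eventually_at_top_linorder)
  show ?thesis
  proof (rule that[of "max N 1"])
    fix s assume "s \<ge> max N 1"
    then show "\<phi> (b * s) \<le> q * \<phi> s"
      using N[of s] phi_pos[of s] by (simp add: field_simps)
  qed simp
qed

text \<open>
  For slowly varying \<open>\<phi>\<close> the long jumps alone account for \<open>\<phi> s\<close>, whatever the constant \<open>k\<close>.
  Indeed the jumps of size at most \<open>k / s\<close> contribute at most \<open>exp k * (\<phi> (2 * s) - \<phi> s)\<close>,
  because \<open>exp (- s t) \<ge> exp (- k)\<close> for them, and slow variation makes this difference
  negligible against \<open>\<phi> s\<close>.
\<close>

lemma tail_lower:
  assumes k: "k > 0"
  obtains s0 where "s0 > 0" "\<And>s. s \<ge> s0 \<Longrightarrow> \<phi> s \<le> 2 * measure \<nu> {k / s<..}"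
proof -
  define q where "q = 1 + exp (- k) / 2"
  obtain s0 where s0: "s0 > 0" "\<And>s. s \<ge> s0 \<Longrightarrow> \<phi> (2 * s) \<le> q * \<phi> s"
    using phi_ratio_le[of 2 q] by (auto simp: q_def)
  have "\<phi> s \<le> 2 * measure \<nu> {k / s<..}" if "s \<ge> s0" for s
  proof -
    have s: "s > 0" using that s0 by simp
    have "k / s > 0" using s k by simp
    have i: "integrable \<nu> (indicator {k / s<..} :: real \<Rightarrow> real)"
      using \<open>k / s > 0\<close> tail_finite[of "k/s"] by (intro integrable_real_indicator) auto
    note i1 = integrable_phi[of s, OF less_imp_le[OF s]] integrable_phi[of "2 * s"]
    have i2: "integrable \<nu> (\<lambda>t. (1 - exp (- (2 * s) * t)) - (1 - exp (- s * t)))"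
      using s by (intro Bochner_Integration.integrable_diff[OF i1(2) i1(1)]) simp
    have "\<phi> s \<le> (\<integral>t. exp k * ((1 - exp (- (2 * s) * t)) - (1 - exp (- s * t))) + indicator {k / s<..} t \<partial>\<nu>)"
      unfolding laplace_exponent_def
    proof (intro integral_mono Bochner_Integration.integrable_add i)
      show "integrable \<nu> (\<lambda>t. 1 - exp (- s * t))" using s by (intro integrable_phi) simp
      show "integrable \<nu> (\<lambda>t. exp k * ((1 - exp (- (2 * s) * t)) - (1 - exp (- s * t))))"
        by (rule integrable_mult_right[OF i2])
    next
      fix t assume "t \<in> space \<nu>"
      then have t: "t > 0" by simp
      have eq: "(1 - exp (- (2 * s) * t)) - (1 - exp (- s * t)) = exp (- s * t) * (1 - exp (- s * t))"
        by (simp add: algebra_simps exp_add [symmetric])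
      have nn: "0 \<le> 1 - exp (- s * t)" using s t by simp
      show "1 - exp (- s * t) \<le> exp k * ((1 - exp (- (2 * s) * t)) - (1 - exp (- s * t))) + indicator {k / s<..} t"
      proof (cases "t > k / s")
        case True
        have "exp k * (exp (- s * t) * (1 - exp (- s * t))) \<ge> 0" using nn by simp
        moreover have "1 - exp (- s * t) \<le> 1" by simp
        ultimately have "1 - exp (- s * t) \<le> exp k * (exp (- s * t) * (1 - exp (- s * t))) + 1"
          by (meson add_increasing)
        then show ?thesis using True unfolding eq by simp
      next
        case False
        then have "1 \<le> exp (k - s * t)" using s by (simp add: field_simps)
        then have "1 * (1 - exp (- s * t)) \<le> exp (k - s * t) * (1 - exp (- s * t))"
          using nn by (intro mult_right_mono)
        then show ?thesis using False unfolding eq by (simp add: exp_diff exp_minus field_simps)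
      qed
    qed
    also have "\<dots> = exp k * (\<phi> (2 * s) - \<phi> s) + measure \<nu> {k / s<..}"
      unfolding laplace_exponent_def using s \<open>k / s > 0\<close>
      by (subst Bochner_Integration.integral_add[OF integrable_mult_right[OF i2] i],
          subst integral_mult_right_zero, subst Bochner_Integration.integral_diff[OF i1(2) i1(1)])
         (auto intro!: arg_cong[where f = "measure \<nu>"] intro: less_trans)
    also have "\<phi> (2 * s) - \<phi> s \<le> exp (- k) / 2 * \<phi> s"
      using s0(2)[OF that] by (simp add: q_def algebra_simps)
    also have "exp k * (exp (- k) / 2 * \<phi> s) = \<phi> s / 2"
      by (simp add: exp_minus)
    finally show ?thesis by simp
  qed
  then show ?thesis using s0(1) that by blast
qed

text \<open>
  The rate of jumps of the process that are longer than \<open>r\<close>, up to constants.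
\<close>

definition H :: "real \<Rightarrow> real" where
  "H r = \<phi> (1 / r\<^sup>2)"

lemma rho_eq: "rho \<nu> r = 1 / H r"
  by (simp add: rho_def psi_def H_def inverse_eq_divide power_one_over)

lemma H_pos: "r > 0 \<Longrightarrow> H r > 0"
  by (simp add: H_def phi_pos)

lemma rho_pos: "r > 0 \<Longrightarrow> rho \<nu> r > 0"
  by (simp add: rho_eq H_pos)

lemma H_antimono: "0 < r \<Longrightarrow> r \<le> s \<Longrightarrow> H s \<le> H r"
  unfolding H_def by (intro phi_mono) (auto intro!: divide_left_mono power_mono)

lemma H_scale:
  assumes "0 < r" "r \<le> s"
  shows "H r \<le> (s / r)\<^sup>2 * H s"
proof -
  have "\<phi> ((s / r)\<^sup>2 * (1 / s\<^sup>2)) \<le> (s / r)\<^sup>2 * \<phi> (1 / s\<^sup>2)"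
    using assms by (intro phi_scale) auto
  then show ?thesis using assms by (simp add: H_def power_divide)
qed

lemma H_doubling:
  assumes "q > 1"
  obtains r1 where "r1 > 0" "r1 \<le> 1" "H r1 \<ge> 1" "\<And>r. 0 < r \<Longrightarrow> r \<le> r1 \<Longrightarrow> H (r / 2) \<le> q * H r"
proof -
  obtain s0 where s0: "s0 > 0" "\<And>s. s \<ge> s0 \<Longrightarrow> \<phi> (4 * s) \<le> q * \<phi> s"
    using phi_ratio_le[of 4 q] assms by auto
  obtain s1 where s1: "\<And>s. s \<ge> s1 \<Longrightarrow> \<phi> s \<ge> 1"
    using phi_at_top by (auto simp: filterlim_at_top eventually_at_top_linorder)
  define s2 where "s2 = max 1 (max s0 s1)"
  define r1 where "r1 = 1 / sqrt s2"
  have s2: "s2 \<ge> 1" "s2 \<ge> s0" "s2 \<ge> s1" by (auto simp: s2_def)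
  have *: "1 / r\<^sup>2 \<ge> s2" if "0 < r" "r \<le> r1" for r
  proof -
    have "r\<^sup>2 \<le> r1\<^sup>2" using that by (intro power_mono) auto
    then have "1 / r1\<^sup>2 \<le> 1 / r\<^sup>2" using that by (intro divide_left_mono) auto
    then show ?thesis using s2 by (simp add: r1_def power_divide)
  qed
  have "r1 > 0" using s2 by (simp add: r1_def)
  moreover have "r1 \<le> 1" using s2 by (simp add: r1_def)
  moreover have "H r1 \<ge> 1"
    unfolding H_def using *[of r1] s2 \<open>r1 > 0\<close> by (intro s1) auto
  moreover have "H (r / 2) \<le> q * H r" if "0 < r" "r \<le> r1" for r
    using s0(2)[of "1 / r\<^sup>2"] *[OF that] s2 by (simp add: H_def power_divide)
  ultimately show ?thesis using that by blast
qed

lemma tail_H: "r > 0 \<Longrightarrow> emeasure \<nu> {r\<^sup>2<..} \<le> ennreal (2 * H r)"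
  using tail_upper[of "r\<^sup>2"] by (simp add: H_def)

lemma measure_tail_H: "r > 0 \<Longrightarrow> measure \<nu> {r\<^sup>2<..} \<le> 2 * H r"
  using measure_tail_upper[of "r\<^sup>2"] by (simp add: H_def)

lemma tail_lower_H:
  assumes k: "k > 0"
  obtains r2 where "r2 > 0" "\<And>r. 0 < r \<Longrightarrow> r \<le> r2 \<Longrightarrow> H r \<le> 2 * measure \<nu> {k * r\<^sup>2<..}"
proof -
  obtain s0 where s0: "s0 > 0" "\<And>s. s \<ge> s0 \<Longrightarrow> \<phi> s \<le> 2 * measure \<nu> {k / s<..}"
    using tail_lower[OF k] by blast
  show ?thesis
  proof (rule that[of "1 / sqrt s0"])
    fix r assume r: "0 < r" "r \<le> 1 / sqrt s0"
    then have "r\<^sup>2 \<le> (1 / sqrt s0)\<^sup>2" by (intro power_mono) auto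
    then have "s0 \<le> 1 / r\<^sup>2" using s0(1) r by (simp add: power_divide field_simps)
    then show "H r \<le> 2 * measure \<nu> {k * r\<^sup>2<..}"
      using s0(2)[of "1 / r\<^sup>2"] by (simp add: H_def)
  qed (use s0 in auto)
qed

lemma H_at_0: "\<exists>r0>0. \<forall>r. 0 < r \<longrightarrow> r \<le> r0 \<longrightarrow> H r \<ge> B"
proof -
  obtain s1 where s1: "\<And>s. s \<ge> s1 \<Longrightarrow> \<phi> s \<ge> B"
    using phi_at_top by (auto simp: filterlim_at_top eventually_at_top_linorder)
  define s2 where "s2 = max 1 s1"
  have s2: "s2 \<ge> 1" "s2 \<ge> s1" by (auto simp: s2_def)
  show ?thesis
  proof (intro exI[of _ "1 / sqrt s2"] conjI allI impI)
    fix r assume r: "0 < r" "r \<le> 1 / sqrt s2"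
    then have "r\<^sup>2 \<le> (1 / sqrt s2)\<^sup>2" by (intro power_mono) auto
    then have "s2 \<le> 1 / r\<^sup>2" using s2 r by (simp add: power_divide field_simps)
    then show "H r \<ge> B" using s1[of "1 / r\<^sup>2"] s2 by (simp add: H_def)
  qed (use s2 in auto)
qed

end

text \<open>
  The scale \<open>r1\<close> is one below which doubling \<open>r\<close> changes \<open>H\<close> by a factor \<open>q\<close> at most. The
  requirement on \<open>q\<close> makes a modulus of order \<open>\<rho> powr (1 + \<alpha>)\<close> grow at most like a square root.
\<close>

locale capped_levy = slowly_varying_levy +
  fixes r1 q \<alpha> :: real
  assumes r1: "r1 > 0" "r1 \<le> 1" "H r1 \<ge> 1"
    and q: "q > 1" and \<alpha>: "\<alpha> > 0" and q_power: "q powr (1 + \<alpha>) \<le> sqrt 2"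
    and H_half: "\<And>r. 0 < r \<Longrightarrow> r \<le> r1 \<Longrightarrow> H (r / 2) \<le> q * H r"
begin

text \<open>
  The function \<open>\<rho>\<close>, frozen beyond the scale \<open>r1\<close>. Unlike \<open>\<rho>\<close> it is bounded, and the bounds that
  slow variation provides near \<open>0\<close> hold for it on the whole half-line. The value \<open>0\<close> on the
  negative half-line makes it monotone on all reals.
\<close>

definition R :: "real \<Rightarrow> real" where
  "R r = (if r \<le> 0 then 0 else rho \<nu> (min r r1))"

lemma q_le: "q \<le> 3 / 2"
proof -
  have "q = q powr 1" using q by simp
  also have "\<dots> \<le> q powr (1 + \<alpha>)" using q \<alpha> by (intro powr_mono) auto
  also have "\<dots> \<le> sqrt 2" by (rule q_power)
  also have "\<dots> \<le> sqrt ((3/2)\<^sup>2)" by (intro real_sqrt_le_mono) (simp add: power2_eq_square)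
  finally show ?thesis by simp
qed

lemma R_0 [simp]: "R 0 = 0"
  by (simp add: R_def)

lemma R_eq: "0 < r \<Longrightarrow> r \<le> r1 \<Longrightarrow> R r = 1 / H r"
  by (simp add: R_def rho_eq)

lemma R_pos: "r > 0 \<Longrightarrow> R r > 0"
  using r1 by (simp add: R_def rho_pos)

lemma R_nonneg [simp]: "R r \<ge> 0"
  using R_pos[of r] by (cases "r > 0") (auto simp: R_def)

lemma R_mono: "r \<le> s \<Longrightarrow> R r \<le> R s"
  using r1 by (auto simp: R_def rho_eq H_pos less_imp_le intro!: divide_left_mono H_antimono mult_pos_pos)

lemma R_le_rho: "r > 0 \<Longrightarrow> R r \<le> rho \<nu> r"
  using r1 by (auto simp: R_def rho_eq H_pos less_imp_le intro!: divide_left_mono H_antimono mult_pos_pos)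

lemma R_le_1: "R r \<le> 1"
proof -
  have "R r \<le> R (max r r1)" by (intro R_mono) auto
  also have "\<dots> = 1 / H r1" using r1 by (simp add: R_def rho_eq)
  also have "\<dots> \<le> 1" using r1 by simp
  finally show ?thesis .
qed

lemma R_measurable [measurable]: "R \<in> borel_measurable borel"
  by (intro borel_measurable_mono) (auto simp: mono_def R_mono)

lemma R_double: "R (2 * r) \<le> q * R r"
proof (cases "r > 0")
  case True
  have *: "R s \<le> q * R (s / 2)" if "0 < s" "s \<le> r1" for s
    using H_half[OF that] that H_pos[of s] H_pos[of "s/2"] q by (simp add: R_eq field_simps)
  show ?thesis
  proof (cases "2 * r \<le> r1")
    case True
    then show ?thesis using *[of "2 * r"] \<open>r > 0\<close> by simp
  next
    case False
    have "R (2 * r) = R r1" using False r1 \<open>r > 0\<close> by (simp add: R_def)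
    also have "\<dots> \<le> q * R (r1 / 2)" using * r1 by simp
    also have "\<dots> \<le> q * R r" using False q by (intro mult_left_mono R_mono) auto
    finally show ?thesis .
  qed
qed (auto simp: R_def)

lemma R_scale:
  assumes "0 < r" "r \<le> s"
  shows "R s \<le> (s / r)\<^sup>2 * R r"
proof -
  have "H (min r r1) \<le> (min s r1 / min r r1)\<^sup>2 * H (min s r1)"
    using assms r1 by (intro H_scale) auto
  also have "\<dots> \<le> (s / r)\<^sup>2 * H (min s r1)"
    using assms r1 H_pos[of "min s r1"]
    by (intro mult_right_mono power_mono) (auto simp: min_def field_simps)
  finally show ?thesis using assms r1 H_pos[of "min s r1"] H_pos[of "min r r1"]
    by (simp add: R_def rho_eq field_simps)
qed

lemma R_max_scale:
  assumes t: "t > 0" and x: "x \<ge> 0"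
  shows "R (max x t) \<le> (max 1 (x / t))\<^sup>2 * R t"
proof -
  have "R (max x t) \<le> (max x t / t)\<^sup>2 * R t" using t by (intro R_scale) auto
  also have "max x t / t = max 1 (x / t)" using t by (auto simp: max_def field_simps)
  finally show ?thesis .
qed

lemma R_tendsto_0: "\<epsilon> > 0 \<Longrightarrow> \<exists>r0>0. \<forall>r\<le>r0. R r \<le> \<epsilon>"
proof -
  assume e: "\<epsilon> > 0"
  obtain r0 where r0: "r0 > 0" "\<And>r. 0 < r \<Longrightarrow> r \<le> r0 \<Longrightarrow> H r \<ge> 1 / \<epsilon>"
    using H_at_0[of "1 / \<epsilon>"] by auto
  have "R r \<le> \<epsilon>" if "r \<le> min r0 r1" for r
  proof (cases "r > 0")
    case True
    then show ?thesis using r0(2)[of r] that e H_pos[of r] by (simp add: R_eq field_simps)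
  qed (use e in \<open>auto simp: R_def\<close>)
  then show ?thesis using r0 r1 by (intro exI[of _ "min r0 r1"]) auto
qed

text \<open>
  The set is an up-set in \<open>t\<close>. With \<open>s\<close> a point of it below twice its infimum, it is contained
  in \<open>{s / 2<..}\<close>, which has mass at most \<open>2 \<phi> (2 / s) \<le> 4 \<phi> (1 / s)\<close>, and \<open>\<phi> (1 / s) = 1 / \<rho>
  (sqrt s) \<le> 1 / c\<close>.
\<close>

lemma measure_R_sqrt_gt:
  assumes c: "c > 0"
  shows "emeasure \<nu> {t\<in>space \<nu>. R (sqrt t) > c} \<le> ennreal (8 / c)"
proof -
  define T where "T = {t. t > 0 \<and> R (sqrt t) > c}"
  have T_eq: "{t\<in>space \<nu>. R (sqrt t) > c} = T" by (auto simp: T_def)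
  show ?thesis
  proof (cases "T = {}")
    case False
    obtain r0 where r0: "r0 > 0" "\<And>r. r \<le> r0 \<Longrightarrow> R r \<le> c" using R_tendsto_0[OF c] by blast
    have lower: "r0\<^sup>2 \<le> t" if "t \<in> T" for t
    proof (rule ccontr)
      assume "\<not> ?thesis"
      then have "sqrt t \<le> r0" using r0 by (metis less_eq_real_def not_le real_sqrt_le_iff real_sqrt_pow2_iff real_sqrt_unique)
      then show False using r0(2)[of "sqrt t"] that by (auto simp: T_def)
    qed
    have bdd: "bdd_below T" using lower by (auto intro!: bdd_belowI)
    have inf: "Inf T \<ge> r0\<^sup>2" using False lower by (intro cInf_greatest)
    then have "Inf T < 2 * Inf T" using r0 by (simp add: order.strict_trans2[of 0 "r0\<^sup>2"])
    then obtain s where s: "s \<in> T" "s < 2 * Inf T"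
      using cInf_less_iff[OF False bdd] by blast
    have s0: "s > 0" using s by (simp add: T_def)
    have "emeasure \<nu> T \<le> emeasure \<nu> {s / 2<..}"
    proof (intro emeasure_mono)
      show "T \<subseteq> {s / 2<..}"
      proof
        fix t assume "t \<in> T"
        then have "Inf T \<le> t" using bdd by (rule cInf_lower)
        then show "t \<in> {s / 2<..}" using s by simp
      qed
    qed (use s0 in simp)
    also have "\<dots> \<le> ennreal (2 * \<phi> (1 / (s / 2)))"
      using s0 by (intro tail_upper) simp
    also have "\<dots> \<le> ennreal (8 / c)"
    proof (rule ennreal_leI)
      have "\<phi> (1 / (s / 2)) = \<phi> (2 * (1 / s))" by simp
      also have "\<dots> \<le> 2 * \<phi> (1 / s)" using s0 by (intro phi_scale) auto
      also have "\<phi> (1 / s) \<le> 1 / c"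
      proof -
        have "c < R (sqrt s)" using s by (simp add: T_def)
        also have "\<dots> \<le> 1 / H (sqrt s)" using R_le_rho[of "sqrt s"] s0 by (simp add: rho_eq)
        finally show ?thesis using s0 c phi_pos[of "1 / s"] by (simp add: H_def field_simps)
      qed
      finally show "2 * \<phi> (1 / (s / 2)) \<le> 8 / c"
        using c by (simp add: field_simps)
    qed
    finally show ?thesis unfolding T_eq .
  qed (simp add: T_eq del: space_nu)
qed

text \<open>
  Sum over the levels \<open>R (sqrt t) \<approx> 2 powr (- n)\<close>. Such a level has mass at most of order \<open>2 ^
  n\<close>, so that it contributes at most a multiple of \<open>2 powr (- n \<alpha>)\<close>. This is where \<open>\<alpha> > 0\<close> is
  essential: a function of class \<open>\<rho> powr 1\<close> only need not be in the domain of the operator.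
\<close>

lemma nn_integral_R_sqrt_finite:
  "(\<integral>\<^sup>+ t. ennreal (R (sqrt t) powr (1 + \<alpha>)) \<partial>\<nu>) < \<infinity>"
proof -
  define T where "T = (\<lambda>n. {t\<in>space \<nu>. R (sqrt t) > (1/2) ^ Suc n})"
  let ?b = "(1/2::real) powr (1 + \<alpha>)"
  have [measurable]: "T n \<in> sets \<nu>" for n
  proof -
    have [measurable]: "(\<lambda>t. R (sqrt t)) \<in> borel_measurable \<nu>"
      by (intro measurable_nu) measurable
    show ?thesis unfolding T_def by measurable
  qed
  have "(\<integral>\<^sup>+ t. ennreal (R (sqrt t) powr (1 + \<alpha>)) \<partial>\<nu>) \<le>
      (\<integral>\<^sup>+ t. (\<Sum>n. ennreal (?b ^ n) * indicator (T n) t) \<partial>\<nu>)"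
  proof (intro nn_integral_mono)
    fix t assume "t \<in> space \<nu>"
    then have t: "t > 0" by simp
    obtain n where n: "(1/2) ^ Suc n < R (sqrt t)" "R (sqrt t) \<le> (1/2) ^ n"
      using dyadic_level[of "R (sqrt t)"] R_pos[of "sqrt t"] R_le_1 t by auto
    have "R (sqrt t) powr (1 + \<alpha>) \<le> ((1/2) ^ n) powr (1 + \<alpha>)"
      using n \<alpha> by (intro powr_mono2) auto
    also have "\<dots> = ?b ^ n"
      by (simp add: powr_realpow [symmetric] powr_powr mult.commute)
    finally have "ennreal (R (sqrt t) powr (1 + \<alpha>)) \<le> ennreal (?b ^ n) * indicator (T n) t"
      using n t by (simp add: ennreal_leI T_def)
    also have "\<dots> \<le> (\<Sum>n. ennreal (?b ^ n) * indicator (T n) t)"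
      by (rule ennreal_le_suminf)
    finally show "ennreal (R (sqrt t) powr (1 + \<alpha>)) \<le> (\<Sum>n. ennreal (?b ^ n) * indicator (T n) t)" .
  qed
  also have "\<dots> = (\<Sum>n. ennreal (?b ^ n) * emeasure \<nu> (T n))"
    by (subst nn_integral_suminf) (auto simp: nn_integral_cmult_indicator)
  also have "\<dots> \<le> (\<Sum>n. ennreal (16 * ((1/2) powr \<alpha>) ^ n))"
  proof (intro suminf_le)
    fix n
    have "ennreal (?b ^ n) * emeasure \<nu> (T n) \<le> ennreal (?b ^ n) * ennreal (8 / (1/2) ^ Suc n)"
      unfolding T_def by (intro mult_left_mono measure_R_sqrt_gt) auto
    also have "\<dots> = ennreal (?b ^ n * (8 / (1/2) ^ Suc n))"
      by (rule ennreal_mult' [symmetric]) simp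
    also have "?b ^ n * (8 / (1/2) ^ Suc n) = 16 * ((1/2) powr \<alpha>) ^ n"
      by (simp add: powr_add power_mult_distrib field_simps)
    finally show "ennreal (?b ^ n) * emeasure \<nu> (T n) \<le> ennreal (16 * ((1/2) powr \<alpha>) ^ n)" .
  qed auto
  also have "\<dots> < \<infinity>"
  proof -
    have "(1/2::real) powr \<alpha> < 1" using \<alpha> powr_less_mono'[of "1/2" 0 \<alpha>] by simp
    then have "summable (\<lambda>n. 16 * ((1/2::real) powr \<alpha>) ^ n)"
      by (intro summable_mult summable_geometric) auto
    then have "(\<Sum>n. ennreal (16 * ((1/2) powr \<alpha>) ^ n)) = ennreal (\<Sum>n. 16 * ((1/2) powr \<alpha>) ^ n)"
      by (intro suminf_ennreal2) auto
    then show ?thesis by simp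
  qed
  finally show ?thesis .
qed

lemma H_pow_half:
  assumes "0 < r" "r \<le> r1"
  shows "H (r * (1/2) ^ n) \<le> q ^ n * H r"
proof (induction n)
  case (Suc n)
  have "r * (1/2) ^ n \<le> r * 1" using assms by (intro mult_left_mono power_le_one) auto
  also have "\<dots> \<le> r1" using assms by simp
  finally have "H (r * (1/2) ^ n / 2) \<le> q * H (r * (1/2) ^ n)"
    using assms by (intro H_half) auto
  also have "\<dots> \<le> q * (q ^ n * H r)" using Suc q by (intro mult_left_mono) auto
  finally show ?case by (simp add: mult_ac)
qed simp

text \<open>
  At the level \<open>sqrt t / r \<approx> 2 powr (- n)\<close> the mass is at most of order \<open>H (2 powr (- n) r) \<le> q
  ^ n H r\<close>, and \<open>q < 2\<close> makes the sum a convergent geometric series.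
\<close>

lemma nn_integral_min_sqrt:
  assumes r: "0 < r" "r \<le> r1"
  shows "(\<integral>\<^sup>+ t. ennreal (min 1 (sqrt t / r)) \<partial>\<nu>) \<le> ennreal (12 * H r)"
proof -
  let ?s = "\<lambda>n. (r * (1/2) ^ Suc n)\<^sup>2"
  have s_pos: "r * (1/2) ^ Suc n > 0" for n using r by simp
  have [measurable]: "{?s n<..} \<in> sets \<nu>" for n by (intro Ioi_sets_nu) simp
  have "(\<integral>\<^sup>+ t. ennreal (min 1 (sqrt t / r)) \<partial>\<nu>) \<le>
      (\<integral>\<^sup>+ t. (\<Sum>n. ennreal ((1/2) ^ n) * indicator {?s n<..} t) \<partial>\<nu>)"
  proof (intro nn_integral_mono)
    fix t assume "t \<in> space \<nu>"
    then have t: "t > 0" by simp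
    have "0 < min 1 (sqrt t / r)" "min 1 (sqrt t / r) \<le> 1" using t r by auto
    then obtain n where n: "(1/2) ^ Suc n < min 1 (sqrt t / r)" "min 1 (sqrt t / r) \<le> (1/2) ^ n"
      by (rule dyadic_level)
    have "r * (1/2) ^ Suc n < sqrt t" using n(1) r by (simp add: field_simps)
    then have "?s n < (sqrt t)\<^sup>2" using s_pos[of n] by (intro power_strict_mono) auto
    then have "?s n < t" using t by simp
    then have "ennreal (min 1 (sqrt t / r)) \<le> ennreal ((1/2) ^ n) * indicator {?s n<..} t"
      using n by (simp add: ennreal_leI del: power_Suc)
    also have "\<dots> \<le> (\<Sum>n. ennreal ((1/2) ^ n) * indicator {?s n<..} t)"
      by (rule ennreal_le_suminf)
    finally show "ennreal (min 1 (sqrt t / r)) \<le> (\<Sum>n. ennreal ((1/2) ^ n) * indicator {?s n<..} t)" .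
  qed
  also have "\<dots> = (\<Sum>n. ennreal ((1/2) ^ n) * emeasure \<nu> {?s n<..})"
    by (subst nn_integral_suminf) (auto simp: nn_integral_cmult_indicator)
  also have "\<dots> \<le> (\<Sum>n. ennreal (3 * H r * (3/4) ^ n))"
  proof (intro suminf_le)
    fix n
    have "emeasure \<nu> {?s n<..} \<le> ennreal (2 * H (r * (1/2) ^ Suc n))"
      using s_pos by (intro tail_H)
    also have "\<dots> \<le> ennreal (2 * (q ^ Suc n * H r))"
      by (intro ennreal_leI mult_left_mono H_pow_half r) auto
    also have "\<dots> \<le> ennreal (2 * ((3/2) ^ Suc n * H r))"
      using q q_le H_pos[OF r(1)] by (intro ennreal_leI mult_left_mono mult_right_mono power_mono) auto
    finally have "ennreal ((1/2) ^ n) * emeasure \<nu> {?s n<..} \<le> ennreal ((1/2) ^ n) * ennreal (2 * ((3/2) ^ Suc n * H r))"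
      by (intro mult_left_mono) auto
    also have "\<dots> = ennreal ((1/2) ^ n * (2 * ((3/2) ^ Suc n * H r)))"
      by (simp add: ennreal_mult' del: power_Suc)
    also have "(1/2) ^ n * (2 * ((3/2) ^ Suc n * H r)) = 3 * H r * ((1/2) * (3/2)) ^ n"
      by (simp only: power_mult_distrib power_Suc) simp
    finally show "ennreal ((1/2) ^ n) * emeasure \<nu> {?s n<..} \<le> ennreal (3 * H r * (3/4) ^ n)" by simp
  qed auto
  also have "\<dots> = ennreal (\<Sum>n. 3 * H r * (3/4) ^ n)"
    using H_pos[OF r(1)] by (intro suminf_ennreal2 summable_mult summable_geometric) auto
  also have "(\<Sum>n. 3 * H r * (3/4) ^ n) = 12 * H r"
    by (subst suminf_mult) (auto simp: suminf_geometric)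
  finally show ?thesis .
qed

end

section \<open>Parts of the jump kernel\<close>

text \<open>
  The part of the jump kernel that stems from jumps of the subordinator larger than \<open>s\<close>.
  Truncating in time rather than in space keeps the kernel a mixture of heat kernels, hence
  smooth enough to be coupled with its translates.
\<close>

definition jump_part :: "real measure \<Rightarrow> real \<Rightarrow> 'a::euclidean_space \<Rightarrow> real" where
  "jump_part \<nu> s z = enn2real (\<integral>\<^sup>+ t. ennreal (heat t z) * indicator {s<..} t \<partial>\<nu>)"

lemma jump_part_nonneg [simp]: "jump_part \<nu> s z \<ge> 0"
  by (simp add: jump_part_def)

context slowly_varying_levy
begin

abbreviation heat_tail :: "real \<Rightarrow> 'a::euclidean_space \<Rightarrow> ennreal" where
  "heat_tail s z \<equiv> \<integral>\<^sup>+ t. ennreal (heat t z) * indicator {s<..} t \<partial>\<nu>"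

lemma jump_kernel_eq: "jump_kernel \<nu> z = jump_part \<nu> 0 z"
proof -
  have "jump_kernel \<nu> z = enn2real (\<integral>\<^sup>+ t. ennreal (heat t z) \<partial>\<nu>)"
    unfolding jump_kernel_def heat_def [symmetric]
    by (intro integral_eq_nn_integral) auto
  also have "(\<integral>\<^sup>+ t. ennreal (heat t z) \<partial>\<nu>) = heat_tail 0 z"
    by (intro nn_integral_cong) auto
  finally show ?thesis by (simp add: jump_part_def)
qed

lemma measurable_fst_nu [measurable]: "fst \<in> borel_measurable (\<nu> \<Otimes>\<^sub>M M)"
  using measurable_compose[OF measurable_fst measurable_ident_nu] by simp

lemma heat_tail_measurable [measurable]:
  "(\<lambda>(t, z::'a::euclidean_space). ennreal (heat t z) * indicator {s<..} t) \<in> borel_measurable (\<nu> \<Otimes>\<^sub>M lborel)"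
  by measurable

lemma heat_tail_measurable':
  "(\<lambda>(z::'a::euclidean_space, t). ennreal (heat t z) * indicator {s<..} t) \<in> borel_measurable (lborel \<Otimes>\<^sub>M \<nu>)"
proof -
  have [measurable]: "snd \<in> borel_measurable (lborel \<Otimes>\<^sub>M \<nu>)"
    using measurable_compose[OF measurable_snd measurable_ident_nu] by simp
  show ?thesis by measurable
qed

lemma heat_tail_nn_measurable [measurable]:
  "(\<lambda>z::'a::euclidean_space. heat_tail s z) \<in> borel_measurable borel"
  using sigma_finite_measure.borel_measurable_nn_integral_fst[OF sigma_finite_nu heat_tail_measurable'[where 'a='a], of s]
  by simp

lemma jump_part_measurable [measurable]: "jump_part \<nu> s \<in> borel_measurable borel"
  unfolding jump_part_def by measurable

lemma heat_tonelli:
  fixes g :: "real \<Rightarrow> 'a::euclidean_space \<Rightarrow> ennreal"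
  assumes [measurable]: "(\<lambda>(t, z). g t z) \<in> borel_measurable (\<nu> \<Otimes>\<^sub>M lborel)"
  shows "(\<integral>\<^sup>+ z. (\<integral>\<^sup>+ t. g t z \<partial>\<nu>) \<partial>lborel) = (\<integral>\<^sup>+ t. (\<integral>\<^sup>+ z. g t z \<partial>lborel) \<partial>\<nu>)"
proof -
  interpret sigma_finite_measure \<nu> by (rule sigma_finite_nu)
  interpret pair_sigma_finite \<nu> "lborel :: 'a measure" ..
  show ?thesis by (rule Fubini') (rule assms)
qed

lemma nn_integral_heat_tail:
  fixes g :: "'a::euclidean_space \<Rightarrow> ennreal"
  assumes [measurable]: "g \<in> borel_measurable borel"
  shows "(\<integral>\<^sup>+ z. g z * heat_tail s z \<partial>lborel) =
     (\<integral>\<^sup>+ t. (\<integral>\<^sup>+ z. g z * ennreal (heat t z) \<partial>lborel) * indicator {s<..} t \<partial>\<nu>)"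
proof -
  have "(\<integral>\<^sup>+ z. g z * heat_tail s z \<partial>lborel) =
     (\<integral>\<^sup>+ z. (\<integral>\<^sup>+ t. g z * (ennreal (heat t z) * indicator {s<..} t) \<partial>\<nu>) \<partial>lborel)"
    by (intro nn_integral_cong, subst nn_integral_cmult) auto
  also have "\<dots> = (\<integral>\<^sup>+ t. (\<integral>\<^sup>+ z. g z * (ennreal (heat t z) * indicator {s<..} t) \<partial>lborel) \<partial>\<nu>)"
    by (rule heat_tonelli) measurable
  also have "\<dots> = (\<integral>\<^sup>+ t. (\<integral>\<^sup>+ z. g z * ennreal (heat t z) \<partial>lborel) * indicator {s<..} t \<partial>\<nu>)"
    by (intro nn_integral_cong, subst nn_integral_multc [symmetric]) (auto simp: mult.assoc)
  finally show ?thesis .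
qed

lemma jump_part_le:
  "ennreal (jump_part \<nu> s z) \<le> heat_tail s z"
  unfolding jump_part_def by (simp add: ennreal_enn2real_if)

lemma heat_le:
  assumes "0 < s" "s \<le> t"
  shows "heat t (z::'a::euclidean_space) \<le> (4 * pi * s) powr (- (real DIM('a) / 2))"
proof -
  have "heat t z \<le> (4 * pi * t) powr (- (real DIM('a) / 2)) * 1"
    unfolding heat_def using assms by (intro mult_left_mono) auto
  also have "\<dots> \<le> (4 * pi * s) powr (- (real DIM('a) / 2))"
    using assms by (auto intro!: powr_mono2')
  finally show ?thesis .
qed

lemma heat_tail_finite:
  assumes s: "s > 0"
  shows "heat_tail s z < \<infinity>"
proof -
  have "heat_tail s z \<le>
    (\<integral>\<^sup>+ t. ennreal ((4 * pi * s) powr (- (real DIM('a) / 2))) * indicator {s<..} t \<partial>\<nu>)"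
    using s by (intro nn_integral_mono) (auto simp: indicator_def intro!: ennreal_leI heat_le)
  also have "\<dots> < \<infinity>"
    using s tail_finite[OF s] by (simp add: nn_integral_cmult_indicator ennreal_mult_less_top)
  finally show ?thesis .
qed

lemma jump_part_eq:
  assumes "s > 0"
  shows "ennreal (jump_part \<nu> s z) = heat_tail s z"
  using heat_tail_finite[OF assms, of z] by (simp add: jump_part_def less_top)

lemma jump_part_mass_nn:
  assumes "s > 0"
  shows "(\<integral>\<^sup>+ (z::'a::euclidean_space). ennreal (jump_part \<nu> s z) \<partial>lborel) =
    ennreal (heat_moment TYPE('a) 0 * measure \<nu> {s<..})"
proof -
  have "(\<integral>\<^sup>+ (z::'a). ennreal (jump_part \<nu> s z) \<partial>lborel) =
     (\<integral>\<^sup>+ t. (\<integral>\<^sup>+ (z::'a). 1 * ennreal (heat t z) \<partial>lborel) * indicator {s<..} t \<partial>\<nu>)"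
    unfolding jump_part_eq[OF assms] by (subst nn_integral_heat_tail [symmetric]) auto
  also have "\<dots> = (\<integral>\<^sup>+ t. ennreal (heat_moment TYPE('a) 0) * indicator {s<..} t \<partial>\<nu>)"
    by (intro nn_integral_cong) (auto simp: heat_mass)
  also have "\<dots> = ennreal (heat_moment TYPE('a) 0 * measure \<nu> {s<..})"
    using assms by (simp add: nn_integral_cmult_indicator emeasure_tail ennreal_mult')
  finally show ?thesis .
qed

lemma jump_part_integrable:
  assumes "s > 0"
  shows "integrable lborel (jump_part \<nu> s :: 'a::euclidean_space \<Rightarrow> real)"
  by (intro integrableI_nonneg) (auto simp: jump_part_mass_nn[OF assms])

lemma jump_part_mass:
  assumes "s > 0"
  shows "(\<integral> (z::'a::euclidean_space). jump_part \<nu> s z \<partial>lborel) = heat_moment TYPE('a) 0 * measure \<nu> {s<..}"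
  by (subst integral_eq_nn_integral) (auto simp: jump_part_mass_nn[OF assms])

lemma jump_part_antimono:
  assumes "0 < s" "s \<le> s'"
  shows "jump_part \<nu> s' z \<le> jump_part \<nu> s z"
proof -
  have "ennreal (jump_part \<nu> s' z) \<le> ennreal (jump_part \<nu> s z)"
    using assms by (subst (1 2) jump_part_eq) (auto intro!: nn_integral_mono simp: indicator_def)
  then show ?thesis by simp
qed

end

context capped_levy
begin

lemma nn_integral_min_heat_tail:
  fixes r s :: real
  assumes r: "0 < r" "r \<le> r1"
  shows "(\<integral>\<^sup>+ (z::'a::euclidean_space). ennreal (min 1 (norm z / r)) *
      heat_tail s z \<partial>lborel)
    \<le> ennreal (heat_moment TYPE('a) 1 * (12 * H r))"
proof -
  have "(\<integral>\<^sup>+ (z::'a). ennreal (min 1 (norm z / r)) * heat_tail s z \<partial>lborel) =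
     (\<integral>\<^sup>+ t. (\<integral>\<^sup>+ (z::'a). ennreal (min 1 (norm z / r)) * ennreal (heat t z) \<partial>lborel) * indicator {s<..} t \<partial>\<nu>)"
    by (rule nn_integral_heat_tail) simp
  also have "\<dots> \<le> (\<integral>\<^sup>+ t. ennreal (heat_moment TYPE('a) 1) * ennreal (min 1 (sqrt t / r)) \<partial>\<nu>)"
  proof (intro nn_integral_mono)
    fix t assume "t \<in> space \<nu>"
    then have t: "t > 0" by simp
    have "(\<integral>\<^sup>+ (z::'a). ennreal (min 1 (norm z / r)) * ennreal (heat t z) \<partial>lborel) \<le>
      (\<integral>\<^sup>+ (z::'a). ennreal (min 1 (sqrt t / r)) * ennreal (max 1 (norm z / sqrt t) ^ 1 * heat t z) \<partial>lborel)"
    proof (intro nn_integral_mono)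
      fix z :: 'a
      have "norm z / r \<le> max 1 (norm z / sqrt t) * (sqrt t / r)"
        using t r by (auto simp: max_def field_simps)
      moreover have "1 \<le> max 1 (norm z / sqrt t)" by simp
      moreover have "max 1 (norm z / sqrt t) * 1 = max 1 (norm z / sqrt t)" by simp
      ultimately have "min 1 (norm z / r) \<le> max 1 (norm z / sqrt t) * min 1 (sqrt t / r)"
        by (auto simp: min_def)
      then have "min 1 (norm z / r) * heat t z \<le> max 1 (norm z / sqrt t) * min 1 (sqrt t / r) * heat t z"
        by (rule mult_right_mono) simp
      then have "min 1 (norm z / r) * heat t z \<le> min 1 (sqrt t / r) * (max 1 (norm z / sqrt t) ^ 1 * heat t z)"
        by (simp add: mult_ac)
      then show "ennreal (min 1 (norm z / r)) * ennreal (heat t z) \<le> ennreal (min 1 (sqrt t / r)) * ennreal (max 1 (norm z / sqrt t) ^ 1 * heat t z)"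
        using t r by (simp add: ennreal_mult' [symmetric] ennreal_leI)
    qed
    also have "\<dots> = ennreal (min 1 (sqrt t / r)) * ennreal (heat_moment TYPE('a) 1)"
      using t by (subst nn_integral_cmult) (auto simp: heat_moment_scaled[where p=1, simplified])
    finally show "(\<integral>\<^sup>+ (z::'a). ennreal (min 1 (norm z / r)) * ennreal (heat t z) \<partial>lborel) * indicator {s<..} t
        \<le> ennreal (heat_moment TYPE('a) 1) * ennreal (min 1 (sqrt t / r))"
      by (auto simp: indicator_def mult.commute)
  qed
  also have "\<dots> = ennreal (heat_moment TYPE('a) 1) * (\<integral>\<^sup>+ t. ennreal (min 1 (sqrt t / r)) \<partial>\<nu>)"
    by (intro nn_integral_cmult) auto
  also have "\<dots> \<le> ennreal (heat_moment TYPE('a) 1) * ennreal (12 * H r)"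
    by (intro mult_left_mono nn_integral_min_sqrt r) auto
  finally show ?thesis by (simp add: ennreal_mult')
qed

lemma nn_integral_min_jump_part:
  fixes r s :: real
  assumes r: "0 < r" "r \<le> r1"
  shows "(\<integral>\<^sup>+ (z::'a::euclidean_space). ennreal (min 1 (norm z / r)) * ennreal (jump_part \<nu> s z) \<partial>lborel)
    \<le> ennreal (heat_moment TYPE('a) 1 * (12 * H r))"
  by (rule order.trans[OF nn_integral_mono nn_integral_min_heat_tail[OF r, of s]])
     (intro mult_left_mono jump_part_le zero_le)

text \<open>
  A kernel that integrates \<open>min 1 (|z| / r1)\<close> is finite almost everywhere.
\<close>

lemma heat_tail_AE_finite:
  "AE z::'a::euclidean_space in lborel. heat_tail s z < \<infinity>"
proof -
  let ?F = "\<lambda>z::'a. heat_tail s z"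
  have "(\<integral>\<^sup>+ z. ennreal (min 1 (norm z / r1)) * ?F z \<partial>lborel) < \<infinity>"
    using nn_integral_min_heat_tail[OF r1(1), where 'a='a, of s] by (simp add: le_less_trans)
  then have "AE z in lborel. ennreal (min 1 (norm z / r1)) * ?F z \<noteq> \<infinity>"
    by (intro nn_integral_noteq_infinite) auto
  moreover have "AE z in lborel. z \<noteq> (0::'a)"
    by (rule AE_lborel_singleton)
  ultimately show ?thesis
  proof eventually_elim
    case (elim z)
    have "min 1 (norm z / r1) > 0" using elim r1 by simp
    then have "ennreal (min 1 (norm z / r1)) \<noteq> 0" by (simp add: ennreal_eq_0_iff not_le del: min_less_iff_conj)
    then show ?case using elim(1) by (auto simp: ennreal_mult_eq_top_iff less_top)
  qed
qed

text \<open>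
  An integrable function that dominates \<open>R (max |z| e) powr (1 + \<alpha>)\<close> times the truncated kernel
  simultaneously for all \<open>e\<close>: the truncated kernel only involves times with \<open>sqrt t \<ge> e\<close>.
\<close>

definition weight :: "'a::euclidean_space \<Rightarrow> ennreal" where
  "weight z = (\<integral>\<^sup>+ t. ennreal (R (max (norm z) (sqrt t)) powr (1 + \<alpha>)) * ennreal (heat t z) \<partial>\<nu>)"

text \<open>
  \<open>R (max |z| (sqrt t))\<close> grows at most quadratically in \<open>|z| / sqrt t\<close>, so its power \<open>1 + \<alpha>\<close>
  costs a Gaussian moment of this order.
\<close>

definition moment_index :: nat where "moment_index = nat \<lceil>2 * (1 + \<alpha>)\<rceil>"

lemma nn_integral_R_heat:
  assumes t: "t > 0"
  shows "(\<integral>\<^sup>+ (z::'a::euclidean_space). ennreal (R (max (norm z) (sqrt t)) powr (1 + \<alpha>)) * ennreal (heat t z) \<partial>lborel)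
     \<le> ennreal (heat_moment TYPE('a) moment_index) * ennreal (R (sqrt t) powr (1 + \<alpha>))"
proof -
  have "(\<integral>\<^sup>+ (z::'a). ennreal (R (max (norm z) (sqrt t)) powr (1 + \<alpha>)) * ennreal (heat t z) \<partial>lborel) \<le>
    (\<integral>\<^sup>+ (z::'a). ennreal (R (sqrt t) powr (1 + \<alpha>)) * ennreal (max 1 (norm z / sqrt t) ^ moment_index * heat t z) \<partial>lborel)"
  proof (intro nn_integral_mono)
    fix z :: 'a
    let ?m = "max 1 (norm z / sqrt t)"
    have "R (max (norm z) (sqrt t)) powr (1 + \<alpha>) \<le> (?m\<^sup>2 * R (sqrt t)) powr (1 + \<alpha>)"
      using t \<alpha> by (intro powr_mono2 R_max_scale) auto
    also have "\<dots> = (?m\<^sup>2) powr (1 + \<alpha>) * R (sqrt t) powr (1 + \<alpha>)"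
      by (rule powr_mult)
    also have "(?m\<^sup>2) powr (1 + \<alpha>) = ?m powr (2 * (1 + \<alpha>))"
    proof -
      have "?m\<^sup>2 = ?m powr 2" by (simp add: powr_numeral)
      then show ?thesis by (simp only: powr_powr)
    qed
    also have "?m powr (2 * (1 + \<alpha>)) \<le> ?m powr (real moment_index)"
      unfolding moment_index_def by (rule powr_mono[OF real_nat_ceiling_ge]) simp
    also have "\<dots> = ?m ^ moment_index" by (intro powr_realpow) auto
    finally have "R (max (norm z) (sqrt t)) powr (1 + \<alpha>) * heat t z \<le> ?m ^ moment_index * R (sqrt t) powr (1 + \<alpha>) * heat t z"
      by (simp add: mult_right_mono)
    then show "ennreal (R (max (norm z) (sqrt t)) powr (1 + \<alpha>)) * ennreal (heat t z) \<le>
       ennreal (R (sqrt t) powr (1 + \<alpha>)) * ennreal (?m ^ moment_index * heat t z)"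
      by (simp add: ennreal_mult' [symmetric] mult_ac ennreal_leI)
  qed
  also have "\<dots> = ennreal (R (sqrt t) powr (1 + \<alpha>)) * ennreal (heat_moment TYPE('a) moment_index)"
    using t by (subst nn_integral_cmult) (auto simp: heat_moment_scaled)
  finally show ?thesis by (simp add: mult.commute)
qed

lemma weight_measurable_pair [measurable]:
  "(\<lambda>(t, z::'a::euclidean_space). ennreal (R (max (norm z) (sqrt t)) powr (1 + \<alpha>)) * ennreal (heat t z))
     \<in> borel_measurable (\<nu> \<Otimes>\<^sub>M lborel)"
  by measurable

lemma weight_measurable [measurable]: "(weight :: 'a::euclidean_space \<Rightarrow> ennreal) \<in> borel_measurable borel"
proof -
  have [measurable]: "snd \<in> borel_measurable (lborel \<Otimes>\<^sub>M \<nu>)"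
    using measurable_compose[OF measurable_snd measurable_ident_nu] by simp
  have "(\<lambda>(z::'a, t). ennreal (R (max (norm z) (sqrt t)) powr (1 + \<alpha>)) * ennreal (heat t z))
     \<in> borel_measurable (lborel \<Otimes>\<^sub>M \<nu>)"
    by measurable
  from sigma_finite_measure.borel_measurable_nn_integral_fst[OF sigma_finite_nu this]
  show ?thesis unfolding weight_def[abs_def] by simp
qed

lemma nn_integral_weight_finite: "(\<integral>\<^sup>+ (z::'a::euclidean_space). weight z \<partial>lborel) < \<infinity>"
proof -
  have "(\<integral>\<^sup>+ (z::'a). weight z \<partial>lborel) =
     (\<integral>\<^sup>+ t. (\<integral>\<^sup>+ (z::'a). ennreal (R (max (norm z) (sqrt t)) powr (1 + \<alpha>)) * ennreal (heat t z) \<partial>lborel) \<partial>\<nu>)"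
    unfolding weight_def by (rule heat_tonelli) measurable
  also have "\<dots> \<le> (\<integral>\<^sup>+ t. ennreal (heat_moment TYPE('a) moment_index) * ennreal (R (sqrt t) powr (1 + \<alpha>)) \<partial>\<nu>)"
    by (intro nn_integral_mono nn_integral_R_heat) simp
  also have "\<dots> = ennreal (heat_moment TYPE('a) moment_index) * (\<integral>\<^sup>+ t. ennreal (R (sqrt t) powr (1 + \<alpha>)) \<partial>\<nu>)"
    by (intro nn_integral_cmult) auto
  also have "\<dots> < \<infinity>"
    using nn_integral_R_sqrt_finite by (simp add: ennreal_mult_less_top)
  finally show ?thesis .
qed

text \<open>
  The share of \<open>weight\<close> due to the jumps that truncation at level \<open>s\<close> removes.
\<close>

definition low_weight :: "real \<Rightarrow> 'a::euclidean_space \<Rightarrow> ennreal" where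
  "low_weight s z = (\<integral>\<^sup>+ t. ennreal (R (max (norm z) (sqrt t)) powr (1 + \<alpha>)) * ennreal (heat t z) * indicator {..s} t \<partial>\<nu>)"

lemma low_weight_measurable [measurable]:
  "(low_weight s :: 'a::euclidean_space \<Rightarrow> ennreal) \<in> borel_measurable borel"
proof -
  have [measurable]: "snd \<in> borel_measurable (lborel \<Otimes>\<^sub>M \<nu>)"
    using measurable_compose[OF measurable_snd measurable_ident_nu] by simp
  have "(\<lambda>(z::'a, t). ennreal (R (max (norm z) (sqrt t)) powr (1 + \<alpha>)) * ennreal (heat t z) * indicator {..s} t)
     \<in> borel_measurable (lborel \<Otimes>\<^sub>M \<nu>)"
    by measurable
  from sigma_finite_measure.borel_measurable_nn_integral_fst[OF sigma_finite_nu this]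
  show ?thesis unfolding low_weight_def[abs_def] by simp
qed

lemma nn_integral_low_weight:
  "(\<integral>\<^sup>+ (z::'a::euclidean_space). low_weight s z \<partial>lborel) \<le>
     ennreal (heat_moment TYPE('a) moment_index) * (\<integral>\<^sup>+ t. ennreal (R (sqrt t) powr (1 + \<alpha>)) * indicator {..s} t \<partial>\<nu>)"
proof -
  have "(\<integral>\<^sup>+ (z::'a). low_weight s z \<partial>lborel) =
     (\<integral>\<^sup>+ t. (\<integral>\<^sup>+ (z::'a). ennreal (R (max (norm z) (sqrt t)) powr (1 + \<alpha>)) * ennreal (heat t z) * indicator {..s} t \<partial>lborel) \<partial>\<nu>)"
    unfolding low_weight_def by (rule heat_tonelli) measurable
  also have "\<dots> \<le> (\<integral>\<^sup>+ t. ennreal (heat_moment TYPE('a) moment_index) * (ennreal (R (sqrt t) powr (1 + \<alpha>)) * indicator {..s} t) \<partial>\<nu>)"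
  proof (intro nn_integral_mono)
    fix t assume "t \<in> space \<nu>"
    then have "t > 0" by simp
    then show "(\<integral>\<^sup>+ (z::'a). ennreal (R (max (norm z) (sqrt t)) powr (1 + \<alpha>)) * ennreal (heat t z) * indicator {..s} t \<partial>lborel)
      \<le> ennreal (heat_moment TYPE('a) moment_index) * (ennreal (R (sqrt t) powr (1 + \<alpha>)) * indicator {..s} t)"
      using nn_integral_R_heat[of t, where 'a='a] by (auto simp: indicator_def)
  qed
  also have "\<dots> = ennreal (heat_moment TYPE('a) moment_index) * (\<integral>\<^sup>+ t. ennreal (R (sqrt t) powr (1 + \<alpha>)) * indicator {..s} t \<partial>\<nu>)"
    by (intro nn_integral_cmult) auto
  finally show ?thesis .
qed

lemma small_low_weight:
  assumes \<epsilon>: "\<epsilon> > 0"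
  obtains s0 where "s0 > 0"
    "\<And>s. s \<le> s0 \<Longrightarrow> (\<integral>\<^sup>+ (z::'a::euclidean_space). low_weight s z \<partial>lborel) \<le> ennreal \<epsilon>"
proof -
  let ?M = "heat_moment TYPE('a) moment_index"
  let ?g = "\<lambda>s t. ennreal (R (sqrt t) powr (1 + \<alpha>)) * indicator {..s} t"
  have "(\<lambda>n. \<integral>\<^sup>+ t. ?g (1 / real (Suc n)) t \<partial>\<nu>) \<longlonglongrightarrow> (\<integral>\<^sup>+ t. 0 \<partial>\<nu>)"
  proof (rule nn_integral_dominated_convergence[where w = "\<lambda>t. ennreal (R (sqrt t) powr (1 + \<alpha>))"])
    show "AE t in \<nu>. (\<lambda>n. ?g (1 / real (Suc n)) t) \<longlonglongrightarrow> 0"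
    proof (rule AE_I2)
      fix t assume "t \<in> space \<nu>"
      then have t: "t > 0" by simp
      then obtain m where m: "1 / real (Suc m) < t" using nat_approx_posE by blast
      have "eventually (\<lambda>n. ?g (1 / real (Suc n)) t = 0) sequentially"
        using eventually_ge_at_top[of m]
      proof eventually_elim
        case (elim n)
        then have "1 / real (Suc n) \<le> 1 / real (Suc m)" by (simp add: field_simps)
        then show ?case using m by (simp add: indicator_def)
      qed
      then show "(\<lambda>n. ?g (1 / real (Suc n)) t) \<longlonglongrightarrow> 0"
        by (rule tendsto_eventually)
    qed
  qed (use nn_integral_R_sqrt_finite in \<open>auto simp: indicator_def intro!: AE_I2\<close>)
  then have "eventually (\<lambda>n. (\<integral>\<^sup>+ t. ?g (1 / real (Suc n)) t \<partial>\<nu>) < ennreal (\<epsilon> / (?M + 1))) sequentially"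
    using \<epsilon> heat_moment_nonneg[where 'a='a, of moment_index]
    by (intro order_tendstoD(2)) (auto intro!: divide_pos_pos add_nonneg_pos)
  then obtain n where n: "(\<integral>\<^sup>+ t. ?g (1 / real (Suc n)) t \<partial>\<nu>) < ennreal (\<epsilon> / (?M + 1))"
    by (auto simp: eventually_sequentially)
  show ?thesis
  proof (rule that[of "1 / real (Suc n)"])
    fix s :: real assume s: "s \<le> 1 / real (Suc n)"
    have "(\<integral>\<^sup>+ (z::'a). low_weight s z \<partial>lborel) \<le> ennreal ?M * (\<integral>\<^sup>+ t. ?g s t \<partial>\<nu>)"
      by (rule nn_integral_low_weight)
    also have "\<dots> \<le> ennreal ?M * (\<integral>\<^sup>+ t. ?g (1 / real (Suc n)) t \<partial>\<nu>)"
      using s by (intro mult_left_mono nn_integral_mono) (auto simp: indicator_def)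
    also have "\<dots> \<le> ennreal ?M * ennreal (\<epsilon> / (?M + 1))"
      using n by (intro mult_left_mono) auto
    also have "\<dots> = ennreal (?M * (\<epsilon> / (?M + 1)))"
      by (rule ennreal_mult' [symmetric]) simp
    also have "\<dots> \<le> ennreal \<epsilon>"
    proof (rule ennreal_leI)
      have "?M + 1 > 0" using heat_moment_nonneg[where 'a='a, of moment_index] by linarith
      then show "?M * (\<epsilon> / (?M + 1)) \<le> \<epsilon>" using \<epsilon> by (simp add: field_simps)
    qed
    finally show "(\<integral>\<^sup>+ (z::'a). low_weight s z \<partial>lborel) \<le> ennreal \<epsilon>" .
  qed simp
qed

lemma weight_bound:
  assumes e: "e \<ge> 0"
  shows "ennreal (R (max (norm z) e) powr (1 + \<alpha>)) * ennreal (jump_part \<nu> (e\<^sup>2) z) \<le> weight z"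
proof -
  have "ennreal (R (max (norm z) e) powr (1 + \<alpha>)) * ennreal (jump_part \<nu> (e\<^sup>2) z) \<le>
     ennreal (R (max (norm z) e) powr (1 + \<alpha>)) * heat_tail (e\<^sup>2) z"
    by (intro mult_left_mono jump_part_le) auto
  also have "\<dots> = (\<integral>\<^sup>+ t. ennreal (R (max (norm z) e) powr (1 + \<alpha>)) * (ennreal (heat t z) * indicator {e\<^sup>2<..} t) \<partial>\<nu>)"
    by (subst nn_integral_cmult) auto
  also have "\<dots> \<le> weight z"
    unfolding weight_def
  proof (intro nn_integral_mono)
    fix t assume "t \<in> space \<nu>"
    have "e \<le> sqrt t" if "e\<^sup>2 < t" using that by (simp add: real_le_rsqrt)
    then have "e\<^sup>2 < t \<Longrightarrow> R (max (norm z) e) powr (1 + \<alpha>) \<le> R (max (norm z) (sqrt t)) powr (1 + \<alpha>)"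
      using \<alpha> by (intro powr_mono2 R_mono) auto
    then show "ennreal (R (max (norm z) e) powr (1 + \<alpha>)) * (ennreal (heat t z) * indicator {e\<^sup>2<..} t)
      \<le> ennreal (R (max (norm z) (sqrt t)) powr (1 + \<alpha>)) * ennreal (heat t z)"
      by (auto simp: indicator_def intro!: mult_right_mono ennreal_leI)
  qed
  finally show ?thesis .
qed

lemma jump_part_diff:
  assumes s: "0 \<le> s" "s \<le> s'" and fin: "heat_tail s z < \<infinity>"
  shows "jump_part \<nu> s' z \<le> jump_part \<nu> s z"
    and "ennreal (jump_part \<nu> s z - jump_part \<nu> s' z) = (\<integral>\<^sup>+ t. ennreal (heat t z) * indicator {s<..s'} t \<partial>\<nu>)"
proof -
  let ?a = "heat_tail s z"
  let ?b = "heat_tail s' z"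
  let ?c = "\<integral>\<^sup>+ t. ennreal (heat t z) * indicator {s<..s'} t \<partial>\<nu>"
  have "{s<..} \<inter> {0<..} \<in> sets \<nu>" for s :: real
    by (auto simp: sets_nu sets_restrict_space_iff)
  have abc: "?a = ?b + ?c"
    using s by (subst nn_integral_add [symmetric]) (auto intro!: nn_integral_cong simp: indicator_def)
  then have b: "?b < \<infinity>" and c: "?c < \<infinity>" using fin by (auto simp: less_top)
  have ja: "ennreal (jump_part \<nu> s z) = ?a" and jb: "ennreal (jump_part \<nu> s' z) = ?b"
    using fin b by (auto simp: jump_part_def less_top)
  show le: "jump_part \<nu> s' z \<le> jump_part \<nu> s z"
  proof -
    have "ennreal (jump_part \<nu> s' z) \<le> ennreal (jump_part \<nu> s z)" unfolding ja jb abc by simp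
    then show ?thesis by simp
  qed
  have "ennreal (jump_part \<nu> s z - jump_part \<nu> s' z) = ?a - ?b"
    using ennreal_minus[of "jump_part \<nu> s' z" "jump_part \<nu> s z"] by (simp add: ja jb)
  also have "\<dots> = ?c" unfolding abc using b by (simp add: less_top)
  finally show "ennreal (jump_part \<nu> s z - jump_part \<nu> s' z) = ?c" .
qed

lemma low_weight_bound:
  assumes e: "0 \<le> e" "e \<le> e'" and fin: "heat_tail (e\<^sup>2) z < \<infinity>"
  shows "ennreal (R (max (norm z) e) powr (1 + \<alpha>)) * ennreal (jump_part \<nu> (e\<^sup>2) z - jump_part \<nu> (e'\<^sup>2) z) \<le> low_weight (e'\<^sup>2) z"
proof -
  have "e\<^sup>2 \<le> e'\<^sup>2" using e by (intro power_mono) auto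
  then have "ennreal (R (max (norm z) e) powr (1 + \<alpha>)) * ennreal (jump_part \<nu> (e\<^sup>2) z - jump_part \<nu> (e'\<^sup>2) z) =
     ennreal (R (max (norm z) e) powr (1 + \<alpha>)) * (\<integral>\<^sup>+ t. ennreal (heat t z) * indicator {e\<^sup>2<..e'\<^sup>2} t \<partial>\<nu>)"
    using fin by (subst jump_part_diff(2)) auto
  also have "\<dots> = (\<integral>\<^sup>+ t. ennreal (R (max (norm z) e) powr (1 + \<alpha>)) * (ennreal (heat t z) * indicator {e\<^sup>2<..e'\<^sup>2} t) \<partial>\<nu>)"
    by (subst nn_integral_cmult) auto
  also have "\<dots> \<le> low_weight (e'\<^sup>2) z"
    unfolding low_weight_def
  proof (intro nn_integral_mono)
    fix t assume "t \<in> space \<nu>"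
    have "e \<le> sqrt t" if "e\<^sup>2 < t" using that by (simp add: real_le_rsqrt)
    then have "e\<^sup>2 < t \<Longrightarrow> R (max (norm z) e) powr (1 + \<alpha>) \<le> R (max (norm z) (sqrt t)) powr (1 + \<alpha>)"
      using \<alpha> by (intro powr_mono2 R_mono) auto
    then show "ennreal (R (max (norm z) e) powr (1 + \<alpha>)) * (ennreal (heat t z) * indicator {e\<^sup>2<..e'\<^sup>2} t)
      \<le> ennreal (R (max (norm z) (sqrt t)) powr (1 + \<alpha>)) * ennreal (heat t z) * indicator {..e'\<^sup>2} t"
      by (auto simp: indicator_def intro!: mult_right_mono ennreal_leI)
  qed
  finally show ?thesis .
qed

lemma small_weight_near_0:
  assumes \<epsilon>: "\<epsilon> > 0"
  obtains \<delta> where "\<delta> > 0"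
    "(\<integral>\<^sup>+ (z::'a::euclidean_space). weight z * indicator (ball 0 \<delta>) z \<partial>lborel) \<le> ennreal \<epsilon>"
proof -
  let ?g = "\<lambda>n z::'a. weight z * indicator (ball 0 (1 / real (Suc n))) z"
  have "(\<lambda>n. \<integral>\<^sup>+ z. ?g n z \<partial>lborel) \<longlonglongrightarrow> (\<integral>\<^sup>+ (z::'a). 0 \<partial>lborel)"
  proof (rule nn_integral_dominated_convergence[where w = weight])
    show "AE z in lborel. (\<lambda>n. ?g n z) \<longlonglongrightarrow> 0"
      using AE_lborel_singleton[of "0::'a"]
    proof eventually_elim
      case (elim z)
      then obtain m where m: "1 / real (Suc m) < norm z" using nat_approx_posE[of "norm z"] by auto
      have "eventually (\<lambda>n. ?g n z = 0) sequentially"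
        using eventually_ge_at_top[of m]
      proof eventually_elim
        case (elim n)
        then have "1 / real (Suc n) \<le> 1 / real (Suc m)" by (simp add: field_simps)
        then show ?case using m by (simp add: indicator_def)
      qed
      then show ?case by (rule tendsto_eventually)
    qed
  qed (use nn_integral_weight_finite[where 'a='a] in \<open>auto simp: indicator_def intro!: AE_I2\<close>)
  then have "eventually (\<lambda>n. (\<integral>\<^sup>+ z. ?g n z \<partial>lborel) < ennreal \<epsilon>) sequentially"
    using \<epsilon> by (intro order_tendstoD(2)) auto
  then obtain n where "(\<integral>\<^sup>+ z. ?g n z \<partial>lborel) < ennreal \<epsilon>"
    by (auto simp: eventually_sequentially)
  then show ?thesis by (intro that[of "1 / real (Suc n)"]) auto
qed

lemma jump_part_tendsto:
  assumes fin: "heat_tail 0 z < \<infinity>"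
    and s: "\<And>n. s n > 0" "s \<longlonglongrightarrow> 0"
  shows "(\<lambda>n. jump_part \<nu> (s n) z) \<longlonglongrightarrow> jump_part \<nu> 0 z"
proof -
  let ?g = "\<lambda>n t. ennreal (heat t z) * indicator {s n<..} t"
  have "(\<lambda>n. \<integral>\<^sup>+ t. ?g n t \<partial>\<nu>) \<longlonglongrightarrow> heat_tail 0 z"
  proof (rule nn_integral_dominated_convergence[where w = "\<lambda>t. ennreal (heat t z) * indicator {0<..} t"])
    show "AE t in \<nu>. (\<lambda>n. ?g n t) \<longlonglongrightarrow> ennreal (heat t z) * indicator {0<..} t"
    proof (rule AE_I2)
      fix t assume "t \<in> space \<nu>"
      then have t: "t > 0" by simp
      have "eventually (\<lambda>n. ?g n t = ennreal (heat t z) * indicator {0<..} t) sequentially"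
        using order_tendstoD(2)[OF s(2) t] by eventually_elim (use t in auto)
      then show "(\<lambda>n. ?g n t) \<longlonglongrightarrow> ennreal (heat t z) * indicator {0<..} t"
        by (rule tendsto_eventually)
    qed
  next
    show "AE t in \<nu>. ?g n t \<le> ennreal (heat t z) * indicator {0<..} t" for n
      using s(1)[of n] by (intro AE_I2) (auto simp: indicator_def)
  qed (use fin in auto)
  then show ?thesis unfolding jump_part_def using fin
    by (intro tendsto_enn2real) auto
qed

end

context slowly_varying_levy
begin

lemma jump_part_shift_diff:
  assumes s: "s > 0"
  shows "ennreal \<bar>jump_part \<nu> s z - jump_part \<nu> s (z + h)\<bar> \<le>
    (\<integral>\<^sup>+ t. ennreal \<bar>heat t z - heat t (z + h)\<bar> * indicator {s<..} t \<partial>\<nu>)" (is "_ \<le> ?X")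
proof -
  have *: "ennreal (jump_part \<nu> s a) \<le> ennreal (jump_part \<nu> s b) +
      (\<integral>\<^sup>+ t. ennreal \<bar>heat t a - heat t b\<bar> * indicator {s<..} t \<partial>\<nu>)" for a b :: 'a
    unfolding jump_part_eq[OF s]
    by (subst nn_integral_add [symmetric])
       (auto intro!: nn_integral_mono simp: indicator_def ennreal_plus [symmetric] simp del: ennreal_plus intro!: ennreal_leI)
  show ?thesis
  proof (cases "?X = \<infinity>")
    case False
    then obtain x where x: "?X = ennreal x" "x \<ge> 0" by (cases ?X) auto
    have "jump_part \<nu> s z \<le> jump_part \<nu> s (z + h) + x" "jump_part \<nu> s (z + h) \<le> jump_part \<nu> s z + x"
      using *[of z "z + h"] *[of "z + h" z] x
      by (simp_all add: abs_minus_commute ennreal_plus [symmetric] del: ennreal_plus)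
    then have "\<bar>jump_part \<nu> s z - jump_part \<nu> s (z + h)\<bar> \<le> x" by linarith
    then show ?thesis by (simp add: x ennreal_leI)
  qed simp
qed

text \<open>
  Integrate \<open>heat_shift_integral\<close> over the times \<open>t \<ge> k r\<^sup>2\<close>. A modulus that grows like a square
  root costs a factor \<open>sqrt (sqrt t / r)\<close>, which leaves \<open>sqrt (r / sqrt t)\<close> of the gain \<open>r /
  sqrt t\<close>, and this is as small as desired if \<open>k\<close> is large. Thus at least half of the mass of
  the kernel can be coupled.
\<close>

lemma jump_part_coupling:
  obtains k where "k \<ge> 1"
    "\<And>\<omega> r s (h::'a::euclidean_space). \<omega> \<in> borel_measurable borel \<Longrightarrow> mono \<omega> \<Longrightarrow> (\<And>x. \<omega> x \<ge> 0) \<Longrightarrow>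
       (\<And>x. x \<ge> r \<Longrightarrow> \<omega> x \<le> 2 * sqrt (x / r) * \<omega> r) \<Longrightarrow> r > 0 \<Longrightarrow> norm h = r \<Longrightarrow> s \<ge> k * r\<^sup>2 \<Longrightarrow>
       (\<integral>\<^sup>+ z. ennreal (\<omega> (norm z) * \<bar>jump_part \<nu> s z - jump_part \<nu> s (z + h)\<bar>) \<partial>lborel)
         \<le> ennreal (heat_moment TYPE('a) 0 / 2 * \<omega> r * measure \<nu> {s<..})"
proof -
  let ?G = "heat_moment TYPE('a) 0"
  obtain C where C: "C > 0" "\<And>t h. t > 0 \<Longrightarrow> norm h \<le> sqrt t \<Longrightarrow>
      (\<integral>\<^sup>+ (z::'a). ennreal (max 1 (norm z / sqrt t) * \<bar>heat t z - heat t (z + h)\<bar>) \<partial>lborel)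
        \<le> ennreal (C * (norm h / sqrt t))"
    using heat_shift_integral[where 'a='a] by blast
  define \<kappa> where "\<kappa> = ?G / (4 * C)"
  have \<kappa>: "\<kappa> > 0" using C heat_mass_pos[where 'a='a] by (simp add: \<kappa>_def)
  \<comment> \<open>for \<open>t \<ge> k r\<^sup>2\<close> this gives \<open>sqrt (r / sqrt t) \<le> \<kappa>\<close>, hence \<open>2 C sqrt (r / sqrt t) \<le> 2 C \<kappa>\<close>,
    half the heat mass\<close>
  define k where "k = max 1 (1 / \<kappa> ^ 4)"
  have k: "k \<ge> 1" "k \<ge> 1 / \<kappa> ^ 4" by (auto simp: k_def)
  show ?thesis
  proof (rule that[of k])
    fix \<omega> :: "real \<Rightarrow> real" and r s :: real and h :: 'a
    assume [measurable]: "\<omega> \<in> borel_measurable borel" and mono: "mono \<omega>" and nn: "\<And>x. \<omega> x \<ge> 0"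
      and growth: "\<And>x. x \<ge> r \<Longrightarrow> \<omega> x \<le> 2 * sqrt (x / r) * \<omega> r"
      and r: "r > 0" and h: "norm h = r" and s: "s \<ge> k * r\<^sup>2"
    have s0: "s > 0" using s k r by (intro less_le_trans[OF _ s]) simp
    have inner: "(\<integral>\<^sup>+ (z::'a). ennreal (\<omega> (norm z)) * ennreal \<bar>heat t z - heat t (z + h)\<bar> \<partial>lborel) \<le> ennreal (?G / 2 * \<omega> r)"
      if t: "t > s" for t
    proof -
      define u where "u = sqrt t / r"
      have kt: "k * r\<^sup>2 < t" using s t by linarith
      then have "1 * r\<^sup>2 < t" using k by (intro le_less_trans[OF mult_right_mono kt]) auto
      then have rt: "r \<le> sqrt t" by (simp add: real_le_rsqrt less_imp_le)
      then have u1: "u \<ge> 1" using r by (simp add: u_def)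
      have t0: "t > 0" using s0 t by simp
      have "k \<le> t / r\<^sup>2" using kt r by (simp add: pos_le_divide_eq)
      with k(2) have "1 / \<kappa> ^ 4 \<le> t / r\<^sup>2" by (rule order.trans)
      also have "t / r\<^sup>2 = u\<^sup>2" using t0 by (simp add: u_def power_divide)
      also have "1 / \<kappa> ^ 4 = (1 / \<kappa>\<^sup>2)\<^sup>2" by (simp add: power2_eq_square power4_eq_xxxx)
      finally have "(1 / \<kappa>\<^sup>2)\<^sup>2 \<le> u\<^sup>2" .
      then have "1 / \<kappa>\<^sup>2 \<le> u" by (rule power2_le_imp_le) (use u1 in simp)
      then have "(1 / \<kappa>)\<^sup>2 \<le> u" by (simp add: power_divide)
      then have \<kappa>u: "1 / \<kappa> \<le> sqrt u" by (rule real_le_rsqrt)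
      have su: "sqrt u * sqrt u = u" using u1 by simp
      have bound: "\<omega> (norm z) \<le> 2 * sqrt u * \<omega> r * max 1 (norm z / sqrt t)" for z :: 'a
      proof (cases "norm z \<ge> r")
        case True
        let ?m = "max 1 (norm z / sqrt t)"
        have "norm z / r \<le> u * ?m"
          using r t0 by (auto simp: u_def max_def field_simps)
        then have "sqrt (norm z / r) \<le> sqrt (u * ?m)" by (rule real_sqrt_le_mono)
        also have "\<dots> = sqrt u * sqrt ?m" by (rule real_sqrt_mult)
        also have "sqrt u * sqrt ?m \<le> sqrt u * ?m"
        proof (intro mult_left_mono)
          have "?m * 1 \<le> ?m * ?m" by (intro mult_left_mono) auto
          then show "sqrt ?m \<le> ?m" by (intro real_le_lsqrt) (auto simp: power2_eq_square)
        qed (use u1 in auto)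
        finally have "sqrt (norm z / r) \<le> sqrt u * ?m" .
        then have "2 * sqrt (norm z / r) * \<omega> r \<le> 2 * (sqrt u * ?m) * \<omega> r"
          using nn by (intro mult_right_mono mult_left_mono) auto
        then show ?thesis using growth[OF True] by (simp add: mult_ac)
      next
        case False
        then have "\<omega> (norm z) \<le> 1 * \<omega> r * 1" using monoD[OF mono, of "norm z" r] by simp
        also have "\<dots> \<le> 2 * sqrt u * \<omega> r * max 1 (norm z / sqrt t)"
        proof (intro mult_mono)
          have "sqrt 1 \<le> sqrt u" using u1 by (intro real_sqrt_le_mono)
          then show "1 \<le> 2 * sqrt u" unfolding real_sqrt_one by linarith
        qed (use nn u1 in auto)
        finally show ?thesis .
      qed
      have "(\<integral>\<^sup>+ (z::'a). ennreal (\<omega> (norm z)) * ennreal \<bar>heat t z - heat t (z + h)\<bar> \<partial>lborel) \<le>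
         (\<integral>\<^sup>+ (z::'a). ennreal (2 * sqrt u * \<omega> r) * ennreal (max 1 (norm z / sqrt t) * \<bar>heat t z - heat t (z + h)\<bar>) \<partial>lborel)"
      proof (intro nn_integral_mono)
        fix z :: 'a
        have "\<omega> (norm z) * \<bar>heat t z - heat t (z + h)\<bar> \<le> 2 * sqrt u * \<omega> r * max 1 (norm z / sqrt t) * \<bar>heat t z - heat t (z + h)\<bar>"
          using bound by (intro mult_right_mono) auto
        then show "ennreal (\<omega> (norm z)) * ennreal \<bar>heat t z - heat t (z + h)\<bar> \<le>
           ennreal (2 * sqrt u * \<omega> r) * ennreal (max 1 (norm z / sqrt t) * \<bar>heat t z - heat t (z + h)\<bar>)"
          using nn u1 by (simp add: ennreal_mult' [symmetric] mult.assoc ennreal_leI)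
      qed
      also have "\<dots> = ennreal (2 * sqrt u * \<omega> r) * (\<integral>\<^sup>+ (z::'a). ennreal (max 1 (norm z / sqrt t) * \<bar>heat t z - heat t (z + h)\<bar>) \<partial>lborel)"
        by (intro nn_integral_cmult) auto
      also have "\<dots> \<le> ennreal (2 * sqrt u * \<omega> r) * ennreal (C * (norm h / sqrt t))"
        using t0 rt h by (intro mult_left_mono C(2)) auto
      also have "\<dots> = ennreal (2 * sqrt u * \<omega> r * (C * (norm h / sqrt t)))"
        using nn u1 by (intro ennreal_mult' [symmetric]) auto
      also have "\<dots> \<le> ennreal (?G / 2 * \<omega> r)"
      proof (rule ennreal_leI)
        have "norm h / sqrt t = 1 / u" by (simp add: h u_def)
        also have "1 / u = 1 / sqrt u * (1 / sqrt u)" using su by simp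
        finally have "2 * sqrt u * \<omega> r * (C * (norm h / sqrt t)) =
            2 * sqrt u * \<omega> r * (C * (1 / sqrt u * (1 / sqrt u)))" by (simp only:)
        also have "\<dots> = 2 * C * \<omega> r * (1 / sqrt u) * (sqrt u * (1 / sqrt u))"
          by (simp only: mult_ac)
        also have "sqrt u * (1 / sqrt u) = 1" using u1 by simp
        finally have "2 * sqrt u * \<omega> r * (C * (norm h / sqrt t)) = 2 * C * \<omega> r * (1 / sqrt u)"
          by (simp only: mult_1_right)
        also have "\<dots> \<le> 2 * C * \<omega> r * \<kappa>"
        proof (intro mult_left_mono)
          have "sqrt u > 0" using u1 by simp
          then show "1 / sqrt u \<le> \<kappa>" using \<kappa>u \<kappa> by (simp add: field_simps)
        qed (use C nn in auto)
        also have "\<dots> = ?G / 2 * \<omega> r" using C by (simp add: \<kappa>_def field_simps)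
        finally show "2 * sqrt u * \<omega> r * (C * (norm h / sqrt t)) \<le> ?G / 2 * \<omega> r" .
      qed
      finally show ?thesis .
    qed
    have "(\<integral>\<^sup>+ z. ennreal (\<omega> (norm z) * \<bar>jump_part \<nu> s z - jump_part \<nu> s (z + h)\<bar>) \<partial>lborel) \<le>
      (\<integral>\<^sup>+ z. (\<integral>\<^sup>+ t. ennreal (\<omega> (norm z)) * (ennreal \<bar>heat t z - heat t (z + h)\<bar> * indicator {s<..} t) \<partial>\<nu>) \<partial>lborel)"
    proof (intro nn_integral_mono)
      fix z :: 'a
      have "ennreal (\<omega> (norm z) * \<bar>jump_part \<nu> s z - jump_part \<nu> s (z + h)\<bar>) \<le>
         ennreal (\<omega> (norm z)) * (\<integral>\<^sup>+ t. ennreal \<bar>heat t z - heat t (z + h)\<bar> * indicator {s<..} t \<partial>\<nu>)"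
        using nn by (subst ennreal_mult') (auto intro!: mult_left_mono jump_part_shift_diff s0)
      also have "\<dots> = (\<integral>\<^sup>+ t. ennreal (\<omega> (norm z)) * (ennreal \<bar>heat t z - heat t (z + h)\<bar> * indicator {s<..} t) \<partial>\<nu>)"
        by (subst nn_integral_cmult) auto
      finally show "ennreal (\<omega> (norm z) * \<bar>jump_part \<nu> s z - jump_part \<nu> s (z + h)\<bar>) \<le>
         (\<integral>\<^sup>+ t. ennreal (\<omega> (norm z)) * (ennreal \<bar>heat t z - heat t (z + h)\<bar> * indicator {s<..} t) \<partial>\<nu>)" .
    qed
    also have "\<dots> = (\<integral>\<^sup>+ t. (\<integral>\<^sup>+ z. ennreal (\<omega> (norm z)) * (ennreal \<bar>heat t z - heat t (z + h)\<bar> * indicator {s<..} t) \<partial>lborel) \<partial>\<nu>)"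
      by (rule heat_tonelli) measurable
    also have "\<dots> \<le> (\<integral>\<^sup>+ t. ennreal (?G / 2 * \<omega> r) * indicator {s<..} t \<partial>\<nu>)"
      using inner by (intro nn_integral_mono) (auto simp: indicator_def)
    also have "\<dots> = ennreal (?G / 2 * \<omega> r * measure \<nu> {s<..})"
      using s0 nn[of r] heat_mass_pos[where 'a='a]
      by (subst ennreal_mult') (simp_all add: nn_integral_cmult_indicator emeasure_tail)
    finally show "(\<integral>\<^sup>+ z. ennreal (\<omega> (norm z) * \<bar>jump_part \<nu> s z - jump_part \<nu> s (z + h)\<bar>) \<partial>lborel)
         \<le> ennreal (?G / 2 * \<omega> r * measure \<nu> {s<..})" .
  qed (use k in auto)
qed

end

section \<open>The discrete maximum principle for kernels of finite mass\<close>

text \<open>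
  Iterating \<open>T\<close> from \<open>v0\<close>, rather than invoking completeness of a function space, gives a fixed
  point that inherits every property \<open>P\<close> that \<open>T\<close> preserves and that passes to pointwise limits.
\<close>

lemma contraction_fixed_point_pointwise:
  fixes T :: "('b \<Rightarrow> real) \<Rightarrow> 'b \<Rightarrow> real"
  assumes v0: "P v0" and inv: "\<And>v. P v \<Longrightarrow> P (T v)"
    and closed: "\<And>s u. (\<And>n. P (s n)) \<Longrightarrow> (\<And>x. (\<lambda>n. s n x) \<longlonglongrightarrow> u x) \<Longrightarrow> P u"
    and bounded: "\<And>v x. P v \<Longrightarrow> \<bar>v x\<bar> \<le> A"
    and contr: "\<And>v w D x. P v \<Longrightarrow> P w \<Longrightarrow> (\<And>x. \<bar>v x - w x\<bar> \<le> D) \<Longrightarrow> \<bar>T v x - T w x\<bar> \<le> \<theta> * D"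
    and \<theta>: "0 \<le> \<theta>" "\<theta> < 1"
  obtains u where "P u" "T u = u"
proof -
  define s where "s = (\<lambda>n. (T ^^ n) v0)"
  have Ps: "P (s n)" for n unfolding s_def by (induction n) (auto intro: v0 inv)
  have diff: "\<bar>s (m + n) x - s n x\<bar> \<le> \<theta> ^ n * (2 * A)" for m n x
  proof (induction n arbitrary: x)
    case 0
    then show ?case using bounded[OF Ps, of m x] bounded[OF Ps, of 0 x] by simp
  next
    case (Suc n)
    have "\<bar>T (s (m + n)) x - T (s n) x\<bar> \<le> \<theta> * (\<theta> ^ n * (2 * A))"
      by (intro contr Ps Suc)
    then show ?case by (simp add: s_def mult.assoc)
  qed
  have lim0: "(\<lambda>n. \<theta> ^ n * (2 * A)) \<longlonglongrightarrow> 0"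
    using \<theta> by (intro tendsto_mult_left_zero LIMSEQ_power_zero) auto
  have "Cauchy (\<lambda>n. s n x)" for x
  proof (rule CauchyI)
    fix e :: real assume e: "e > 0"
    obtain N where N: "\<bar>\<theta> ^ N * (2 * A)\<bar> < e / 2"
      using LIMSEQ_D[OF lim0, of "e/2"] e by auto
    have "\<bar>s m x - s N x\<bar> < e / 2" if "m \<ge> N" for m
    proof -
      have "\<bar>s m x - s N x\<bar> \<le> \<theta> ^ N * (2 * A)" using diff[of "m - N" N x] that by simp
      then show ?thesis using N by linarith
    qed
    then have "norm (s m x - s n x) < e" if "m \<ge> N" "n \<ge> N" for m n
      using that by (smt (verit, best) field_sum_of_halves real_norm_def)
    then show "\<exists>M. \<forall>m\<ge>M. \<forall>n\<ge>M. norm (s m x - s n x) < e" by blast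
  qed
  then have "convergent (\<lambda>n. s n x)" for x by (rule Cauchy_convergent)
  then obtain u where u: "\<And>x. (\<lambda>n. s n x) \<longlonglongrightarrow> u x"
    unfolding convergent_def by metis
  have Pu: "P u" using Ps u by (rule closed)
  have near: "\<bar>u x - s n x\<bar> \<le> \<theta> ^ n * (2 * A)" for n x
  proof (rule LIMSEQ_le_const2)
    show "(\<lambda>m. \<bar>s (m + n) x - s n x\<bar>) \<longlonglongrightarrow> \<bar>u x - s n x\<bar>"
      by (intro tendsto_intros LIMSEQ_ignore_initial_segment u)
  qed (use diff in auto)
  have "T u x = u x" for x
  proof (rule LIMSEQ_unique)
    show "(\<lambda>n. s (Suc n) x) \<longlonglongrightarrow> u x" using u LIMSEQ_Suc by blast
    have "\<bar>s (Suc n) x - T u x\<bar> \<le> \<theta> ^ n * (2 * A)" for n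
    proof -
      have "\<bar>T u x - T (s n) x\<bar> \<le> \<theta> * (\<theta> ^ n * (2 * A))" by (intro contr Pu Ps near)
      also have "\<dots> \<le> 1 * (\<theta> ^ n * (2 * A))"
        using \<theta> order.trans[OF abs_ge_zero near[of x n]] by (intro mult_right_mono) auto
      finally show ?thesis by (simp add: s_def abs_minus_commute)
    qed
    then have "(\<lambda>n. s (Suc n) x - T u x) \<longlonglongrightarrow> 0"
      by (intro Lim_null_comparison[OF _ lim0]) auto
    then show "(\<lambda>n. s (Suc n) x) \<longlonglongrightarrow> T u x" by (simp add: LIM_zero_iff)
  qed
  then show ?thesis using Pu that by blast
qed

definition jump_op :: "('a::euclidean_space \<Rightarrow> real) \<Rightarrow> ('a \<Rightarrow> 'a \<Rightarrow> real) \<Rightarrow> ('a \<Rightarrow> real) \<Rightarrow> 'a \<Rightarrow> real" where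
  "jump_op k a v x = (\<integral>z. (v (x + z) - v x) * a x z * k z \<partial>lborel)"

definition has_modulus :: "(real \<Rightarrow> real) \<Rightarrow> ('a::real_normed_vector \<Rightarrow> real) \<Rightarrow> bool" where
  "has_modulus \<omega> v \<longleftrightarrow> (\<forall>x y. v x - v y \<le> \<omega> (norm (x - y)))"

lemma has_modulus_abs: "has_modulus \<omega> v \<Longrightarrow> \<bar>v x - v y\<bar> \<le> \<omega> (norm (x - y))"
  by (smt (verit) has_modulus_def norm_minus_commute)

lemma lborel_integrable_shift:
  fixes f :: "'a::euclidean_space \<Rightarrow> real"
  assumes "integrable lborel f"
  shows "integrable lborel (\<lambda>z. f (z + h))" "(\<integral>z. f (z + h) \<partial>lborel) = (\<integral>z. f z \<partial>lborel)"
proof -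
  have [measurable]: "f \<in> borel_measurable borel" using assms by (simp add: integrable_iff_bounded)
  have eq: "distr lborel borel (\<lambda>z. z + h) = (lborel :: 'a measure)"
  proof -
    have "(\<lambda>z. z + h) = (+) h" by (simp add: fun_eq_iff add.commute)
    then show ?thesis using lborel_distr_plus[of h] by (simp only:)
  qed
  show "integrable lborel (\<lambda>z. f (z + h))"
    using integrable_distr_eq[of "\<lambda>z. z + h" lborel borel f] assms by (simp add: eq)
  show "(\<integral>z. f (z + h) \<partial>lborel) = (\<integral>z. f z \<partial>lborel)"
    using integral_distr[of "\<lambda>z. z + h" lborel borel f] by (simp add: eq)
qed

lemma integrable_times_dominated:
  fixes g \<kappa> :: "'a::euclidean_space \<Rightarrow> real"
  assumes [measurable]: "g \<in> borel_measurable borel" and bd: "\<And>z. \<bar>g z\<bar> \<le> B" and \<kappa>: "integrable lborel \<kappa>"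
  shows "integrable lborel (\<lambda>z. g z * \<kappa> z)"
proof (rule Bochner_Integration.integrable_bound)
  show "integrable lborel (\<lambda>z. B * \<bar>\<kappa> z\<bar>)" using \<kappa> by simp
  have [measurable]: "\<kappa> \<in> borel_measurable borel" using \<kappa> by (simp add: integrable_iff_bounded)
  show "(\<lambda>z. g z * \<kappa> z) \<in> borel_measurable lborel" by simp
  show "AE z in lborel. norm (g z * \<kappa> z) \<le> norm (B * \<bar>\<kappa> z\<bar>)"
  proof (intro AE_I2)
    fix z :: 'a
    have "\<bar>g z\<bar> * \<bar>\<kappa> z\<bar> \<le> \<bar>B\<bar> * \<bar>\<kappa> z\<bar>" using bd[of z] by (intro mult_right_mono) auto
    then show "norm (g z * \<kappa> z) \<le> norm (B * \<bar>\<kappa> z\<bar>)" by (simp add: abs_mult)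
  qed
qed

text \<open>
  Here \<open>\<kappa>\<close> is the part of the kernel that is coupled, \<open>E\<close> bounds the variation of the
  coefficient and \<open>C1\<close> is a logarithmic Lipschitz constant of \<open>\<omega>\<close>. The inequality says that the
  merging rate \<open>\<integral> \<kappa>\<close> and the killing rate \<open>l\<close> outweigh, in this order, the right-hand side, the
  failure of the coupling, the part of the kernel where the coefficient may be negative, and the
  jumps that only one of the two points makes.
\<close>

definition coupling_estimate :: "('a::euclidean_space \<Rightarrow> real) \<Rightarrow> ('a \<Rightarrow> 'a \<Rightarrow> real) \<Rightarrow> real \<Rightarrow> real \<Rightarrow> real \<Rightarrow>
    ('a \<Rightarrow> real) \<Rightarrow> real \<Rightarrow> (real \<Rightarrow> real) \<Rightarrow> 'a \<Rightarrow> 'a \<Rightarrow> ('a \<Rightarrow> real) \<Rightarrow> real \<Rightarrow> real \<Rightarrow> bool" where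
  "coupling_estimate k a c0 \<Lambda> l f A \<omega> x y \<kappa> E C1 \<longleftrightarrow> (let r = norm (x - y) in
     integrable lborel \<kappa> \<and> (\<forall>z. 0 \<le> \<kappa> z \<and> \<kappa> z \<le> c0 * k z) \<and>
     (\<forall>z. \<bar>a x z - a y z\<bar> \<le> E) \<and> E \<le> 2 / c0 \<and> C1 \<ge> 0 \<and>
     (\<forall>s. 0 \<le> s \<longrightarrow> s \<le> r / 2 \<longrightarrow> \<omega> (r + s) \<le> \<omega> r * (1 + C1 * (s / r))) \<and>
     f x - f y + (\<integral>z. \<omega> (norm z) * \<bar>\<kappa> z - \<kappa> (z + (x - y))\<bar> \<partial>lborel) + 4 / c0 * \<omega> r * \<Lambda>
       + E * (C1 * \<omega> r * (\<integral>z. min 1 (norm z / r) * k z \<partial>lborel)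
          + (\<integral>z. min (\<omega> (norm z)) (2 * A) * indicator {z. r / 2 \<le> norm z} z * k z \<partial>lborel))
     \<le> \<omega> r * (l + (\<integral>z. \<kappa> z \<partial>lborel)))"

text \<open>
  The first alternative covers distant points, for which the supremum bound \<open>A\<close> already implies
  the modulus.
\<close>

definition supersolution :: "('a::euclidean_space \<Rightarrow> real) \<Rightarrow> ('a \<Rightarrow> 'a \<Rightarrow> real) \<Rightarrow> real \<Rightarrow> real \<Rightarrow> real \<Rightarrow>
    ('a \<Rightarrow> real) \<Rightarrow> real \<Rightarrow> (real \<Rightarrow> real) \<Rightarrow> bool" where
  "supersolution k a c0 \<Lambda> l f A \<omega> \<longleftrightarrow> (\<forall>x y. x \<noteq> y \<longrightarrow>
     2 * A \<le> \<omega> (norm (x - y)) \<or> (\<exists>\<kappa> E C1. coupling_estimate k a c0 \<Lambda> l f A \<omega> x y \<kappa> E C1))"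

definition admissible_modulus :: "(real \<Rightarrow> real) \<Rightarrow> bool" where
  "admissible_modulus \<omega> \<longleftrightarrow> \<omega> \<in> borel_measurable borel \<and> mono \<omega> \<and> (\<forall>s. 0 \<le> \<omega> s) \<and> (\<exists>\<Omega>. \<forall>s. \<omega> s \<le> \<Omega>)"

locale bounded_generator =
  fixes k :: "'a::euclidean_space \<Rightarrow> real" and a :: "'a \<Rightarrow> 'a \<Rightarrow> real" and c0 \<rho>0 \<Lambda> :: real
  assumes k_int: "integrable lborel k" and k_nonneg: "\<And>z. k z \<ge> 0"
    and a_meas: "(\<lambda>(x, z). a x z) \<in> borel_measurable (borel \<Otimes>\<^sub>M borel)"
    and a_bound: "\<And>x z. \<bar>a x z\<bar> \<le> 1 / c0"
    and a_lower: "\<And>x z. norm z < \<rho>0 \<Longrightarrow> a x z \<ge> c0"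
    and c0: "0 < c0" "c0 < 1"
    and far: "(\<integral>z. indicator {z. \<rho>0 \<le> norm z} z * k z \<partial>lborel) \<le> \<Lambda>"
begin

lemma k_meas [measurable]: "k \<in> borel_measurable borel"
  using k_int by (simp add: integrable_iff_bounded)

lemma coefficient_measurable [measurable (raw)]:
  assumes [measurable]: "f \<in> borel_measurable M" "g \<in> borel_measurable M"
  shows "(\<lambda>x. a (f x) (g x)) \<in> borel_measurable M"
  using measurable_compose[OF measurable_Pair[OF assms] a_meas] by simp

lemma integrable_times_k:
  fixes g :: "'a \<Rightarrow> real"
  assumes "g \<in> borel_measurable borel" "\<And>z. \<bar>g z\<bar> \<le> B"
  shows "integrable lborel (\<lambda>z. g z * k z)"
  using integrable_times_dominated[OF assms k_int] .

lemma mass_nonneg: "(\<integral>z. k z \<partial>lborel) \<ge> 0"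
  by (intro Bochner_Integration.integral_nonneg k_nonneg)

lemma \<Lambda>_nonneg: "\<Lambda> \<ge> 0"
proof -
  have "0 \<le> (\<integral>z. indicator {z. \<rho>0 \<le> norm z} z * k z \<partial>lborel)"
    by (intro Bochner_Integration.integral_nonneg) (simp add: k_nonneg)
  then show ?thesis using far by linarith
qed

lemma integrable_jump_op:
  assumes [measurable]: "v \<in> borel_measurable borel" and bd: "\<And>x. \<bar>v x\<bar> \<le> A"
  shows "integrable lborel (\<lambda>z. (v (x + z) - v x) * a x z * k z)"
proof (rule integrable_times_k)
  show "\<bar>(v (x + z) - v x) * a x z\<bar> \<le> (2 * A) * (1 / c0)" for z
  proof -
    have "\<bar>v (x + z) - v x\<bar> \<le> 2 * A" using bd[of "x + z"] bd[of x] by linarith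
    then show ?thesis unfolding abs_mult using a_bound[of x z] by (intro mult_mono) auto
  qed
qed simp

lemma jump_op_measurable:
  assumes [measurable]: "v \<in> borel_measurable borel"
  shows "jump_op k a v \<in> borel_measurable borel"
proof -
  have "(\<lambda>x. \<integral>z. (v (x + z) - v x) * a x z * k z \<partial>lborel) \<in> borel_measurable borel"
    by (intro sigma_finite_measure.borel_measurable_lebesgue_integral) (simp_all add: sigma_finite_lborel case_prod_beta)
  then show ?thesis by (simp add: jump_op_def[abs_def])
qed

lemma jump_op_diff:
  assumes [measurable]: "v \<in> borel_measurable borel" "w \<in> borel_measurable borel"
    and bd: "\<And>x. \<bar>v x\<bar> \<le> A" "\<And>x. \<bar>w x\<bar> \<le> A"
  shows "jump_op k a (\<lambda>x. v x - w x) x = jump_op k a v x - jump_op k a w x"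
proof -
  have "jump_op k a v x - jump_op k a w x = (\<integral>z. (v (x + z) - v x) * a x z * k z - (w (x + z) - w x) * a x z * k z \<partial>lborel)"
    unfolding jump_op_def
    by (intro Bochner_Integration.integral_diff [symmetric] integrable_jump_op[of _ A]) (use bd in auto)
  also have "\<dots> = jump_op k a (\<lambda>x. v x - w x) x"
    unfolding jump_op_def by (intro Bochner_Integration.integral_cong) (auto simp: algebra_simps)
  finally show ?thesis by simp
qed

text \<open>
  An upper bound for all jump intensities that occur below; an explicit Euler step of length \<open>\<tau>\<close>
  is monotone as soon as \<open>\<tau> * (l + rate) \<le> 1\<close>.
\<close>

definition rate :: real where "rate = (3 / c0 + 1) * (\<integral>z. k z \<partial>lborel)"

lemma rate: "rate \<ge> 0" "(\<integral>z. k z \<partial>lborel) / c0 \<le> rate"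
proof -
  show "rate \<ge> 0" using mass_nonneg c0 by (simp add: rate_def)
  have "1 / c0 * (\<integral>z. k z \<partial>lborel) \<le> rate"
    unfolding rate_def using mass_nonneg c0 by (intro mult_right_mono) (auto simp: field_simps)
  then show "(\<integral>z. k z \<partial>lborel) / c0 \<le> rate" by simp
qed

text \<open>
  The step is a combination of values of \<open>v\<close> whose weights would be nonnegative with total \<open>1 -
  \<tau> l\<close> if \<open>a\<close> were nonnegative. Negative values of \<open>a\<close> occur for \<open>|z| \<ge> \<rho>0\<close> only and cost at
  most \<open>2 / c0 * \<Lambda> \<le> l / 2\<close>. As \<open>g\<close> is an arbitrary number, the lemma serves as an invariance, a
  contraction and a stability estimate.
\<close>

lemma euler_step_bound:
  assumes [measurable]: "v \<in> borel_measurable borel" and bd: "\<And>x. \<bar>v x\<bar> \<le> A"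
    and l: "l \<ge> 2 * (2 / c0 * \<Lambda> + 1)" and \<tau>: "0 \<le> \<tau>" "\<tau> * (l + rate) \<le> 1"
  shows "\<bar>v x + \<tau> * (g - l * v x + jump_op k a v x)\<bar> \<le> A + \<tau> * (\<bar>g\<bar> - l / 2 * A)"
proof -
  have A: "A \<ge> 0" using bd[of x] by linarith
  have i1: "integrable lborel (\<lambda>z. (v (x + z) * a x z) * k z)"
  proof (rule integrable_times_k)
    show "\<bar>v (x + z) * a x z\<bar> \<le> A * (1 / c0)" for z
      unfolding abs_mult using a_bound[of x z] bd[of "x + z"] A by (intro mult_mono) auto
  qed simp
  have i2: "integrable lborel (\<lambda>z. a x z * k z)"
    by (rule integrable_times_k[of _ "1 / c0"]) (auto simp: a_bound)
  have i3: "integrable lborel (\<lambda>z. \<bar>a x z\<bar> * k z)"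
    by (rule integrable_times_k[of _ "1 / c0"]) (auto simp: a_bound)
  have i4: "integrable lborel (\<lambda>z. indicator {z. \<rho>0 \<le> norm z} z * k z)"
    by (rule integrable_times_k[of _ 1]) (auto simp: indicator_def)
  let ?I = "\<integral>z. (v (x + z) * a x z) * k z \<partial>lborel" and ?a = "\<integral>z. a x z * k z \<partial>lborel"
    and ?b = "\<integral>z. \<bar>a x z\<bar> * k z \<partial>lborel"
  have op: "jump_op k a v x = ?I - v x * ?a"
  proof -
    have "jump_op k a v x = (\<integral>z. (v (x + z) * a x z) * k z - v x * (a x z * k z) \<partial>lborel)"
      unfolding jump_op_def by (intro Bochner_Integration.integral_cong) (auto simp: algebra_simps)
    also have "\<dots> = ?I - v x * ?a"
      using i1 i2 by simp
    finally show ?thesis .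
  qed
  have I: "\<bar>?I\<bar> \<le> A * ?b"
  proof -
    have "\<bar>?I\<bar> \<le> (\<integral>z. \<bar>(v (x + z) * a x z) * k z\<bar> \<partial>lborel)"
      by (rule integral_abs_bound)
    also have "\<dots> \<le> (\<integral>z. A * (\<bar>a x z\<bar> * k z) \<partial>lborel)"
    proof (intro integral_mono)
      show "\<bar>v (x + z) * a x z * k z\<bar> \<le> A * (\<bar>a x z\<bar> * k z)" for z
        using bd[of "x + z"] k_nonneg[of z] by (simp add: abs_mult mult.assoc mult_right_mono)
    qed (use i1 i3 in auto)
    finally show ?thesis by simp
  qed
  have b: "?b \<le> ?a + 2 / c0 * \<Lambda>"
  proof -
    have "?b \<le> (\<integral>z. a x z * k z + 2 / c0 * (indicator {z. \<rho>0 \<le> norm z} z * k z) \<partial>lborel)"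
    proof (intro integral_mono Bochner_Integration.integrable_add integrable_mult_right i2 i3 i4)
      fix z :: 'a
      show "\<bar>a x z\<bar> * k z \<le> a x z * k z + 2 / c0 * (indicator {z. \<rho>0 \<le> norm z} z * k z)"
      proof (cases "norm z < \<rho>0")
        case True
        then have "a x z \<ge> 0" using a_lower[OF True, of x] c0 by linarith
        then show ?thesis using c0 k_nonneg[of z] by simp
      next
        case False
        have "\<bar>a x z\<bar> \<le> a x z + 2 * (1 / c0)" using a_bound[of x z] by linarith
        then have "\<bar>a x z\<bar> * k z \<le> (a x z + 2 * (1 / c0)) * k z"
          using k_nonneg[of z] by (intro mult_right_mono)
        then show ?thesis using False by (simp add: algebra_simps)
      qed
    qed
    also have "\<dots> = ?a + 2 / c0 * (\<integral>z. indicator {z. \<rho>0 \<le> norm z} z * k z \<partial>lborel)"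
      using i2 i4 by simp
    also have "\<dots> \<le> ?a + 2 / c0 * \<Lambda>"
      using far c0 by (intro add_left_mono mult_left_mono) auto
    finally show ?thesis .
  qed
  have a: "?a \<le> rate"
  proof -
    have "?a \<le> (\<integral>z. 1 / c0 * k z \<partial>lborel)"
    proof (intro integral_mono i2)
      show "a x z * k z \<le> 1 / c0 * k z" for z
        using a_bound[of x z] k_nonneg[of z] by (intro mult_right_mono) auto
    qed (use k_int in simp)
    also have "\<dots> = (\<integral>z. k z \<partial>lborel) / c0" by simp
    also have "\<dots> \<le> rate" by (rule rate)
    finally show ?thesis .
  qed
  have "\<tau> * (l + ?a) \<le> \<tau> * (l + rate)" using a \<tau> by (intro mult_left_mono) auto
  then have p: "0 \<le> 1 - \<tau> * (l + ?a)" using \<tau> by linarith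
  have "v x + \<tau> * (g - l * v x + jump_op k a v x) = v x * (1 - \<tau> * (l + ?a)) + \<tau> * g + \<tau> * ?I"
    unfolding op by (simp add: algebra_simps)
  also have "\<bar>\<dots>\<bar> \<le> \<bar>v x * (1 - \<tau> * (l + ?a))\<bar> + \<bar>\<tau> * g\<bar> + \<bar>\<tau> * ?I\<bar>"
    by linarith
  also have "\<dots> \<le> A * (1 - \<tau> * (l + ?a)) + \<tau> * \<bar>g\<bar> + \<tau> * (A * ?b)"
    using p \<tau> bd[of x] I by (auto simp: abs_mult intro!: add_mono mult_right_mono mult_left_mono)
  also have "\<dots> \<le> A * (1 - \<tau> * (l + ?a)) + \<tau> * \<bar>g\<bar> + \<tau> * (A * (?a + 2 / c0 * \<Lambda>))"
    using \<tau> A b by (intro add_left_mono mult_left_mono) auto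
  also have "\<dots> = A + \<tau> * \<bar>g\<bar> + \<tau> * (A * (2 / c0 * \<Lambda> - l))"
    by (simp add: algebra_simps)
  also have "\<dots> \<le> A + \<tau> * \<bar>g\<bar> + \<tau> * (A * (- (l / 2)))"
    using \<tau> A l by (intro add_left_mono mult_left_mono) auto
  also have "\<dots> = A + \<tau> * (\<bar>g\<bar> - l / 2 * A)" by (simp add: algebra_simps)
  finally show ?thesis .
qed

text \<open>
  A function is a fixed point of the Euler step with its own right-hand side, so
  \<open>euler_step_bound\<close> bounds the supremum of \<open>|v|\<close> by itself minus a positive multiple of itself.
\<close>

lemma resolvent_bound:
  assumes [measurable]: "v \<in> borel_measurable borel" and bd: "\<And>x. \<bar>v x\<bar> \<le> A"
    and l: "l \<ge> 2 * (2 / c0 * \<Lambda> + 1)"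
    and g: "\<And>x. \<bar>l * v x - jump_op k a v x\<bar> \<le> g"
  shows "\<bar>v x\<bar> \<le> 2 * g / l"
proof -
  have l0: "l > 0" using l \<Lambda>_nonneg c0 by (smt (verit) divide_nonneg_nonneg mult_nonneg_nonneg)
  define S where "S = (SUP x. \<bar>v x\<bar>)"
  have bdd: "bdd_above (range (\<lambda>x. \<bar>v x\<bar>))" using bd by (intro bdd_aboveI[of _ A]) auto
  have S: "\<bar>v x\<bar> \<le> S" for x unfolding S_def using bdd by (intro cSUP_upper) auto
  define \<tau> where "\<tau> = 1 / (l + rate)"
  have \<tau>: "\<tau> > 0" "\<tau> * (l + rate) \<le> 1" using l0 rate by (auto simp: \<tau>_def)
  have "\<bar>v x\<bar> \<le> S + \<tau> * (g - l / 2 * S)" for x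
  proof -
    have "\<bar>v x\<bar> = \<bar>v x + \<tau> * ((l * v x - jump_op k a v x) - l * v x + jump_op k a v x)\<bar>" by simp
    also have "\<dots> \<le> S + \<tau> * (\<bar>l * v x - jump_op k a v x\<bar> - l / 2 * S)"
      using \<tau> by (intro euler_step_bound l S) auto
    also have "\<dots> \<le> S + \<tau> * (g - l / 2 * S)"
      using g[of x] \<tau> by (intro add_left_mono mult_left_mono) auto
    finally show ?thesis .
  qed
  then have "S \<le> S + \<tau> * (g - l / 2 * S)"
    unfolding S_def[symmetric] by (subst (1) S_def) (intro cSUP_least, auto)
  then have "0 \<le> \<tau> * (g - l / 2 * S)" by simp
  then have "0 \<le> g - l / 2 * S" using \<tau> by (simp add: zero_le_mult_iff)
  then have "S \<le> 2 * g / l" using l0 by (simp add: field_simps)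
  then show ?thesis using S[of x] by linarith
qed

text \<open>
  After the substitution \<open>z \<mapsto> z + (x - y)\<close> in the jumps from \<open>y\<close>, both jumps end at \<open>x + z\<close>, so
  that they cancel up to the mass by which \<open>\<kappa>\<close> and its translate differ. What remains is \<open>- (v x
  - v y)\<close> times the mass of \<open>\<kappa>\<close>.
\<close>

lemma coupled_part_le:
  fixes v \<kappa> :: "'a \<Rightarrow> real"
  assumes [measurable]: "v \<in> borel_measurable borel" and bd: "\<And>x. \<bar>v x\<bar> \<le> A"
    and [measurable]: "\<omega> \<in> borel_measurable borel" and \<omega>: "\<And>s. 0 \<le> \<omega> s" "\<And>s. \<omega> s \<le> \<Omega>" and md: "has_modulus \<omega> v"
    and \<kappa>: "integrable lborel \<kappa>"
  shows "(\<integral>z. (v (x + z) - v x) * \<kappa> z - (v (y + z) - v y) * \<kappa> z \<partial>lborel) \<le>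
     (\<integral>z. \<omega> (norm z) * \<bar>\<kappa> z - \<kappa> (z + (x - y))\<bar> \<partial>lborel) - (v x - v y) * (\<integral>z. \<kappa> z \<partial>lborel)"
proof -
  have v2: "\<bar>v p - v q\<bar> \<le> 2 * A" for p q using bd[of p] bd[of q] by linarith
  have \<kappa>': "integrable lborel (\<lambda>z. \<kappa> (z + (x - y)))" by (rule lborel_integrable_shift[OF \<kappa>])
  have i1: "integrable lborel (\<lambda>z. (v (x + z) - v x) * \<kappa> z)"
    by (rule integrable_times_dominated[OF _ _ \<kappa>]) (auto intro: v2)
  have i2: "integrable lborel (\<lambda>z. (v (y + z) - v y) * \<kappa> z)"
    by (rule integrable_times_dominated[OF _ _ \<kappa>]) (auto intro: v2)
  have i2': "integrable lborel (\<lambda>z. (v (y + z) - v x) * \<kappa> z)"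
    by (rule integrable_times_dominated[OF _ _ \<kappa>]) (auto intro: v2)
  have i3: "integrable lborel (\<lambda>z. (v (x + z) - v x) * \<kappa> (z + (x - y)))"
    by (rule integrable_times_dominated[OF _ _ \<kappa>']) (auto intro: v2)
  have i4: "integrable lborel (\<lambda>z. \<omega> (norm z) * \<bar>\<kappa> z - \<kappa> (z + (x - y))\<bar>)"
    by (rule integrable_times_dominated[of _ \<Omega>]) (use \<kappa> \<kappa>' \<omega> in auto)
  have shift: "(\<integral>z. (v (y + z) - v x) * \<kappa> z \<partial>lborel) = (\<integral>z. (v (x + z) - v x) * \<kappa> (z + (x - y)) \<partial>lborel)"
    using lborel_integrable_shift(2)[OF i2', of "x - y"] by (simp add: algebra_simps)
  have "(\<integral>z. (v (x + z) - v x) * \<kappa> z - (v (y + z) - v y) * \<kappa> z \<partial>lborel) =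
     (\<integral>z. ((v (x + z) - v x) * \<kappa> z - (v (y + z) - v x) * \<kappa> z) - (v x - v y) * \<kappa> z \<partial>lborel)"
    by (intro Bochner_Integration.integral_cong) (auto simp: algebra_simps)
  also have "\<dots> = ((\<integral>z. (v (x + z) - v x) * \<kappa> z \<partial>lborel) - (\<integral>z. (v (x + z) - v x) * \<kappa> (z + (x - y)) \<partial>lborel))
      - (v x - v y) * (\<integral>z. \<kappa> z \<partial>lborel)"
    using i1 i2' \<kappa> shift
    by (subst Bochner_Integration.integral_diff, simp, simp, subst Bochner_Integration.integral_diff) simp_all
  also have "(\<integral>z. (v (x + z) - v x) * \<kappa> z \<partial>lborel) - (\<integral>z. (v (x + z) - v x) * \<kappa> (z + (x - y)) \<partial>lborel) =
     (\<integral>z. (v (x + z) - v x) * \<kappa> z - (v (x + z) - v x) * \<kappa> (z + (x - y)) \<partial>lborel)"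
    using i1 i3 by simp
  also have "\<dots> \<le> (\<integral>z. \<omega> (norm z) * \<bar>\<kappa> z - \<kappa> (z + (x - y))\<bar> \<partial>lborel)"
  proof (intro integral_mono Bochner_Integration.integrable_diff i1 i3 i4)
    fix z
    have "(v (x + z) - v x) * \<kappa> z - (v (x + z) - v x) * \<kappa> (z + (x - y)) = (v (x + z) - v x) * (\<kappa> z - \<kappa> (z + (x - y)))"
      by (simp add: right_diff_distrib)
    also have "\<dots> \<le> \<bar>v (x + z) - v x\<bar> * \<bar>\<kappa> z - \<kappa> (z + (x - y))\<bar>"
      by (metis abs_ge_self abs_mult)
    also have "\<dots> \<le> \<omega> (norm z) * \<bar>\<kappa> z - \<kappa> (z + (x - y))\<bar>"
      using has_modulus_abs[OF md, of "x + z" x] by (intro mult_right_mono) auto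
    finally show "(v (x + z) - v x) * \<kappa> z - (v (x + z) - v x) * \<kappa> (z + (x - y)) \<le> \<omega> (norm z) * \<bar>\<kappa> z - \<kappa> (z + (x - y))\<bar>" .
  qed
  finally show ?thesis by simp
qed

text \<open>
  The pointwise split of the kernel for the pair \<open>(x, y)\<close>: the part \<open>\<kappa>\<close>, the rest of the common
  part \<open>min (a x z) (a y z) k\<close>, and the excess \<open>|a x z - a y z| k\<close>, by which only one of the
  points jumps. A multiple of \<open>\<omega> r - (v x - v y)\<close> on the right is harmless: in the Euler step it
  is multiplied by \<open>\<tau>\<close> and is then absorbed by the gap itself.
\<close>

lemma integrand_diff_le:
  assumes bd: "\<And>x. \<bar>v x\<bar> \<le> A"
    and \<omega>: "\<And>s. 0 \<le> \<omega> s" "mono \<omega>" and md: "has_modulus \<omega> v"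
    and \<kappa>: "0 \<le> \<kappa>" "\<kappa> \<le> c0 * k z"
    and r: "r > 0" "norm (x - y) = r"
    and E: "\<bar>a x z - a y z\<bar> \<le> E"
    and C1: "C1 \<ge> 0" "\<And>s. 0 \<le> s \<Longrightarrow> s \<le> r / 2 \<Longrightarrow> \<omega> (r + s) \<le> \<omega> r * (1 + C1 * (s / r))"
  shows "(v (x + z) - v x) * a x z * k z - (v (y + z) - v y) * a y z * k z \<le>
     ((v (x + z) - v x) * \<kappa> - (v (y + z) - v y) * \<kappa>) + (\<omega> r - (v x - v y)) * (1 / c0 + E) * k z
     + 4 / c0 * \<omega> r * (indicator {z. \<rho>0 \<le> norm z} z * k z)
     + E * (C1 * \<omega> r) * (min 1 (norm z / r) * k z)
     + E * (min (\<omega> (norm z)) (2 * A) * indicator {z. r / 2 \<le> norm z} z * k z)"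
proof -
  define D where "D = v x - v y"
  define d where "d = v (x + z) - v (y + z) - D"
  define w1 where "w1 = v (x + z) - v x"
  define w2 where "w2 = v (y + z) - v y"
  define m where "m = min (a x z) (a y z)"
  define e where "e = \<bar>a x z - a y z\<bar>"
  define B where "B = (\<omega> r - D) + C1 * \<omega> r * min 1 (norm z / r) + min (\<omega> (norm z)) (2 * A) * indicator {z. r / 2 \<le> norm z} z"
  note k0 = k_nonneg[of z]
  have c1: "c0 \<le> 1 / c0" using c0 by (simp add: field_simps mult_le_one)
  have A0: "A \<ge> 0" using bd[of x] by linarith
  have D: "D \<le> \<omega> r" "- \<omega> r \<le> D"
    using has_modulus_abs[OF md, of x y] r by (auto simp: D_def)
  have v12: "\<bar>v (x + z) - v (y + z)\<bar> \<le> \<omega> r"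
    using has_modulus_abs[OF md, of "x + z" "y + z"] r by simp
  have d12: "d = w1 - w2" by (simp add: d_def w1_def w2_def D_def)
  have E0: "0 \<le> e" "e \<le> E" using E by (auto simp: e_def)
  have B0: "0 \<le> B" unfolding B_def using D C1 \<omega>(1) A0 r by (intro add_nonneg_nonneg mult_nonneg_nonneg) auto
  have w: "w1 \<le> B \<and> - w2 \<le> B"
  proof (cases "r / 2 \<le> norm z")
    case True
    have "\<bar>w1\<bar> \<le> min (\<omega> (norm z)) (2 * A)" "\<bar>w2\<bar> \<le> min (\<omega> (norm z)) (2 * A)"
      unfolding w1_def w2_def
      using has_modulus_abs[OF md, of "x + z" x] has_modulus_abs[OF md, of "y + z" y]
        bd[of "x + z"] bd[of x] bd[of "y + z"] bd[of y] by auto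
    moreover have "0 \<le> (\<omega> r - D) + C1 * \<omega> r * min 1 (norm z / r)"
      using D C1 \<omega>(1) r by (intro add_nonneg_nonneg mult_nonneg_nonneg) auto
    ultimately show ?thesis using True unfolding B_def by auto
  next
    case False
    then have z: "norm z < r / 2" by simp
    then have zr: "min 1 (norm z / r) = norm z / r" using r by (simp add: min_def)
    have "\<omega> (norm (x + z - y)) \<le> \<omega> (r + norm z)"
      using norm_triangle_ineq[of "x - y" z] r by (intro monoD[OF \<omega>(2)]) (simp add: algebra_simps)
    moreover have "\<omega> (norm (x - (y + z))) \<le> \<omega> (r + norm z)"
      using norm_triangle_ineq4[of "x - y" z] r by (intro monoD[OF \<omega>(2)]) (simp add: algebra_simps)
    moreover have "\<omega> (r + norm z) \<le> \<omega> r * (1 + C1 * (norm z / r))" using z by (intro C1) auto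
    moreover have "v (x + z) - v y \<le> \<omega> (norm (x + z - y))" "v x - v (y + z) \<le> \<omega> (norm (x - (y + z)))"
      using md by (auto simp: has_modulus_def)
    moreover have "B = (\<omega> r - D) + C1 * \<omega> r * (norm z / r)"
      using z unfolding B_def zr by simp
    ultimately show ?thesis
      by (simp add: w1_def w2_def D_def algebra_simps)
  qed
  have eB: "w1 * e * k z \<le> B * E * k z" "- w2 * e * k z \<le> B * E * k z"
  proof -
    have "w1 * e \<le> B * e" using w E0 by (intro mult_right_mono) auto
    also have "\<dots> \<le> B * E" using E0 B0 by (intro mult_left_mono)
    finally show "w1 * e * k z \<le> B * E * k z" using k0 by (intro mult_right_mono)
    have "- w2 * e \<le> B * e" using w E0 by (intro mult_right_mono) auto
    also have "\<dots> \<le> B * E" using E0 B0 by (intro mult_left_mono)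
    finally show "- w2 * e * k z \<le> B * E * k z" using k0 by (intro mult_right_mono)
  qed
  have split: "w1 * a x z * k z - w2 * a y z * k z \<le> d * (m * k z) + B * E * k z"
  proof (cases "a x z \<ge> a y z")
    case True
    then have m: "m = a y z" and e: "a x z = a y z + e" by (auto simp: m_def e_def)
    have "w1 * a x z * k z - w2 * a y z * k z = d * (m * k z) + w1 * e * k z"
      unfolding m e d12 by (simp add: algebra_simps)
    then show ?thesis using eB by linarith
  next
    case False
    then have m: "m = a x z" and e: "a y z = a x z + e" by (auto simp: m_def e_def)
    have "w1 * a x z * k z - w2 * a y z * k z = d * (m * k z) + - w2 * e * k z"
      unfolding m e d12 by (simp add: algebra_simps)
    then show ?thesis using eB by linarith
  qed
  have sync: "d * (m * k z - \<kappa>) \<le> (\<omega> r - D) * (1 / c0) * k z + 4 / c0 * \<omega> r * (indicator {z. \<rho>0 \<le> norm z} z * k z)"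
  proof (cases "norm z < \<rho>0")
    case True
    have "c0 \<le> m" using a_lower[OF True] by (simp add: m_def)
    then have "c0 * k z \<le> m * k z" using k0 by (intro mult_right_mono)
    then have p: "0 \<le> m * k z - \<kappa>" using \<kappa> by linarith
    have "m \<le> 1 / c0" using a_bound[of x z] by (auto simp: m_def)
    then have "m * k z \<le> 1 / c0 * k z" using k0 by (intro mult_right_mono)
    then have q: "m * k z - \<kappa> \<le> 1 / c0 * k z" using \<kappa> by linarith
    have "d \<le> \<omega> r - D" using v12 by (auto simp: d_def)
    then have "d * (m * k z - \<kappa>) \<le> (\<omega> r - D) * (m * k z - \<kappa>)" using p by (intro mult_right_mono)
    also have "\<dots> \<le> (\<omega> r - D) * (1 / c0 * k z)" using q D by (intro mult_left_mono) auto
    finally show ?thesis using True by simp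
  next
    case False
    have "\<bar>m\<bar> \<le> 1 / c0" using a_bound[of x z] a_bound[of y z] by (auto simp: m_def)
    then have "\<bar>m\<bar> * k z \<le> 1 / c0 * k z" using k0 by (intro mult_right_mono)
    then have "\<bar>m * k z\<bar> \<le> 1 / c0 * k z" using k0 by (simp add: abs_mult)
    moreover have "c0 * k z \<le> 1 / c0 * k z" using c1 k0 by (intro mult_right_mono)
    ultimately have "\<bar>m * k z - \<kappa>\<bar> \<le> 2 * (1 / c0 * k z)" using \<kappa> by linarith
    moreover have "\<bar>d\<bar> \<le> 2 * \<omega> r" using v12 D by (auto simp: d_def)
    ultimately have "\<bar>d\<bar> * \<bar>m * k z - \<kappa>\<bar> \<le> (2 * \<omega> r) * (2 * (1 / c0 * k z))"
      using \<omega>(1) by (intro mult_mono) auto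
    then have "d * (m * k z - \<kappa>) \<le> (2 * \<omega> r) * (2 * (1 / c0 * k z))"
      by (metis abs_ge_self abs_mult order.trans)
    moreover have "0 \<le> (\<omega> r - D) * (1 / c0) * k z" using D k0 c0 by simp
    ultimately show ?thesis using False by (simp add: field_simps)
  qed
  have "w1 * a x z * k z - w2 * a y z * k z \<le> (d * \<kappa> + d * (m * k z - \<kappa>)) + B * E * k z"
    using split by (simp add: algebra_simps)
  also have "\<dots> \<le> (d * \<kappa> + ((\<omega> r - D) * (1 / c0) * k z + 4 / c0 * \<omega> r * (indicator {z. \<rho>0 \<le> norm z} z * k z))) + B * E * k z"
    using sync by simp
  also have "\<dots> = (w1 * \<kappa> - w2 * \<kappa>) + (\<omega> r - D) * (1 / c0 + E) * k z
     + 4 / c0 * \<omega> r * (indicator {z. \<rho>0 \<le> norm z} z * k z)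
     + E * (C1 * \<omega> r) * (min 1 (norm z / r) * k z)
     + E * (min (\<omega> (norm z)) (2 * A) * indicator {z. r / 2 \<le> norm z} z * k z)"
    unfolding B_def d12 by (simp add: algebra_simps)
  finally show ?thesis unfolding w1_def w2_def D_def .
qed

lemma jump_op_diff_le:
  assumes [measurable]: "v \<in> borel_measurable borel" and bd: "\<And>x. \<bar>v x\<bar> \<le> A"
    and [measurable]: "\<omega> \<in> borel_measurable borel"
    and \<omega>: "\<And>s. 0 \<le> \<omega> s" "mono \<omega>" "\<And>s. \<omega> s \<le> \<Omega>" and md: "has_modulus \<omega> v"
    and \<kappa>_int: "integrable lborel \<kappa>" and \<kappa>: "\<And>z. 0 \<le> \<kappa> z" "\<And>z. \<kappa> z \<le> c0 * k z"
    and r: "r > 0" "norm (x - y) = r"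
    and E: "\<And>z. \<bar>a x z - a y z\<bar> \<le> E"
    and C1: "C1 \<ge> 0" "\<And>s. 0 \<le> s \<Longrightarrow> s \<le> r / 2 \<Longrightarrow> \<omega> (r + s) \<le> \<omega> r * (1 + C1 * (s / r))"
  shows "jump_op k a v x - jump_op k a v y \<le>
     (\<omega> r - (v x - v y)) * ((1 / c0 + E + c0) * (\<integral>z. k z \<partial>lborel))
     + (\<integral>z. \<omega> (norm z) * \<bar>\<kappa> z - \<kappa> (z + (x - y))\<bar> \<partial>lborel) - \<omega> r * (\<integral>z. \<kappa> z \<partial>lborel)
     + 4 / c0 * \<omega> r * \<Lambda>
     + E * (C1 * \<omega> r * (\<integral>z. min 1 (norm z / r) * k z \<partial>lborel)
          + (\<integral>z. min (\<omega> (norm z)) (2 * A) * indicator {z. r / 2 \<le> norm z} z * k z \<partial>lborel))"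
proof -
  let ?D = "v x - v y"
  have v2: "\<bar>v p - v q\<bar> \<le> 2 * A" for p q using bd[of p] bd[of q] by linarith
  have A0: "A \<ge> 0" using bd[of x] by linarith
  have iI: "integrable lborel (\<lambda>z. (v (x + z) - v x) * a x z * k z)"
    "integrable lborel (\<lambda>z. (v (y + z) - v y) * a y z * k z)"
    by (rule integrable_jump_op[OF _ bd], simp)+
  have i1: "integrable lborel (\<lambda>z. (v (x + z) - v x) * \<kappa> z)" "integrable lborel (\<lambda>z. (v (y + z) - v y) * \<kappa> z)"
    by (rule integrable_times_dominated[OF _ _ \<kappa>_int]; (simp | rule v2))+
  have i3: "integrable lborel (\<lambda>z. indicator {z. \<rho>0 \<le> norm z} z * k z)"
    by (rule integrable_times_k[of _ 1]) (auto simp: indicator_def)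
  have i4: "integrable lborel (\<lambda>z. min 1 (norm z / r) * k z)"
    by (rule integrable_times_k[of _ 1]) (use r in auto)
  have i5: "integrable lborel (\<lambda>z. min (\<omega> (norm z)) (2 * A) * indicator {z. r / 2 \<le> norm z} z * k z)"
    by (rule integrable_times_k[of _ "2 * A"]) (use A0 \<omega>(1) in \<open>auto simp: indicator_def abs_mult\<close>)
  let ?f1 = "\<lambda>z. (v (x + z) - v x) * \<kappa> z - (v (y + z) - v y) * \<kappa> z"
  let ?f2 = "\<lambda>z. (\<omega> r - ?D) * (1 / c0 + E) * k z"
  let ?f3 = "\<lambda>z. 4 / c0 * \<omega> r * (indicator {z. \<rho>0 \<le> norm z} z * k z)"
  let ?f4 = "\<lambda>z. E * (C1 * \<omega> r) * (min 1 (norm z / r) * k z)"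
  let ?f5 = "\<lambda>z. E * (min (\<omega> (norm z)) (2 * A) * indicator {z. r / 2 \<le> norm z} z * k z)"
  have j1: "integrable lborel ?f1" by (rule Bochner_Integration.integrable_diff[OF i1])
  have j2: "integrable lborel ?f2" by (rule integrable_mult_right[OF k_int])
  have j3: "integrable lborel ?f3" by (rule integrable_mult_right[OF i3])
  have j4: "integrable lborel ?f4" by (rule integrable_mult_right[OF i4])
  have j5: "integrable lborel ?f5" by (rule integrable_mult_right[OF i5])
  note j12 = Bochner_Integration.integrable_add[OF j1 j2]
  note j123 = Bochner_Integration.integrable_add[OF j12 j3]
  note j1234 = Bochner_Integration.integrable_add[OF j123 j4]
  note j = Bochner_Integration.integrable_add[OF j1234 j5]
  have D: "?D \<le> \<omega> r" using has_modulus_abs[OF md, of x y] r by auto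
  have "jump_op k a v x - jump_op k a v y =
     (\<integral>z. (v (x + z) - v x) * a x z * k z - (v (y + z) - v y) * a y z * k z \<partial>lborel)"
    unfolding jump_op_def by (rule Bochner_Integration.integral_diff[OF iI, symmetric])
  also have "\<dots> \<le> (\<integral>z. ?f1 z + ?f2 z + ?f3 z + ?f4 z + ?f5 z \<partial>lborel)"
    by (intro integral_mono Bochner_Integration.integrable_diff[OF iI] j
        integrand_diff_le[OF bd \<omega>(1,2) md \<kappa> r E C1])
  also have "\<dots> = (\<integral>z. ?f1 z \<partial>lborel) + (\<integral>z. ?f2 z \<partial>lborel) + (\<integral>z. ?f3 z \<partial>lborel) + (\<integral>z. ?f4 z \<partial>lborel) + (\<integral>z. ?f5 z \<partial>lborel)"
    by (simp only: Bochner_Integration.integral_add[OF j1234 j5] Bochner_Integration.integral_add[OF j123 j4]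
        Bochner_Integration.integral_add[OF j12 j3] Bochner_Integration.integral_add[OF j1 j2])
  also have "(\<integral>z. ?f2 z \<partial>lborel) = (\<omega> r - ?D) * (1 / c0 + E) * (\<integral>z. k z \<partial>lborel)"
    by (rule integral_mult_right_zero)
  also have "(\<integral>z. ?f3 z \<partial>lborel) = 4 / c0 * \<omega> r * (\<integral>z. indicator {z. \<rho>0 \<le> norm z} z * k z \<partial>lborel)"
    by (rule integral_mult_right_zero)
  also have "(\<integral>z. ?f4 z \<partial>lborel) = E * (C1 * \<omega> r) * (\<integral>z. min 1 (norm z / r) * k z \<partial>lborel)"
    by (rule integral_mult_right_zero)
  also have "(\<integral>z. ?f5 z \<partial>lborel) = E * (\<integral>z. min (\<omega> (norm z)) (2 * A) * indicator {z. r / 2 \<le> norm z} z * k z \<partial>lborel)"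
    by (rule integral_mult_right_zero)
  finally have main: "jump_op k a v x - jump_op k a v y \<le> (\<integral>z. ?f1 z \<partial>lborel) + (\<omega> r - ?D) * (1 / c0 + E) * (\<integral>z. k z \<partial>lborel)
    + 4 / c0 * \<omega> r * (\<integral>z. indicator {z. \<rho>0 \<le> norm z} z * k z \<partial>lborel)
    + E * (C1 * \<omega> r) * (\<integral>z. min 1 (norm z / r) * k z \<partial>lborel)
    + E * (\<integral>z. min (\<omega> (norm z)) (2 * A) * indicator {z. r / 2 \<le> norm z} z * k z \<partial>lborel)" .
  have c: "(\<integral>z. ?f1 z \<partial>lborel) \<le> (\<integral>z. \<omega> (norm z) * \<bar>\<kappa> z - \<kappa> (z + (x - y))\<bar> \<partial>lborel) - ?D * (\<integral>z. \<kappa> z \<partial>lborel)"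
    by (rule coupled_part_le[OF _ bd _ \<omega>(1,3) md \<kappa>_int]) simp_all
  have f: "4 / c0 * \<omega> r * (\<integral>z. indicator {z. \<rho>0 \<le> norm z} z * k z \<partial>lborel) \<le> 4 / c0 * \<omega> r * \<Lambda>"
    using far c0 \<omega>(1) by (intro mult_left_mono) auto
  have "(\<integral>z. \<kappa> z \<partial>lborel) \<le> (\<integral>z. c0 * k z \<partial>lborel)"
    using \<kappa>_int k_int \<kappa> by (intro integral_mono) auto
  then have "(\<integral>z. \<kappa> z \<partial>lborel) \<le> c0 * (\<integral>z. k z \<partial>lborel)" by simp
  then have "(\<omega> r - ?D) * (\<integral>z. \<kappa> z \<partial>lborel) \<le> (\<omega> r - ?D) * (c0 * (\<integral>z. k z \<partial>lborel))"
    using D by (intro mult_left_mono) auto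
  moreover have "J \<le> (w - D) * ((c' + E + c0) * K) + X - w * \<kappa>' + L + E * (C1 * w * I4 + I5)"
    if "J \<le> I1 + (w - D) * (c' + E) * K + L' + E * (C1 * w) * I4 + E * I5"
      "I1 \<le> X - D * \<kappa>'" "L' \<le> L" "(w - D) * \<kappa>' \<le> (w - D) * (c0 * K)"
    for J I1 w D c' K L L' I4 I5 X \<kappa>' :: real
  proof -
    have "(w - D) * ((c' + E + c0) * K) + X - w * \<kappa>' + L + E * (C1 * w * I4 + I5) =
       (X - D * \<kappa>') + (w - D) * (c' + E) * K + L + E * (C1 * w) * I4 + E * I5
       + ((w - D) * (c0 * K) - (w - D) * \<kappa>')"
      by (simp add: algebra_simps)
    then show ?thesis using that by linarith
  qed
  ultimately show ?thesis using main c f by blast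
qed

text \<open>
  If \<open>v x - v y\<close> falls short of \<open>\<omega> r\<close>, then the step closes at most the fraction \<open>\<tau> * (l + rate)
  \<le> 1\<close> of the gap; everything else in the step is nonpositive by the supersolution property. In
  this form the maximum principle works without a pair of points at which the ratio is maximal.
\<close>

lemma euler_step_modulus:
  assumes v[measurable]: "v \<in> borel_measurable borel" and bd: "\<And>x. \<bar>v x\<bar> \<le> A"
    and \<omega>: "admissible_modulus \<omega>" and md: "has_modulus \<omega> v"
    and sup: "supersolution k a c0 \<Lambda> l f A \<omega>" and l: "l \<ge> 2 * (2 / c0 * \<Lambda> + 1)" and f: "\<And>x. \<bar>f x\<bar> \<le> l / 2 * A"
    and \<tau>: "0 \<le> \<tau>" "\<tau> * (l + rate) \<le> 1"
  shows "has_modulus \<omega> (\<lambda>x. v x + \<tau> * (f x - l * v x + jump_op k a v x))"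
  unfolding has_modulus_def
proof (intro allI)
  fix x y :: 'a
  let ?T = "\<lambda>x. v x + \<tau> * (f x - l * v x + jump_op k a v x)"
  obtain \<Omega> where w: "\<omega> \<in> borel_measurable borel" "mono \<omega>" "\<And>s. 0 \<le> \<omega> s" "\<And>s. \<omega> s \<le> \<Omega>"
    using \<omega> by (auto simp: admissible_modulus_def)
  define r where "r = norm (x - y)"
  have l0: "l > 0" using l \<Lambda>_nonneg c0 by (smt (verit) divide_nonneg_nonneg mult_nonneg_nonneg)
  have TA: "\<bar>?T x\<bar> \<le> A" for x
  proof -
    have "\<bar>?T x\<bar> \<le> A + \<tau> * (\<bar>f x\<bar> - l / 2 * A)"
      by (rule euler_step_bound[OF v bd l \<tau>])
    also have "\<dots> \<le> A + \<tau> * 0" using f[of x] \<tau> by (intro add_left_mono mult_left_mono) auto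
    finally show ?thesis by simp
  qed
  show "?T x - ?T y \<le> \<omega> (norm (x - y))"
  proof (cases "x = y")
    case True
    then show ?thesis using w(3)[of 0] by simp
  next
    case False
    then have r: "r > 0" by (simp add: r_def)
    from sup[unfolded supersolution_def, rule_format, OF False]
    show ?thesis
    proof (elim disjE exE)
      assume "2 * A \<le> \<omega> (norm (x - y))"
      then show ?thesis using TA[of x] TA[of y] by linarith
    next
      fix \<kappa> E C1
      assume "coupling_estimate k a c0 \<Lambda> l f A \<omega> x y \<kappa> E C1"
      note h = this[unfolded coupling_estimate_def Let_def r_def[symmetric]]
      let ?D = "v x - v y"
      define X where "X = (\<integral>z. \<omega> (norm z) * \<bar>\<kappa> z - \<kappa> (z + (x - y))\<bar> \<partial>lborel) + 4 / c0 * \<omega> r * \<Lambda>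
         + E * (C1 * \<omega> r * (\<integral>z. min 1 (norm z / r) * k z \<partial>lborel)
          + (\<integral>z. min (\<omega> (norm z)) (2 * A) * indicator {z. r / 2 \<le> norm z} z * k z \<partial>lborel))"
      define K where "K = (\<integral>z. k z \<partial>lborel)"
      have D: "?D \<le> \<omega> r" using has_modulus_abs[OF md, of x y] by (auto simp: r_def)
      have "jump_op k a v x - jump_op k a v y \<le> (\<omega> r - ?D) * ((1 / c0 + E + c0) * K) + X - \<omega> r * (\<integral>z. \<kappa> z \<partial>lborel)"
        using jump_op_diff_le[OF v bd w(1,3,2,4) md _ _ _ r r_def[symmetric], of \<kappa> E C1] h
        unfolding X_def K_def by simp
      also have "(\<omega> r - ?D) * ((1 / c0 + E + c0) * K) \<le> (\<omega> r - ?D) * rate"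
      proof (intro mult_left_mono)
        have "(1 / c0 + E + c0) * K \<le> (3 / c0 + 1) * K"
          using h c0 mass_nonneg unfolding K_def by (intro mult_right_mono) auto
        then show "(1 / c0 + E + c0) * K \<le> rate" by (simp add: rate_def K_def)
      qed (use D in simp)
      finally have L: "jump_op k a v x - jump_op k a v y \<le> (\<omega> r - ?D) * rate + X - \<omega> r * (\<integral>z. \<kappa> z \<partial>lborel)"
        by simp
      have super: "f x - f y + X \<le> \<omega> r * (l + (\<integral>z. \<kappa> z \<partial>lborel))"
        using h unfolding X_def by simp
      have "?T x - ?T y = ?D + \<tau> * ((f x - f y) - l * ?D + (jump_op k a v x - jump_op k a v y))"
        by (simp add: algebra_simps)
      also have "\<dots> \<le> ?D + \<tau> * ((\<omega> r - ?D) * (l + rate))"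
      proof (intro add_left_mono mult_left_mono \<tau>)
        show "(f x - f y) - l * ?D + (jump_op k a v x - jump_op k a v y) \<le> (\<omega> r - ?D) * (l + rate)"
          using L super by (simp add: algebra_simps)
      qed
      also have "\<dots> = ?D + (\<omega> r - ?D) * (\<tau> * (l + rate))" by (simp add: algebra_simps)
      also have "\<dots> \<le> ?D + (\<omega> r - ?D) * 1"
        using D \<tau> by (intro add_left_mono mult_left_mono) auto
      finally show ?thesis by (simp add: r_def)
    qed
  qed
qed

theorem bounded_solution:
  assumes l: "l \<ge> 2 * (2 / c0 * \<Lambda> + 1)"
    and fm[measurable]: "f \<in> borel_measurable borel" and f: "\<And>x. \<bar>f x\<bar> \<le> F"
    and \<omega>: "admissible_modulus \<omega>" and sup: "supersolution k a c0 \<Lambda> l f (2 * F / l) \<omega>"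
  obtains u where "u \<in> borel_measurable borel" "\<And>x. \<bar>u x\<bar> \<le> 2 * F / l"
    "\<And>x. l * u x - jump_op k a u x = f x" "has_modulus \<omega> u"
proof -
  define A where "A = 2 * F / l"
  define \<tau> where "\<tau> = 1 / (l + rate)"
  define T where "T = (\<lambda>v x. v x + \<tau> * (f x - l * v x + jump_op k a v x))"
  define P where "P = (\<lambda>v::'a \<Rightarrow> real. v \<in> borel_measurable borel \<and> (\<forall>x. \<bar>v x\<bar> \<le> A) \<and> has_modulus \<omega> v)"
  have l0: "l > 0" using l \<Lambda>_nonneg c0 by (smt (verit) divide_nonneg_nonneg mult_nonneg_nonneg)
  have F0: "F \<ge> 0" using f[of 0] by linarith
  have A0: "A \<ge> 0" using F0 l0 by (simp add: A_def)
  have fA: "\<bar>f x\<bar> \<le> l / 2 * A" for x using f l0 by (simp add: A_def)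
  have \<tau>: "\<tau> > 0" "\<tau> * (l + rate) \<le> 1" using l0 rate by (auto simp: \<tau>_def)
  have w: "0 \<le> \<omega> s" for s using \<omega> by (auto simp: admissible_modulus_def)
  have "\<tau> * l \<le> \<tau> * (l + rate)" using \<tau> rate by (intro mult_left_mono) auto
  then have "\<tau> * l \<le> 1" using \<tau>(2) by (rule order.trans)
  then have \<tau>l: "0 < \<tau> * l" "\<tau> * l \<le> 1" using \<tau> l0 by auto
  obtain u where u: "P u" "T u = u"
  proof (rule contraction_fixed_point_pointwise[where P = P and T = T and A = A and \<theta> = "1 - \<tau> * l / 2"])
    show "P (\<lambda>_. 0)" using A0 w by (auto simp: P_def has_modulus_def)
  next
    fix v assume "P v"
    then have v[measurable]: "v \<in> borel_measurable borel" and bd: "\<And>x. \<bar>v x\<bar> \<le> A" and md: "has_modulus \<omega> v"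
      by (auto simp: P_def)
    note [measurable] = jump_op_measurable[OF v]
    have "T v \<in> borel_measurable borel" unfolding T_def by measurable
    moreover have "\<bar>T v x\<bar> \<le> A" for x
    proof -
      have "\<bar>T v x\<bar> \<le> A + \<tau> * (\<bar>f x\<bar> - l / 2 * A)"
        unfolding T_def using \<tau> by (intro euler_step_bound v bd l) auto
      also have "\<dots> \<le> A + \<tau> * 0" using fA[of x] \<tau> by (intro add_left_mono mult_left_mono) auto
      finally show ?thesis by simp
    qed
    moreover have "has_modulus \<omega> (T v)"
      unfolding T_def using \<tau> by (intro euler_step_modulus[OF v bd \<omega> md sup[folded A_def] l fA]) auto
    ultimately show "P (T v)" by (simp add: P_def)
  next
    fix s :: "nat \<Rightarrow> 'a \<Rightarrow> real" and u assume s: "\<And>n. P (s n)" and lim: "\<And>x. (\<lambda>n. s n x) \<longlonglongrightarrow> u x"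
    have "u \<in> borel_measurable borel"
      using s by (intro borel_measurable_LIMSEQ_real[OF lim]) (auto simp: P_def)
    moreover have "\<bar>u x\<bar> \<le> A" for x
      by (rule LIMSEQ_le_const2[OF tendsto_rabs[OF lim]]) (use s in \<open>auto simp: P_def\<close>)
    moreover have "u x - u y \<le> \<omega> (norm (x - y))" for x y
      by (rule LIMSEQ_le_const2[OF tendsto_diff[OF lim lim]]) (use s in \<open>auto simp: P_def has_modulus_def\<close>)
    ultimately show "P u" by (simp add: P_def has_modulus_def)
  next
    fix v w D x assume "P v" "P w" and D: "\<And>x. \<bar>v x - w x\<bar> \<le> D"
    then have v[measurable]: "v \<in> borel_measurable borel" "w \<in> borel_measurable borel"
      and bd: "\<And>x. \<bar>v x\<bar> \<le> A" "\<And>x. \<bar>w x\<bar> \<le> A"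
      by (auto simp: P_def)
    have "T v x - T w x = (v x - w x) + \<tau> * (0 - l * (v x - w x) + jump_op k a (\<lambda>x. v x - w x) x)"
      unfolding T_def jump_op_diff[OF v bd] by (simp add: algebra_simps)
    also have "\<bar>\<dots>\<bar> \<le> D + \<tau> * (\<bar>0\<bar> - l / 2 * D)"
      using \<tau> by (intro euler_step_bound l D) auto
    also have "\<dots> = (1 - \<tau> * l / 2) * D" by (simp add: algebra_simps)
    finally show "\<bar>T v x - T w x\<bar> \<le> (1 - \<tau> * l / 2) * D" .
  next
    show "0 \<le> 1 - \<tau> * l / 2" "1 - \<tau> * l / 2 < 1" using \<tau>l by auto
  next
    show "P v \<Longrightarrow> \<bar>v x\<bar> \<le> A" for v x by (simp add: P_def)
  qed
  have "l * u x - jump_op k a u x = f x" for x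
  proof -
    have "T u x = u x" using u by simp
    then have "\<tau> * (f x - l * u x + jump_op k a u x) = 0" by (simp add: T_def)
    then show ?thesis using \<tau> by simp
  qed
  then show ?thesis using u that unfolding P_def A_def by blast
qed

end

section \<open>The barrier\<close>

lemma one_plus_power_le:
  fixes u :: real
  assumes "0 \<le> u" "u \<le> 1"
  shows "(1 + u) ^ n \<le> 1 + 2 ^ n * u"
proof -
  have "(1 + u) ^ n \<le> 1 + (2 ^ n - 1) * u"
  proof (induction n)
    case (Suc n)
    have "(1 + u) ^ Suc n \<le> (1 + u) * (1 + (2 ^ n - 1) * u)"
      using Suc assms by (simp add: mult_left_mono)
    also have "\<dots> = 1 + u + (2 ^ n - 1) * u + (2 ^ n - 1) * (u * u)" by (simp add: algebra_simps)
    also have "\<dots> \<le> 1 + u + (2 ^ n - 1) * u + (2 ^ n - 1) * u"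
      using mult_left_le[of u u] assms by (intro add_left_mono mult_left_mono) auto
    also have "\<dots> = 1 + (2 ^ Suc n - 1) * u" by (simp add: algebra_simps)
    finally show ?case .
  qed simp
  also have "\<dots> \<le> 1 + 2 ^ n * u" using assms by (intro add_left_mono mult_right_mono) auto
  finally show ?thesis .
qed

lemma sqrt_growth_from_doubling:
  fixes \<omega> :: "real \<Rightarrow> real"
  assumes mono: "mono \<omega>" and nn: "\<And>x. \<omega> x \<ge> 0" and dbl: "\<And>r. r > 0 \<Longrightarrow> \<omega> (2 * r) \<le> sqrt 2 * \<omega> r"
    and r: "0 < r" "r \<le> x"
  shows "\<omega> x \<le> 2 * sqrt (x / r) * \<omega> r"
proof -
  have pow: "\<omega> (2 ^ n * r) \<le> sqrt 2 ^ n * \<omega> r" for n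
  proof (induction n)
    case (Suc n)
    have "\<omega> (2 ^ Suc n * r) \<le> sqrt 2 * \<omega> (2 ^ n * r)"
      using dbl[of "2 ^ n * r"] r by (simp add: mult.assoc)
    also have "\<dots> \<le> sqrt 2 * (sqrt 2 ^ n * \<omega> r)" using Suc by (intro mult_left_mono) auto
    finally show ?case by (simp add: mult.assoc)
  qed simp
  have "0 < r / x" "r / x \<le> 1" using r by auto
  then obtain n where n: "(1/2) ^ Suc n < r / x" "r / x \<le> (1/2) ^ n" by (rule dyadic_level)
  have x: "x < 2 ^ Suc n * r" using n(1) r by (simp add: field_simps power_one_over)
  have "sqrt 2 ^ n = sqrt (2 ^ n)" by (simp add: real_sqrt_power)
  also have "\<dots> \<le> sqrt (x / r)"
    using n(2) r by (intro real_sqrt_le_mono) (simp add: field_simps power_one_over)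
  finally have s: "sqrt 2 ^ n \<le> sqrt (x / r)" .
  have "\<omega> x \<le> \<omega> (2 ^ Suc n * r)" using x by (intro monoD[OF mono]) simp
  also have "\<dots> \<le> sqrt 2 ^ Suc n * \<omega> r" by (rule pow)
  also have "\<dots> \<le> 2 * sqrt (x / r) * \<omega> r"
  proof (intro mult_right_mono nn)
    have "sqrt 2 \<le> 2" by (intro real_le_lsqrt) auto
    then have "sqrt 2 * sqrt 2 ^ n \<le> 2 * sqrt (x / r)" using s by (intro mult_mono) auto
    then show "sqrt 2 ^ Suc n \<le> 2 * sqrt (x / r)" by simp
  qed
  finally show ?thesis .
qed

context capped_levy
begin

text \<open>
  The modulus aimed at. Below the truncation level \<open>e\<close> the jump rate no longer increases, whence
  \<open>max r e\<close>.
\<close>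

definition barrier :: "real \<Rightarrow> real \<Rightarrow> real \<Rightarrow> real \<Rightarrow> real \<Rightarrow> real" where
  "barrier M l e \<beta> r = M * R r powr \<beta> / (l + 1 / R (max r e))"

context
  fixes M l e \<beta> :: real
  assumes M: "M \<ge> 0" and l: "l > 0" and e: "e > 0" and \<beta>: "0 \<le> \<beta>" "\<beta> \<le> \<alpha>"
begin

lemma R_max_pos: "R (max r e) > 0"
  using e by (intro R_pos) auto

lemma den_pos: "l + 1 / R (max r e) > 0"
  using l R_max_pos[of r] by (intro add_pos_pos) auto

lemma barrier_nonneg: "barrier M l e \<beta> r \<ge> 0"
  unfolding barrier_def using M den_pos[of r] by (intro divide_nonneg_pos mult_nonneg_nonneg) auto

text \<open>
  All regularity of the barrier, the doubling bound as well as the Lipschitz bound, comes from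
  the corresponding property of \<open>R\<close> through this lemma.
\<close>

lemma barrier_ratio:
  assumes p: "p \<ge> 1" "R s \<le> p * R r" "R (max s e) \<le> p * R (max r e)"
  shows "barrier M l e \<beta> s \<le> p powr (1 + \<alpha>) * barrier M l e \<beta> r"
proof -
  have "R s powr \<beta> \<le> (p * R r) powr \<beta>" using p \<beta> by (intro powr_mono2) auto
  also have "\<dots> = p powr \<beta> * R r powr \<beta>" by (rule powr_mult)
  finally have 1: "M * R s powr \<beta> \<le> M * (p powr \<beta> * R r powr \<beta>)" using M by (intro mult_left_mono)
  have "1 / R (max r e) \<le> p / R (max s e)"
    using p R_max_pos[of r] R_max_pos[of s] by (simp add: field_simps)
  moreover have "l \<le> p * l" using p l by simp
  ultimately have "l + 1 / R (max r e) \<le> p * (l + 1 / R (max s e))" by (simp add: algebra_simps)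
  then have 2: "1 / (l + 1 / R (max s e)) \<le> p / (l + 1 / R (max r e))"
    using den_pos[of r] den_pos[of s] by (simp add: field_simps)
  have "barrier M l e \<beta> s = M * R s powr \<beta> * (1 / (l + 1 / R (max s e)))" by (simp add: barrier_def)
  also have "\<dots> \<le> M * (p powr \<beta> * R r powr \<beta>) * (p / (l + 1 / R (max r e)))"
    using M den_pos[of s] by (intro mult_mono[OF 1 2] mult_nonneg_nonneg) auto
  also have "\<dots> = (p powr 1 * p powr \<beta>) * barrier M l e \<beta> r" using p by (simp add: barrier_def)
  also have "p powr 1 * p powr \<beta> = p powr (1 + \<beta>)" by (simp only: powr_add)
  also have "\<dots> * barrier M l e \<beta> r \<le> p powr (1 + \<alpha>) * barrier M l e \<beta> r"
    using p \<beta> by (intro mult_right_mono barrier_nonneg powr_mono) auto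
  finally show ?thesis .
qed

lemma barrier_mono: "mono (barrier M l e \<beta>)"
proof (intro monoI)
  fix r s :: real assume rs: "r \<le> s"
  have "R r powr \<beta> \<le> R s powr \<beta>" using rs \<beta> by (intro powr_mono2 R_mono) auto
  then have 1: "M * R r powr \<beta> \<le> M * R s powr \<beta>" using M by (intro mult_left_mono)
  have "R (max r e) \<le> R (max s e)" using rs by (intro R_mono) auto
  then have "1 / R (max s e) \<le> 1 / R (max r e)" using R_max_pos[of r] by (intro divide_left_mono) auto
  then show "barrier M l e \<beta> r \<le> barrier M l e \<beta> s"
    unfolding barrier_def using 1 M den_pos[of s] by (intro frac_le) auto
qed

lemma barrier_measurable: "barrier M l e \<beta> \<in> borel_measurable borel"
  by (intro borel_measurable_mono barrier_mono)

lemma barrier_le1: "barrier M l e \<beta> r \<le> M * R r powr \<beta> / l"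
  unfolding barrier_def using M l R_max_pos[of r] by (intro frac_le) auto

lemma barrier_le2: "barrier M l e \<beta> r \<le> M * R r powr \<beta> * R (max r e)"
proof -
  have "barrier M l e \<beta> r \<le> M * R r powr \<beta> / (1 / R (max r e))"
    unfolding barrier_def using M l R_max_pos[of r] by (intro frac_le) auto
  then show ?thesis by simp
qed

lemma barrier_bounded: "barrier M l e \<beta> r \<le> M / l"
proof -
  have "R r powr \<beta> \<le> 1 powr \<beta>" using \<beta> by (intro powr_mono2 R_le_1) auto
  then have "M * R r powr \<beta> / l \<le> M * 1 / l" using M l by (intro divide_right_mono mult_left_mono) auto
  then show ?thesis using barrier_le1[of r] by simp
qed

lemma barrier_admissible: "admissible_modulus (barrier M l e \<beta>)"
  unfolding admissible_modulus_def using barrier_measurable barrier_mono barrier_nonneg barrier_bounded by blast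

lemma barrier_growth:
  assumes "0 < r" "r \<le> x"
  shows "barrier M l e \<beta> x \<le> 2 * sqrt (x / r) * barrier M l e \<beta> r"
proof (rule sqrt_growth_from_doubling[OF barrier_mono barrier_nonneg _ assms])
  fix r :: real assume r: "r > 0"
  have "barrier M l e \<beta> (2 * r) \<le> q powr (1 + \<alpha>) * barrier M l e \<beta> r"
  proof (rule barrier_ratio)
    show "R (max (2 * r) e) \<le> q * R (max r e)"
      using R_mono[of "max (2 * r) e" "2 * max r e"] R_double[of "max r e"] r e by (auto simp: max_def split: if_splits)
  qed (use q R_double in auto)
  also have "\<dots> \<le> sqrt 2 * barrier M l e \<beta> r" by (intro mult_right_mono q_power barrier_nonneg)
  finally show "barrier M l e \<beta> (2 * r) \<le> sqrt 2 * barrier M l e \<beta> r" .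
qed

lemma barrier_lipschitz:
  assumes r: "r > 0" and s: "0 \<le> s" "s \<le> r / 2"
  shows "barrier M l e \<beta> (r + s) \<le> barrier M l e \<beta> r * (1 + 2 ^ moment_index * (s / r))"
proof -
  define p where "p = 1 + s / r"
  have u: "0 \<le> s / r" "s / r \<le> 1" using r s by (auto simp: field_simps)
  have p: "p \<ge> 1" using u by (simp add: p_def)
  have rs: "(r + s) / r = p" using r by (simp add: p_def field_simps)
  have "barrier M l e \<beta> (r + s) \<le> (p\<^sup>2) powr (1 + \<alpha>) * barrier M l e \<beta> r"
  proof (rule barrier_ratio)
    show "1 \<le> p\<^sup>2" using p by simp
    show "R (r + s) \<le> p\<^sup>2 * R r" using R_scale[of r "r + s"] r s rs by simp
    have "max (r + s) e / max r e \<le> p"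
    proof -
      have "max (r + s) e \<le> p * max r e"
      proof (rule max.boundedI)
        have "r + s = p * r" using r rs by (simp add: field_simps)
        also have "\<dots> \<le> p * max r e" using p by (intro mult_left_mono) auto
        finally show "r + s \<le> p * max r e" .
        show "e \<le> p * max r e" using p e by (intro order.trans[OF _ mult_mono[of 1 p e "max r e"]]) auto
      qed
      then show ?thesis using e by (simp add: field_simps less_max_iff_disj)
    qed
    then have "(max (r + s) e / max r e)\<^sup>2 \<le> p\<^sup>2" using r s e by (intro power_mono) auto
    then have "(max (r + s) e / max r e)\<^sup>2 * R (max r e) \<le> p\<^sup>2 * R (max r e)"
      by (intro mult_right_mono) auto
    moreover have "R (max (r + s) e) \<le> (max (r + s) e / max r e)\<^sup>2 * R (max r e)"
      by (rule R_scale) (use r e s in \<open>auto simp: max_def\<close>)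
    ultimately show "R (max (r + s) e) \<le> p\<^sup>2 * R (max r e)" by linarith
  qed
  also have "(p\<^sup>2) powr (1 + \<alpha>) = p powr (2 * (1 + \<alpha>))"
  proof -
    have "p\<^sup>2 = p powr 2" using p by (simp add: powr_numeral)
    then show ?thesis by (simp only: powr_powr)
  qed
  also have "p powr (2 * (1 + \<alpha>)) \<le> p powr (real moment_index)"
    unfolding moment_index_def by (rule powr_mono[OF real_nat_ceiling_ge p])
  also have "\<dots> = p ^ moment_index" using p by (intro powr_realpow) auto
  also have "\<dots> \<le> 1 + 2 ^ moment_index * (s / r)"
    unfolding p_def by (rule one_plus_power_le[OF u])
  finally show ?thesis using barrier_nonneg[of r] by (simp add: mult_right_mono mult.commute)
qed

end

text \<open>
  What the Markov inequality for the function \<open>min 1 (|z| / r1)\<close> gives for the mass of the jumps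
  longer than \<open>\<delta>\<close>, uniformly in the truncation.
\<close>

definition far_bound :: "'a::euclidean_space itself \<Rightarrow> real \<Rightarrow> real" where
  "far_bound _ \<delta> = max 1 (r1 / \<delta>) * (heat_moment TYPE('a) 1 * (12 * H r1))"

lemma far_bound_nonneg: "far_bound TYPE('a::euclidean_space) \<delta> \<ge> 0"
  unfolding far_bound_def using H_pos[OF r1(1)] by (intro mult_nonneg_nonneg) auto

lemma nn_integral_far:
  assumes \<delta>: "\<delta> > 0"
  shows "(\<integral>\<^sup>+ (z::'a::euclidean_space). ennreal (indicator {z. \<delta> \<le> norm z} z * jump_part \<nu> s z) \<partial>lborel)
     \<le> ennreal (far_bound TYPE('a) \<delta>)"
proof -
  have "(\<integral>\<^sup>+ (z::'a). ennreal (indicator {z. \<delta> \<le> norm z} z * jump_part \<nu> s z) \<partial>lborel) \<le>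
    (\<integral>\<^sup>+ (z::'a). ennreal (max 1 (r1 / \<delta>)) * (ennreal (min 1 (norm z / r1)) * ennreal (jump_part \<nu> s z)) \<partial>lborel)"
  proof (intro nn_integral_mono)
    fix z :: 'a
    have "indicator {z. \<delta> \<le> norm z} z \<le> max 1 (r1 / \<delta>) * min 1 (norm z / r1)"
    proof (cases "\<delta> \<le> norm z")
      case True
      have "1 \<le> max 1 (r1 / \<delta>) * (norm z / r1)"
      proof -
        have "1 = r1 / \<delta> * (\<delta> / r1)" using \<delta> r1 by simp
        also have "\<dots> \<le> max 1 (r1 / \<delta>) * (norm z / r1)"
          using True \<delta> r1 by (intro mult_mono divide_right_mono) auto
        finally show ?thesis .
      qed
      then have "1 \<le> max 1 (r1 / \<delta>) * min 1 (norm z / r1)"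
        by (cases "norm z / r1 \<le> 1") simp_all
      then show ?thesis using True by simp
    qed (use r1 in auto)
    then have "indicator {z. \<delta> \<le> norm z} z * jump_part \<nu> s z \<le> max 1 (r1 / \<delta>) * (min 1 (norm z / r1) * jump_part \<nu> s z)"
      unfolding mult.assoc[symmetric] by (intro mult_right_mono) auto
    then show "ennreal (indicator {z. \<delta> \<le> norm z} z * jump_part \<nu> s z) \<le> ennreal (max 1 (r1 / \<delta>)) * (ennreal (min 1 (norm z / r1)) * ennreal (jump_part \<nu> s z))"
      using r1 by (simp add: ennreal_mult' [symmetric] ennreal_leI)
  qed
  also have "\<dots> = ennreal (max 1 (r1 / \<delta>)) * (\<integral>\<^sup>+ (z::'a). ennreal (min 1 (norm z / r1)) * ennreal (jump_part \<nu> s z) \<partial>lborel)"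
    by (intro nn_integral_cmult) auto
  also have "\<dots> \<le> ennreal (max 1 (r1 / \<delta>)) * ennreal (heat_moment TYPE('a) 1 * (12 * H r1))"
    using r1 by (intro mult_left_mono nn_integral_min_jump_part) auto
  also have "\<dots> = ennreal (far_bound TYPE('a) \<delta>)"
    unfolding far_bound_def by (intro ennreal_mult' [symmetric]) auto
  finally show ?thesis .
qed

lemma integral_far:
  assumes \<delta>: "\<delta> > 0"
  shows "(\<integral>(z::'a::euclidean_space). indicator {z. \<delta> \<le> norm z} z * jump_part \<nu> s z \<partial>lborel) \<le> far_bound TYPE('a) \<delta>"
  by (intro integral_real_bounded far_bound_nonneg nn_integral_far \<delta>)

lemma integral_min_jump_part:
  assumes r: "0 < r" "r \<le> r1" and e: "0 < e" "e \<le> r1"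
  shows "(\<integral>(z::'a::euclidean_space). min 1 (norm z / r) * jump_part \<nu> (e\<^sup>2) z \<partial>lborel)
     \<le> (12 * heat_moment TYPE('a) 1 + 2 * heat_moment TYPE('a) 0) * H (max r e)"
proof -
  have Hp: "H (max r e) > 0" using r by (intro H_pos) auto
  have nn: "0 \<le> heat_moment TYPE('a) 0" "0 \<le> heat_moment TYPE('a) 1" by auto
  show ?thesis
  proof (cases "e \<le> r")
    case True
    have "(\<integral>(z::'a). min 1 (norm z / r) * jump_part \<nu> (e\<^sup>2) z \<partial>lborel) \<le> heat_moment TYPE('a) 1 * (12 * H r)"
    proof (intro integral_real_bounded)
      have "(\<integral>\<^sup>+ (z::'a). ennreal (min 1 (norm z / r) * jump_part \<nu> (e\<^sup>2) z) \<partial>lborel) =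
        (\<integral>\<^sup>+ (z::'a). ennreal (min 1 (norm z / r)) * ennreal (jump_part \<nu> (e\<^sup>2) z) \<partial>lborel)"
        using r by (intro nn_integral_cong ennreal_mult') auto
      also have "\<dots> \<le> ennreal (heat_moment TYPE('a) 1 * (12 * H r))"
        by (rule nn_integral_min_jump_part[OF r])
      finally show "(\<integral>\<^sup>+ (z::'a). ennreal (min 1 (norm z / r) * jump_part \<nu> (e\<^sup>2) z) \<partial>lborel) \<le> ennreal (heat_moment TYPE('a) 1 * (12 * H r))" .
    qed (use H_pos[OF r(1)] nn in auto)
    moreover have "0 \<le> 2 * heat_moment TYPE('a) 0 * H r" using nn H_pos[OF r(1)] by simp
    ultimately show ?thesis using True by (simp add: algebra_simps max_def)
  next
    case False
    have "(\<integral>(z::'a). min 1 (norm z / r) * jump_part \<nu> (e\<^sup>2) z \<partial>lborel) \<le> (\<integral>(z::'a). jump_part \<nu> (e\<^sup>2) z \<partial>lborel)"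
    proof (intro integral_mono_AE' jump_part_integrable AE_I2)
      fix z :: 'a
      have "min 1 (norm z / r) * jump_part \<nu> (e\<^sup>2) z \<le> 1 * jump_part \<nu> (e\<^sup>2) z"
        by (intro mult_right_mono) auto
      then show "min 1 (norm z / r) * jump_part \<nu> (e\<^sup>2) z \<le> jump_part \<nu> (e\<^sup>2) z" by simp
    qed (use e r in auto)
    also have "\<dots> = heat_moment TYPE('a) 0 * measure \<nu> {e\<^sup>2<..}"
      using e by (intro jump_part_mass) auto
    also have "\<dots> \<le> heat_moment TYPE('a) 0 * (2 * H e)"
      using e by (intro mult_left_mono measure_tail_H) auto
    also have "\<dots> \<le> (12 * heat_moment TYPE('a) 1 + 2 * heat_moment TYPE('a) 0) * H e"
      using nn H_pos[OF e(1)] by (simp add: algebra_simps)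
    finally show ?thesis using False by (simp add: max_def)
  qed
qed

lemma R_powr_small:
  assumes "\<epsilon> > 0"
  obtains r0 where "r0 > 0" "\<And>r. r \<le> r0 \<Longrightarrow> R r powr \<alpha> \<le> \<epsilon>"
proof -
  obtain r0 where r0: "r0 > 0" "\<forall>r\<le>r0. R r \<le> \<epsilon> powr (1 / \<alpha>)"
    using R_tendsto_0[of "\<epsilon> powr (1 / \<alpha>)"] assms by auto
  have "R r powr \<alpha> \<le> \<epsilon>" if "r \<le> r0" for r
  proof -
    have "R r powr \<alpha> \<le> (\<epsilon> powr (1 / \<alpha>)) powr \<alpha>" using r0 that \<alpha> by (intro powr_mono2) auto
    also have "\<dots> = \<epsilon>" using assms \<alpha> by (simp add: powr_powr)
    finally show ?thesis .
  qed
  then show ?thesis using r0 that by blast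
qed

text \<open>
  This concerns the jumps by more than \<open>r / 2\<close> that only one of the points makes. Up to length
  \<open>\<delta>\<close> the barrier is used; since \<open>R r \<le> 4 R |z|\<close> for them, \<open>\<alpha> - \<beta>\<close> powers of \<open>R r\<close> can be traded
  for powers of \<open>R |z|\<close>, which leads to the integrable weight uniformly in \<open>\<beta> \<in> [0, \<alpha>]\<close>. The
  factor \<open>\<epsilon>\<close> compensates for \<open>M\<close>, which is large; beyond \<open>\<delta>\<close> the supremum bound is used, in
  which \<open>M\<close> does not occur.
\<close>

lemma remainder_bound:
  fixes r \<delta> M l e \<beta> A \<epsilon> :: real
  assumes M: "M \<ge> 0" and l: "l > 0" and e: "e > 0" and \<beta>: "0 \<le> \<beta>" "\<beta> \<le> \<alpha>" and r: "r > 0" and A: "A \<ge> 0"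
    and \<delta>: "\<delta> > 0" and \<epsilon>: "\<epsilon> \<ge> 0" "(\<integral>\<^sup>+ (z::'a::euclidean_space). weight z * indicator (ball 0 \<delta>) z \<partial>lborel) \<le> ennreal \<epsilon>"
  shows "R r powr \<alpha> * (\<integral>(z::'a). min (barrier M l e \<beta> (norm z)) (2 * A) * indicator {z. r / 2 \<le> norm z} z * jump_part \<nu> (e\<^sup>2) z \<partial>lborel)
    \<le> R r powr \<beta> * (4 powr \<alpha> * M * \<epsilon> + 2 * A * far_bound TYPE('a) \<delta>)"
proof -
  note [measurable] = barrier_measurable[OF M l e \<beta>]
  let ?J = "jump_part \<nu> (e\<^sup>2) :: 'a \<Rightarrow> real"
  let ?g = "\<lambda>z::'a. min (barrier M l e \<beta> (norm z)) (2 * A) * indicator {z. r / 2 \<le> norm z} z * ?J z"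
  have pt: "R r powr \<alpha> * ?g z \<le> R r powr \<beta> * (4 powr \<alpha> * M) * (R (max (norm z) e) powr (1 + \<alpha>) * ?J z * indicator (ball 0 \<delta>) z)
     + R r powr \<beta> * (2 * A) * (indicator {z. \<delta> \<le> norm z} z * ?J z)" for z
  proof -
    define w where "w = norm z"
    have J0: "?J z \<ge> 0" by simp
    have \<alpha>\<beta>: "R r powr \<alpha> \<le> R r powr \<beta>"
      using R_le_1[of r] \<beta> by (intro powr_mono') auto
    show ?thesis
    proof (cases "r / 2 \<le> norm z")
      case False
      have "0 \<le> R r powr \<beta> * (4 powr \<alpha> * M) * (R (max (norm z) e) powr (1 + \<alpha>) * ?J z * indicator (ball 0 \<delta>) z)"
        using M by (intro mult_nonneg_nonneg) auto
      moreover have "0 \<le> R r powr \<beta> * (2 * A) * (indicator {z. \<delta> \<le> norm z} z * ?J z)"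
        using A by (intro mult_nonneg_nonneg) auto
      ultimately show ?thesis using False by simp
    next
      case rz: True
      show ?thesis
      proof (cases "norm z < \<delta>")
        case True
        have Rw: "R w > 0" using rz r unfolding w_def by (intro R_pos) linarith
        have "R r \<le> 4 * R (r / 2)" using R_scale[of "r / 2" r] r by simp
        also have "\<dots> \<le> 4 * R w" using rz by (intro mult_left_mono R_mono) (auto simp: w_def)
        finally have R4: "R r \<le> 4 * R w" .
        have "R r powr \<alpha> = R r powr \<beta> * R r powr (\<alpha> - \<beta>)" by (simp add: powr_add [symmetric])
        also have "R r powr (\<alpha> - \<beta>) \<le> (4 * R w) powr (\<alpha> - \<beta>)"
          using R4 \<beta> by (intro powr_mono2) auto
        also have "(4 * R w) powr (\<alpha> - \<beta>) = 4 powr (\<alpha> - \<beta>) * R w powr (\<alpha> - \<beta>)" by (rule powr_mult)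
        also have "4 powr (\<alpha> - \<beta>) * R w powr (\<alpha> - \<beta>) \<le> 4 powr \<alpha> * R w powr (\<alpha> - \<beta>)"
          using \<beta> by (intro mult_right_mono powr_mono) auto
        finally have 1: "R r powr \<alpha> \<le> R r powr \<beta> * (4 powr \<alpha> * R w powr (\<alpha> - \<beta>))"
          by (simp add: mult_left_mono)
        have "min (barrier M l e \<beta> w) (2 * A) \<le> M * R w powr \<beta> * R (max w e)"
          using barrier_le2[OF M l e \<beta>, of w] by linarith
        then have "R r powr \<alpha> * min (barrier M l e \<beta> w) (2 * A) \<le>
           (R r powr \<beta> * (4 powr \<alpha> * R w powr (\<alpha> - \<beta>))) * (M * R w powr \<beta> * R (max w e))"
          using 1 M A barrier_nonneg[OF M l e \<beta>, of w] by (intro mult_mono) auto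
        also have "\<dots> = R r powr \<beta> * (4 powr \<alpha> * M) * ((R w powr (\<alpha> - \<beta>) * R w powr \<beta>) * R (max w e))"
          by (simp only: mult_ac)
        also have "R w powr (\<alpha> - \<beta>) * R w powr \<beta> = R w powr \<alpha>" by (simp add: powr_add [symmetric])
        also have "R r powr \<beta> * (4 powr \<alpha> * M) * (R w powr \<alpha> * R (max w e)) \<le>
            R r powr \<beta> * (4 powr \<alpha> * M) * (R (max w e) powr \<alpha> * R (max w e))"
          using M \<alpha> by (intro mult_left_mono mult_right_mono powr_mono2 R_mono) auto
        also have "R (max w e) powr \<alpha> * R (max w e) = R (max w e) powr (1 + \<alpha>)"
          using R_pos[of "max w e"] e by (simp add: powr_add mult.commute)
        finally have "R r powr \<alpha> * min (barrier M l e \<beta> w) (2 * A) * ?J z \<le> R r powr \<beta> * (4 powr \<alpha> * M) * R (max w e) powr (1 + \<alpha>) * ?J z"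
          by (intro mult_right_mono J0)
        then show ?thesis using True rz by (simp add: w_def mult_ac)
      next
        case False
        have "R r powr \<alpha> * min (barrier M l e \<beta> w) (2 * A) \<le> R r powr \<beta> * (2 * A)"
          using \<alpha>\<beta> A barrier_nonneg[OF M l e \<beta>, of w] by (intro mult_mono) auto
        then have "R r powr \<alpha> * min (barrier M l e \<beta> w) (2 * A) * ?J z \<le> R r powr \<beta> * (2 * A) * ?J z"
          by (intro mult_right_mono J0)
        then show ?thesis using False rz by (simp add: w_def mult_ac)
      qed
    qed
  qed
  have "R r powr \<alpha> * (\<integral>z. ?g z \<partial>lborel) = (\<integral>z. R r powr \<alpha> * ?g z \<partial>lborel)" by simp
  also have "\<dots> \<le> R r powr \<beta> * (4 powr \<alpha> * M * \<epsilon> + 2 * A * far_bound TYPE('a) \<delta>)"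
  proof (rule integral_real_bounded)
    have "(\<integral>\<^sup>+ z. ennreal (R r powr \<alpha> * ?g z) \<partial>lborel) \<le>
      (\<integral>\<^sup>+ z. ennreal (R r powr \<beta> * (4 powr \<alpha> * M)) * (weight z * indicator (ball 0 \<delta>) z)
         + ennreal (R r powr \<beta> * (2 * A)) * ennreal (indicator {z. \<delta> \<le> norm z} z * ?J z) \<partial>lborel)"
    proof (intro nn_integral_mono)
      fix z :: 'a
      have wb: "ennreal (R (max (norm z) e) powr (1 + \<alpha>) * ?J z * indicator (ball 0 \<delta>) z) \<le> weight z * indicator (ball 0 \<delta>) z"
        using weight_bound[of e z] e by (auto simp: indicator_def ennreal_mult')
      have "ennreal (R r powr \<alpha> * ?g z) \<le> ennreal (R r powr \<beta> * (4 powr \<alpha> * M) * (R (max (norm z) e) powr (1 + \<alpha>) * ?J z * indicator (ball 0 \<delta>) z)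
        + R r powr \<beta> * (2 * A) * (indicator {z. \<delta> \<le> norm z} z * ?J z))"
        by (intro ennreal_leI pt)
      also have "\<dots> = ennreal (R r powr \<beta> * (4 powr \<alpha> * M)) * ennreal (R (max (norm z) e) powr (1 + \<alpha>) * ?J z * indicator (ball 0 \<delta>) z)
         + ennreal (R r powr \<beta> * (2 * A)) * ennreal (indicator {z. \<delta> \<le> norm z} z * ?J z)"
        using M A by (subst ennreal_plus) (simp_all add: ennreal_mult' [symmetric] del: ennreal_plus)
      also have "\<dots> \<le> ennreal (R r powr \<beta> * (4 powr \<alpha> * M)) * (weight z * indicator (ball 0 \<delta>) z)
         + ennreal (R r powr \<beta> * (2 * A)) * ennreal (indicator {z. \<delta> \<le> norm z} z * ?J z)"
        by (intro add_right_mono mult_left_mono wb) auto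
      finally show "ennreal (R r powr \<alpha> * ?g z) \<le> \<dots>" .
    qed
    also have "\<dots> = ennreal (R r powr \<beta> * (4 powr \<alpha> * M)) * (\<integral>\<^sup>+ (z::'a). weight z * indicator (ball 0 \<delta>) z \<partial>lborel)
         + ennreal (R r powr \<beta> * (2 * A)) * (\<integral>\<^sup>+ (z::'a). ennreal (indicator {z. \<delta> \<le> norm z} z * ?J z) \<partial>lborel)"
    proof -
      have [measurable]: "(\<lambda>z::'a. weight z * indicator (ball 0 \<delta>) z) \<in> borel_measurable borel"
        by (intro borel_measurable_times_ennreal borel_measurable_indicator weight_measurable) auto
      show ?thesis by (subst nn_integral_add, simp, simp, subst (1 2) nn_integral_cmult) simp_all
    qed
    also have "\<dots> \<le> ennreal (R r powr \<beta> * (4 powr \<alpha> * M)) * ennreal \<epsilon>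
         + ennreal (R r powr \<beta> * (2 * A)) * ennreal (far_bound TYPE('a) \<delta>)"
      by (intro add_mono mult_left_mono \<epsilon> nn_integral_far \<delta>) auto
    also have "\<dots> = ennreal (R r powr \<beta> * (4 powr \<alpha> * M) * \<epsilon> + R r powr \<beta> * (2 * A) * far_bound TYPE('a) \<delta>)"
      using M A \<epsilon> far_bound_nonneg[where 'a='a, of \<delta>] by (subst ennreal_plus) (simp_all add: ennreal_mult')
    also have "R r powr \<beta> * (4 powr \<alpha> * M) * \<epsilon> + R r powr \<beta> * (2 * A) * far_bound TYPE('a) \<delta> =
       R r powr \<beta> * (4 powr \<alpha> * M * \<epsilon> + 2 * A * far_bound TYPE('a) \<delta>)"
      by (simp add: algebra_simps)
    finally show "(\<integral>\<^sup>+ z. ennreal (R r powr \<alpha> * ?g z) \<partial>lborel) \<le> ennreal (R r powr \<beta> * (4 powr \<alpha> * M * \<epsilon> + 2 * A * far_bound TYPE('a) \<delta>))" .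
    show "0 \<le> R r powr \<beta> * (4 powr \<alpha> * M * \<epsilon> + 2 * A * far_bound TYPE('a) \<delta>)"
      using M A \<epsilon> far_bound_nonneg[where 'a='a, of \<delta>] by (intro mult_nonneg_nonneg add_nonneg_nonneg) auto
  qed
  finally show ?thesis .
qed

text \<open>
  A single pair \<open>M0\<close>, \<open>r0\<close> has to serve all truncation levels, since \<open>e\<close> will tend to \<open>0\<close>, and
  all exponents, resolvent parameters and data, on which the constant of the estimate may not
  depend.
\<close>

definition uniform_barrier :: "('a::euclidean_space \<Rightarrow> 'a \<Rightarrow> real) \<Rightarrow> real \<Rightarrow> real \<Rightarrow> real \<Rightarrow> real \<Rightarrow> bool" where
  "uniform_barrier a c0 \<rho>0 M0 r0 \<longleftrightarrow> (\<forall>e \<beta> l f F. 0 < e \<longrightarrow> e \<le> r0 \<longrightarrow> 0 \<le> \<beta> \<longrightarrow> \<beta> \<le> \<alpha> \<longrightarrow> l \<ge> 2 \<longrightarrow> F \<ge> 0 \<longrightarrow>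
     (\<forall>x y. x \<noteq> y \<longrightarrow> f x - f y \<le> F * rho \<nu> (norm (x - y)) powr \<beta>) \<longrightarrow>
     supersolution (jump_part \<nu> (e\<^sup>2)) a c0 (far_bound TYPE('a) \<rho>0) l f (2 * F / l) (barrier (F * M0) l e \<beta>))"

text \<open>
  The constants are chosen in this order: \<open>k\<close> makes the coupling succeed with probability at
  least one half; \<open>\<delta>\<close> makes the near part of the remainder small compared with the merging rate;
  below \<open>r0\<close> the rate \<open>H\<close> is large and \<open>R powr \<alpha>\<close> is small enough for the other errors; finally
  \<open>M0\<close> is large enough for the right-hand side, for the far part of the remainder and for the
  distances beyond \<open>r0\<close>.
\<close>

lemma uniform_barrier_exists:
  fixes c0 \<rho>0 :: real
  assumes c0: "0 < c0" "c0 < 1" and \<rho>0: "\<rho>0 > 0"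
  obtains M0 r0 where "M0 > 0" "0 < r0" "r0 \<le> r1"
    "\<And>a :: 'a::euclidean_space \<Rightarrow> 'a \<Rightarrow> real.
       (\<And>x y z. x \<noteq> y \<Longrightarrow> \<bar>a x z - a y z\<bar> \<le> rho \<nu> (norm (x - y)) powr \<alpha> / c0) \<Longrightarrow>
       uniform_barrier a c0 \<rho>0 M0 r0"
proof -
  define G where "G = heat_moment TYPE('a) 0"
  define K1 where "K1 = 12 * heat_moment TYPE('a) 1 + 2 * G"
  define \<Lambda> where "\<Lambda> = far_bound TYPE('a) \<rho>0"
  define C1 :: real where "C1 = 2 ^ moment_index"
  have G: "G > 0" by (simp add: G_def heat_mass_pos)
  have K1: "K1 > 0" using G unfolding K1_def by (intro add_nonneg_pos) auto
  have \<Lambda>: "\<Lambda> \<ge> 0" by (simp add: \<Lambda>_def far_bound_nonneg)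
  have C1: "C1 > 0" by (simp add: C1_def)
  obtain k where k: "k \<ge> 1"
    "\<And>\<omega> r s (h::'a). \<omega> \<in> borel_measurable borel \<Longrightarrow> mono \<omega> \<Longrightarrow> (\<And>x. \<omega> x \<ge> 0) \<Longrightarrow>
       (\<And>x. x \<ge> r \<Longrightarrow> \<omega> x \<le> 2 * sqrt (x / r) * \<omega> r) \<Longrightarrow> r > 0 \<Longrightarrow> norm h = r \<Longrightarrow> s \<ge> k * r\<^sup>2 \<Longrightarrow>
       (\<integral>\<^sup>+ z. ennreal (\<omega> (norm z) * \<bar>jump_part \<nu> s z - jump_part \<nu> s (z + h)\<bar>) \<partial>lborel)
         \<le> ennreal (G / 2 * \<omega> r * measure \<nu> {s<..})"
    unfolding G_def using jump_part_coupling[where 'a='a] by blast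
  obtain r2 where r2: "r2 > 0" "\<And>r. 0 < r \<Longrightarrow> r \<le> r2 \<Longrightarrow> H r \<le> 2 * measure \<nu> {k * r\<^sup>2<..}"
    using tail_lower_H[of k] k(1) by auto
  \<comment> \<open>the net merging rate at distance \<open>r\<close> is at least \<open>c1 * H (max r e)\<close>: one factor \<open>1 / 2\<close> is
    lost in the coupling, another one in \<open>tail_lower_H\<close>\<close>
  define c1 where "c1 = c0 * G / 4"
  define c2 where "c2 = min 1 (c1 / 2)"
  have c1: "c1 > 0" using c0 G by (simp add: c1_def)
  have c2: "c2 > 0" "c2 \<le> 1" "c2 \<le> c1 / 2" using c1 by (auto simp: c2_def)
  \<comment> \<open>chosen so that the near part of the remainder uses up half of \<open>c2 * M\<close>\<close>
  define \<epsilon> where "\<epsilon> = c0 * c2 / (2 * 4 powr \<alpha>)"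
  have \<epsilon>: "\<epsilon> > 0" using c0 c2 by (simp add: \<epsilon>_def)
  obtain \<delta> where \<delta>: "\<delta> > 0" "(\<integral>\<^sup>+ (z::'a). weight z * indicator (ball 0 \<delta>) z \<partial>lborel) \<le> ennreal \<epsilon>"
    using small_weight_near_0[OF \<epsilon>] by blast
  define \<Phi> where "\<Phi> = far_bound TYPE('a) \<delta>"
  have \<Phi>: "\<Phi> \<ge> 0" by (simp add: \<Phi>_def far_bound_nonneg)
  obtain r3 where r3: "r3 > 0" "\<And>r. 0 < r \<Longrightarrow> r \<le> r3 \<Longrightarrow> H r \<ge> 16 * \<Lambda> / (c0 * c1)"
    using H_at_0 by blast
  obtain r4 where r4: "r4 > 0" "\<And>r. r \<le> r4 \<Longrightarrow> R r powr \<alpha> \<le> c1 * c0 / (4 * C1 * K1)"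
    using R_powr_small[of "c1 * c0 / (4 * C1 * K1)"] c1 c0 C1 K1 by auto
  define r0 where "r0 = min (min r1 r2) (min r3 r4)"
  have r0: "0 < r0" "r0 \<le> r1" "r0 \<le> r2" "r0 \<le> r3" "r0 \<le> r4"
    using r1 r2 r3 r4 by (auto simp: r0_def)
  \<comment> \<open>the first summand pays for \<open>f\<close> and the far part of the remainder, the second one lifts the
    barrier above twice the supremum bound at distance \<open>r0\<close>\<close>
  define M0 where "M0 = 2 * (1 + 2 * \<Phi> / c0) / c2 + 4 * (1 + H r0) / R r0 powr \<alpha>"
  have Rr0: "R r0 powr \<alpha> > 0" using R_pos[of r0] r0 by simp
  have M0a: "2 * (1 + 2 * \<Phi> / c0) / c2 \<le> M0" and M0b: "4 * (1 + H r0) / R r0 powr \<alpha> \<le> M0"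
    using c2 c0 \<Phi> Rr0 H_pos[OF r0(1)] by (auto simp: M0_def intro!: divide_nonneg_pos mult_nonneg_nonneg add_nonneg_nonneg)
  have "0 < 2 * (1 + 2 * \<Phi> / c0) / c2" using c2 c0 \<Phi> by (intro divide_pos_pos mult_pos_pos add_pos_nonneg) auto
  then have M0: "M0 > 0" using M0a by linarith
  show ?thesis
  proof (rule that[OF M0 r0(1,2)])
    fix a :: "'a \<Rightarrow> 'a \<Rightarrow> real"
    assume a: "\<And>x y z. x \<noteq> y \<Longrightarrow> \<bar>a x z - a y z\<bar> \<le> rho \<nu> (norm (x - y)) powr \<alpha> / c0"
    show "uniform_barrier a c0 \<rho>0 M0 r0"
      unfolding uniform_barrier_def
    proof (intro allI impI)
      fix e \<beta> l F :: real and f :: "'a \<Rightarrow> real"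
      assume e: "0 < e" "e \<le> r0" and \<beta>: "0 \<le> \<beta>" "\<beta> \<le> \<alpha>" and l: "l \<ge> 2" and F: "F \<ge> 0"
        and "\<forall>x y. x \<noteq> y \<longrightarrow> f x - f y \<le> F * rho \<nu> (norm (x - y)) powr \<beta>"
      then have f: "\<And>x y. x \<noteq> y \<Longrightarrow> f x - f y \<le> F * rho \<nu> (norm (x - y)) powr \<beta>" by blast
      define M where "M = F * M0"
      define A where "A = 2 * F / l"
      have M: "M \<ge> 0" using F M0 by (simp add: M_def)
      have l0: "l > 0" using l by simp
      have A: "0 \<le> A" "A \<le> F" using F l by (auto simp: A_def field_simps mult_left_mono)
      define \<omega> where "\<omega> = barrier M l e \<beta>"
      note par = M l0 e(1) \<beta>
      have \<omega>0: "\<omega> r \<ge> 0" for r unfolding \<omega>_def by (rule barrier_nonneg[OF par])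
      show "supersolution (jump_part \<nu> (e\<^sup>2)) a c0 (far_bound TYPE('a) \<rho>0) l f (2 * F / l) (barrier (F * M0) l e \<beta>)"
        unfolding supersolution_def A_def[symmetric] M_def[symmetric] \<Lambda>_def[symmetric] \<omega>_def[symmetric]
      proof (intro allI impI)
        fix x y :: 'a assume xy: "x \<noteq> y"
        define r where "r = norm (x - y)"
        have r: "r > 0" using xy by (simp add: r_def)
        show "2 * A \<le> \<omega> (norm (x - y)) \<or>
          (\<exists>\<kappa> E C1. coupling_estimate (jump_part \<nu> (e\<^sup>2)) a c0 \<Lambda> l f A \<omega> x y \<kappa> E C1)"
        proof (cases "r0 \<le> r")
          case True
          have Hr0: "H r0 > 0" by (rule H_pos[OF r0(1)])
          have "2 * A = 4 * F / l" by (simp add: A_def)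
          also have "\<dots> \<le> F * (4 * (1 + H r0)) / (l + H r0)"
          proof -
            have "l + H r0 \<le> l * (1 + H r0)" using l Hr0 by (simp add: algebra_simps)
            then have "4 * F * (l + H r0) \<le> 4 * F * (l * (1 + H r0))" using F by (intro mult_left_mono) auto
            then show ?thesis using l0 Hr0 by (simp add: field_simps)
          qed
          also have "\<dots> \<le> M * R r0 powr \<alpha> / (l + H r0)"
          proof (intro divide_right_mono)
            have "4 * (1 + H r0) \<le> M0 * R r0 powr \<alpha>" using M0b Rr0 by (simp add: field_simps)
            then have "F * (4 * (1 + H r0)) \<le> F * (M0 * R r0 powr \<alpha>)" using F by (intro mult_left_mono)
            then show "F * (4 * (1 + H r0)) \<le> M * R r0 powr \<alpha>" by (simp add: M_def mult.assoc)
          qed (use l0 Hr0 in simp)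
          also have "\<dots> \<le> M * R r0 powr \<beta> / (l + H r0)"
            using M l0 Hr0 R_le_1[of r0] \<beta> by (intro divide_right_mono mult_left_mono powr_mono') auto
          also have "\<dots> = \<omega> r0"
          proof -
            have "max r0 e = r0" using e by simp
            then show ?thesis unfolding \<omega>_def barrier_def using r0 by (simp add: R_eq)
          qed
          also have "\<dots> \<le> \<omega> r" unfolding \<omega>_def using True by (intro monoD[OF barrier_mono[OF par]])
          finally show ?thesis by (simp add: r_def)
        next
          case False
          define re where "re = max r e"
          have re: "0 < re" "re \<le> r0" "r \<le> re" "e \<le> re" using False e r by (auto simp: re_def)
          define H' where "H' = H re"
          have H': "H' > 0" using re by (simp add: H'_def H_pos)
          have Rre: "1 / R re = H'" using re r0 by (simp add: R_eq H'_def)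
          have rr1: "r \<le> r1" using False r0 by simp
          have rho: "rho \<nu> r = R r" using r rr1 by (simp add: R_eq rho_eq)
          \<comment> \<open>coupled are the jumps long compared with \<open>r\<close>; since \<open>k \<ge> 1\<close>, they survive the
            truncation\<close>
          define s where "s = k * re\<^sup>2"
          have s: "s > 0" "e\<^sup>2 \<le> s" "k * r\<^sup>2 \<le> s"
          proof -
            show "s > 0" using k re by (simp add: s_def)
            have "e\<^sup>2 \<le> re\<^sup>2" using e re by (intro power_mono) auto
            also have "\<dots> \<le> s" using k unfolding s_def by (simp add: mult_right_mono[of 1 k "re\<^sup>2", simplified])
            finally show "e\<^sup>2 \<le> s" .
            show "k * r\<^sup>2 \<le> s" unfolding s_def using k r re by (intro mult_left_mono power_mono) auto
          qed
          define N where "N = measure \<nu> {s<..}"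
          have N: "H' \<le> 2 * N" unfolding H'_def N_def s_def using re r0 by (intro r2(2)) auto
          define \<kappa> :: "'a \<Rightarrow> real" where "\<kappa> = (\<lambda>z. c0 * jump_part \<nu> s z)"
          have \<kappa>_int: "integrable lborel \<kappa>"
            unfolding \<kappa>_def using s by (intro integrable_mult_right jump_part_integrable)
          have \<kappa>_mass: "(\<integral>z. \<kappa> z \<partial>lborel) = c0 * (G * N)"
            unfolding \<kappa>_def using s by (simp add: jump_part_mass G_def N_def)
          have \<kappa>: "0 \<le> \<kappa> z \<and> \<kappa> z \<le> c0 * jump_part \<nu> (e\<^sup>2) z" for z
            unfolding \<kappa>_def using c0 s e by (auto intro!: mult_left_mono jump_part_antimono)
          define E where "E = R r powr \<alpha> / c0"
          have aE: "\<bar>a x z - a y z\<bar> \<le> E" for z using a[OF xy, of z] rho by (simp add: E_def r_def)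
          have E0: "E \<ge> 0" using c0 by (simp add: E_def)
          have R1: "R r powr \<alpha> \<le> 1 powr \<alpha>" using R_le_1 \<alpha> by (intro powr_mono2) auto
          then have E2: "E \<le> 2 / c0" unfolding E_def using c0 by (intro divide_right_mono) auto
          have TV: "(\<integral>z. \<omega> (norm z) * \<bar>\<kappa> z - \<kappa> (z + (x - y))\<bar> \<partial>lborel) \<le> c0 * (G / 2 * \<omega> r * N)"
          proof -
            have "(\<integral>z. \<omega> (norm z) * \<bar>\<kappa> z - \<kappa> (z + (x - y))\<bar> \<partial>lborel) =
               c0 * (\<integral>z. \<omega> (norm z) * \<bar>jump_part \<nu> s z - jump_part \<nu> s (z + (x - y))\<bar> \<partial>lborel)"
              unfolding \<kappa>_def using c0
              by (simp add: right_diff_distrib [symmetric] abs_mult mult.left_commute)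
            also have "\<dots> \<le> c0 * (G / 2 * \<omega> r * N)"
            proof (intro mult_left_mono integral_real_bounded)
              show "(\<integral>\<^sup>+ z. ennreal (\<omega> (norm z) * \<bar>jump_part \<nu> s z - jump_part \<nu> s (z + (x - y))\<bar>) \<partial>lborel) \<le> ennreal (G / 2 * \<omega> r * N)"
                unfolding N_def \<omega>_def
              proof (rule k(2)[of "barrier M l e \<beta>" r "x - y" s])
                show "barrier M l e \<beta> x \<le> 2 * sqrt (x / r) * barrier M l e \<beta> r" if "r \<le> x" for x
                  using that by (intro barrier_growth[OF par r])
              qed (use barrier_measurable[OF par] barrier_mono[OF par] barrier_nonneg[OF par] r s in \<open>auto simp: r_def\<close>)
            qed (use c0 G \<omega>0 in \<open>auto simp: N_def\<close>)
            finally show ?thesis .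
          qed
          have gain: "c0 * (G / 2 * \<omega> r * N) + c1 * H' * \<omega> r \<le> \<omega> r * (c0 * (G * N))"
          proof -
            have "c1 * H' * \<omega> r \<le> c1 * (2 * N) * \<omega> r"
              using N c1 \<omega>0 by (intro mult_right_mono mult_left_mono) auto
            also have "\<dots> = c0 * (G / 2 * \<omega> r * N)" by (simp add: c1_def)
            finally show ?thesis by (simp add: algebra_simps)
          qed
          have far: "4 / c0 * \<omega> r * \<Lambda> \<le> c1 / 4 * H' * \<omega> r"
          proof -
            have "16 * \<Lambda> / (c0 * c1) \<le> H'" unfolding H'_def using re r0 by (intro r3(2)) auto
            then have "4 / c0 * \<Lambda> \<le> c1 / 4 * H'" using c0 c1 by (simp add: field_simps)
            then have "4 / c0 * \<Lambda> * \<omega> r \<le> c1 / 4 * H' * \<omega> r" using \<omega>0 by (intro mult_right_mono)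
            then show ?thesis by (simp add: mult_ac)
          qed
          have near: "E * (C1 * \<omega> r * (\<integral>(z::'a). min 1 (norm z / r) * jump_part \<nu> (e\<^sup>2) z \<partial>lborel)) \<le> c1 / 4 * H' * \<omega> r"
          proof -
            have "(\<integral>(z::'a). min 1 (norm z / r) * jump_part \<nu> (e\<^sup>2) z \<partial>lborel) \<le> K1 * H'"
              unfolding K1_def G_def H'_def re_def using r rr1 e r0 by (intro integral_min_jump_part) auto
            then have "E * (C1 * \<omega> r * (\<integral>(z::'a). min 1 (norm z / r) * jump_part \<nu> (e\<^sup>2) z \<partial>lborel)) \<le> E * (C1 * \<omega> r * (K1 * H'))"
              using E0 C1 \<omega>0 by (intro mult_left_mono) auto
            also have "\<dots> = (E * (C1 * K1)) * (H' * \<omega> r)" by simp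
            also have "E * (C1 * K1) \<le> c1 / 4"
            proof -
              have "R r powr \<alpha> \<le> c1 * c0 / (4 * C1 * K1)" using False r0 by (intro r4(2)) auto
              then show ?thesis using c0 C1 K1 by (simp add: E_def field_simps)
            qed
            also have "c1 / 4 * (H' * \<omega> r) = c1 / 4 * H' * \<omega> r" by simp
            finally show ?thesis using H' \<omega>0 by (simp add: mult_right_mono)
          qed
          have rest: "E * (\<integral>(z::'a). min (\<omega> (norm z)) (2 * A) * indicator {z. r / 2 \<le> norm z} z * jump_part \<nu> (e\<^sup>2) z \<partial>lborel)
              \<le> R r powr \<beta> * (c2 / 2 * M + 2 * A * \<Phi> / c0)"
          proof -
            have "R r powr \<alpha> * (\<integral>(z::'a). min (\<omega> (norm z)) (2 * A) * indicator {z. r / 2 \<le> norm z} z * jump_part \<nu> (e\<^sup>2) z \<partial>lborel)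
              \<le> R r powr \<beta> * (4 powr \<alpha> * M * \<epsilon> + 2 * A * \<Phi>)"
              unfolding \<omega>_def \<Phi>_def using A \<epsilon> by (intro remainder_bound[OF par r _ \<delta>(1) _ \<delta>(2)]) auto
            then have "R r powr \<alpha> * (\<integral>(z::'a). min (\<omega> (norm z)) (2 * A) * indicator {z. r / 2 \<le> norm z} z * jump_part \<nu> (e\<^sup>2) z \<partial>lborel) / c0
              \<le> R r powr \<beta> * (4 powr \<alpha> * M * \<epsilon> + 2 * A * \<Phi>) / c0"
              using c0 by (intro divide_right_mono) auto
            also have "\<dots> = R r powr \<beta> * (4 powr \<alpha> * M * \<epsilon> / c0 + 2 * A * \<Phi> / c0)"
              by (simp add: algebra_simps add_divide_distrib)
            also have "4 powr \<alpha> * M * \<epsilon> / c0 = c2 / 2 * M" using c0 by (simp add: \<epsilon>_def)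
            finally show ?thesis by (simp add: E_def)
          qed
          \<comment> \<open>by the definition of the barrier, \<open>l + H re\<close> times \<open>\<omega> r\<close> is \<open>M * R r powr \<beta>\<close>; a
            fraction of it pays for the data\<close>
          have final: "F * R r powr \<beta> + R r powr \<beta> * (c2 / 2 * M + 2 * A * \<Phi> / c0) \<le> l * \<omega> r + c1 / 2 * H' * \<omega> r"
          proof -
            have "2 * A * \<Phi> / c0 \<le> 2 * F * \<Phi> / c0" using A \<Phi> c0 by (intro divide_right_mono mult_right_mono) auto
            then have "F + (c2 / 2 * M + 2 * A * \<Phi> / c0) \<le> F * (1 + 2 * \<Phi> / c0) + c2 / 2 * M"
              by (simp add: algebra_simps)
            also have "F * (1 + 2 * \<Phi> / c0) \<le> F * (c2 / 2 * M0)"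
              using M0a c2 F by (intro mult_left_mono) (auto simp: field_simps)
            also have "F * (c2 / 2 * M0) + c2 / 2 * M = c2 * M" by (simp add: M_def)
            finally have "R r powr \<beta> * (F + (c2 / 2 * M + 2 * A * \<Phi> / c0)) \<le> R r powr \<beta> * (c2 * M)"
              by (intro mult_left_mono) auto
            also have "\<dots> = c2 * (l + H') * \<omega> r"
            proof -
              have "l + H' \<noteq> 0" using l0 H' by simp
              then show ?thesis by (simp add: \<omega>_def barrier_def Rre re_def[symmetric])
            qed
            also have "\<dots> \<le> (l + c1 / 2 * H') * \<omega> r"
            proof (intro mult_right_mono \<omega>0)
              have "c2 * l \<le> 1 * l" using c2 l0 by (intro mult_right_mono) auto
              moreover have "c2 * H' \<le> c1 / 2 * H'" using c2 H' by (intro mult_right_mono) auto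
              ultimately show "c2 * (l + H') \<le> l + c1 / 2 * H'" by (simp add: algebra_simps)
            qed
            finally show ?thesis by (simp add: algebra_simps)
          qed
          have fd: "f x - f y \<le> F * R r powr \<beta>" using f[OF xy] rho by (simp add: r_def)
          have "coupling_estimate (jump_part \<nu> (e\<^sup>2)) a c0 \<Lambda> l f A \<omega> x y \<kappa> E C1"
            unfolding coupling_estimate_def Let_def r_def[symmetric]
          proof (intro conjI allI impI \<kappa>_int aE E2)
            show "\<omega> (r + s) \<le> \<omega> r * (1 + C1 * (s / r))" if "0 \<le> s" "s \<le> r / 2" for s
              unfolding \<omega>_def C1_def by (rule barrier_lipschitz[OF par r that])
            have add: "d + tv + fa + er \<le> T"
              if "er \<le> q + b" "cH = q + q + h" "T = lw + g" "d \<le> p" "tv \<le> t" "t + cH \<le> g" "fa \<le> q" "p + b \<le> lw + h"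
              for d tv fa er T q b cH h lw g p t :: real
              using that by linarith
            have errs: "E * (C1 * \<omega> r * (\<integral>(z::'a). min 1 (norm z / r) * jump_part \<nu> (e\<^sup>2) z \<partial>lborel) + (\<integral>(z::'a). min (\<omega> (norm z)) (2 * A) * indicator {z. r / 2 \<le> norm z} z * jump_part \<nu> (e\<^sup>2) z \<partial>lborel))
              \<le> c1 / 4 * H' * \<omega> r + R r powr \<beta> * (c2 / 2 * M + 2 * A * \<Phi> / c0)"
              unfolding distrib_left[of E] by (rule add_mono[OF near rest])
            have split: "c1 * H' * \<omega> r = c1 / 4 * H' * \<omega> r + c1 / 4 * H' * \<omega> r + c1 / 2 * H' * \<omega> r" by simp
            have total: "\<omega> r * (l + c0 * (G * N)) = l * \<omega> r + \<omega> r * (c0 * (G * N))" by (simp add: algebra_simps)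
            show "f x - f y + (\<integral>z. \<omega> (norm z) * \<bar>\<kappa> z - \<kappa> (z + (x - y))\<bar> \<partial>lborel) + 4 / c0 * \<omega> r * \<Lambda>
               + E * (C1 * \<omega> r * (\<integral>(z::'a). min 1 (norm z / r) * jump_part \<nu> (e\<^sup>2) z \<partial>lborel)
               + (\<integral>(z::'a). min (\<omega> (norm z)) (2 * A) * indicator {z. r / 2 \<le> norm z} z * jump_part \<nu> (e\<^sup>2) z \<partial>lborel))
               \<le> \<omega> r * (l + (\<integral>z. \<kappa> z \<partial>lborel))"
              unfolding \<kappa>_mass by (rule add[OF errs split total fd TV gain far final])
          qed (use \<kappa> C1 in auto)
          then show ?thesis by blast
        qed
      qed
    qed
  qed
qed

end

section \<open>Removing the truncation\<close>

lemma tolerance_bound: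
  fixes K c l \<epsilon> :: real
  assumes "K \<ge> 0" "c > 0" "l > 0" "\<epsilon> > 0"
  shows "2 * (K / c * (\<epsilon> * l * c / (2 * (K + 1)))) / l \<le> \<epsilon>"
proof -
  define D where "D = K + 1"
  have D: "D > 0" "K \<le> D" using assms by (auto simp: D_def)
  have "2 * (K / c * (\<epsilon> * l * c / (2 * D))) / l = K / D * \<epsilon>" using assms D by simp
  also have "\<dots> \<le> 1 * \<epsilon>" using assms D by (intro mult_right_mono) auto
  finally show ?thesis by (simp add: D_def)
qed

locale poisson_setting = capped_levy +
  fixes a :: "'a::euclidean_space \<Rightarrow> 'a \<Rightarrow> real" and c0 \<rho>0 M0 r0 :: real
  assumes c0: "0 < c0" "c0 < 1" and \<rho>0: "\<rho>0 > 0"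
    and a_meas: "(\<lambda>(x, z). a x z) \<in> borel_measurable (borel \<Otimes>\<^sub>M borel)"
    and a_bound: "\<And>x z. \<bar>a x z\<bar> \<le> 1 / c0"
    and a_lower: "\<And>x z. norm z < \<rho>0 \<Longrightarrow> a x z \<ge> c0"
    and M0: "M0 > 0" and r0: "0 < r0" "r0 \<le> r1"
    and uniform: "uniform_barrier a c0 \<rho>0 M0 r0"
begin

abbreviation L :: "real \<Rightarrow> ('a \<Rightarrow> real) \<Rightarrow> 'a \<Rightarrow> real" where "L e \<equiv> jump_op (jump_part \<nu> (e\<^sup>2)) a"

lemma generator: "e > 0 \<Longrightarrow> bounded_generator (jump_part \<nu> (e\<^sup>2)) a c0 \<rho>0 (far_bound TYPE('a) \<rho>0)"
  using jump_part_integrable[of "e\<^sup>2", where 'a='a] a_meas a_bound a_lower c0 integral_far[OF \<rho>0, where 'a='a]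
  by unfold_locales auto

lemma resolvent_parameter_ge_2:
  assumes "l \<ge> 2 * (2 / c0 * far_bound TYPE('a) \<rho>0 + 1)"
  shows "l \<ge> 2"
proof -
  have "2 / c0 * far_bound TYPE('a) \<rho>0 \<ge> 0"
    using far_bound_nonneg[where 'a='a, of \<rho>0] c0 by (intro mult_nonneg_nonneg) auto
  then have "2 * 1 \<le> 2 * (2 / c0 * far_bound TYPE('a) \<rho>0 + 1)" by (intro mult_left_mono) auto
  then show ?thesis using assms by (intro order.trans[OF _ assms]) simp
qed

lemma coefficient_measurable [measurable (raw)]:
  assumes [measurable]: "f \<in> borel_measurable M" "g \<in> borel_measurable M"
  shows "(\<lambda>x. a (f x) (g x)) \<in> borel_measurable M"
  using measurable_compose[OF measurable_Pair[OF assms] a_meas] by simp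

text \<open>
  Boundedness of the increments by \<open>K R powr (1 + \<alpha>)\<close>, relaxed below the scale \<open>e\<close>; for \<open>e = 0\<close>
  and bounded functions it amounts to the Hoelder condition of the solution space.
\<close>

definition increments :: "real \<Rightarrow> real \<Rightarrow> ('a \<Rightarrow> real) \<Rightarrow> bool" where
  "increments K e v \<longleftrightarrow> (\<forall>p q. \<bar>v p - v q\<bar> \<le> K * R (max (norm (p - q)) e) powr (1 + \<alpha>))"

lemma increments_mono:
  assumes "increments K e v" "e \<le> e'" "K \<ge> 0"
  shows "increments K e' v"
  unfolding increments_def
proof (intro allI)
  fix p q :: 'a
  have "\<bar>v p - v q\<bar> \<le> K * R (max (norm (p - q)) e) powr (1 + \<alpha>)" using assms by (simp add: increments_def)
  also have "\<dots> \<le> K * R (max (norm (p - q)) e') powr (1 + \<alpha>)"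
    using assms \<alpha> by (intro mult_left_mono powr_mono2 R_mono) auto
  finally show "\<bar>v p - v q\<bar> \<le> K * R (max (norm (p - q)) e') powr (1 + \<alpha>)" .
qed

lemma increment_times_coefficient:
  assumes "increments K e v" "K \<ge> 0"
  shows "\<bar>(v (x + z) - v x) * a x z\<bar> \<le> K / c0 * R (max (norm z) e) powr (1 + \<alpha>)"
proof -
  have "\<bar>v (x + z) - v x\<bar> \<le> K * R (max (norm (x + z - x)) e) powr (1 + \<alpha>)"
    using assms unfolding increments_def by blast
  then have "\<bar>v (x + z) - v x\<bar> * \<bar>a x z\<bar> \<le> K * R (max (norm z) e) powr (1 + \<alpha>) * (1 / c0)"
    using a_bound[of x z] assms by (intro mult_mono) auto
  then show ?thesis by (simp add: abs_mult)
qed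

lemma integrand_le_weight:
  assumes "increments K e v" "K \<ge> 0" "e \<ge> 0"
  shows "ennreal \<bar>(v (x + z) - v x) * a x z * jump_part \<nu> (e\<^sup>2) z\<bar> \<le> ennreal (K / c0) * weight z"
proof -
  have "\<bar>(v (x + z) - v x) * a x z * jump_part \<nu> (e\<^sup>2) z\<bar> = \<bar>(v (x + z) - v x) * a x z\<bar> * jump_part \<nu> (e\<^sup>2) z"
    by (simp add: abs_mult)
  also have "\<dots> \<le> K / c0 * R (max (norm z) e) powr (1 + \<alpha>) * jump_part \<nu> (e\<^sup>2) z"
    using increment_times_coefficient[OF assms(1,2)] by (intro mult_right_mono) auto
  also have "\<dots> = K / c0 * (R (max (norm z) e) powr (1 + \<alpha>) * jump_part \<nu> (e\<^sup>2) z)" by simp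
  finally have "ennreal \<bar>(v (x + z) - v x) * a x z * jump_part \<nu> (e\<^sup>2) z\<bar> \<le> ennreal (K / c0) * (ennreal (R (max (norm z) e) powr (1 + \<alpha>)) * ennreal (jump_part \<nu> (e\<^sup>2) z))"
    using assms c0 by (simp add: ennreal_mult' [symmetric] ennreal_leI)
  also have "\<dots> \<le> ennreal (K / c0) * weight z"
    using assms by (intro mult_left_mono weight_bound) auto
  finally show ?thesis .
qed

lemma integrand_integrable:
  assumes [measurable]: "v \<in> borel_measurable borel" and v: "increments K e v" "K \<ge> 0" "e \<ge> 0"
  shows "integrable lborel (\<lambda>z. (v (x + z) - v x) * a x z * jump_part \<nu> (e\<^sup>2) z)"
proof (rule integrableI_bounded)
  have "(\<integral>\<^sup>+ z. ennreal (norm ((v (x + z) - v x) * a x z * jump_part \<nu> (e\<^sup>2) z)) \<partial>lborel) \<le> (\<integral>\<^sup>+ (z::'a). ennreal (K / c0) * weight z \<partial>lborel)"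
    unfolding real_norm_def by (intro nn_integral_mono integrand_le_weight v)
  also have "\<dots> = ennreal (K / c0) * (\<integral>\<^sup>+ (z::'a). weight z \<partial>lborel)"
    by (intro nn_integral_cmult) simp
  also have "\<dots> < \<infinity>" using nn_integral_weight_finite[where 'a='a] by (simp add: ennreal_mult_less_top)
  finally show "(\<integral>\<^sup>+ z. ennreal (norm ((v (x + z) - v x) * a x z * jump_part \<nu> (e\<^sup>2) z)) \<partial>lborel) < \<infinity>" .
qed simp

lemma truncation_error:
  assumes [measurable]: "v \<in> borel_measurable borel" and v: "increments K e v" "K \<ge> 0" and e: "0 \<le> e" "e \<le> e'"
    and X: "X \<ge> 0" "(\<integral>\<^sup>+ (z::'a). low_weight (e'\<^sup>2) z \<partial>lborel) \<le> ennreal X"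
  shows "\<bar>L e v x - L e' v x\<bar> \<le> K / c0 * X"
proof -
  let ?h = "\<lambda>z. (v (x + z) - v x) * a x z * jump_part \<nu> (e\<^sup>2) z - (v (x + z) - v x) * a x z * jump_part \<nu> (e'\<^sup>2) z"
  have v': "increments K e' v" by (rule increments_mono[OF v(1) e(2) v(2)])
  have i: "integrable lborel (\<lambda>z. (v (x + z) - v x) * a x z * jump_part \<nu> (e\<^sup>2) z)"
    "integrable lborel (\<lambda>z. (v (x + z) - v x) * a x z * jump_part \<nu> (e'\<^sup>2) z)"
    using integrand_integrable[OF _ v e(1)] integrand_integrable[OF _ v' v(2)] e by auto
  have "L e v x - L e' v x = (\<integral>z. ?h z \<partial>lborel)"
    unfolding jump_op_def by (rule Bochner_Integration.integral_diff[OF i, symmetric])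
  then have "\<bar>L e v x - L e' v x\<bar> \<le> (\<integral>z. \<bar>?h z\<bar> \<partial>lborel)"
    by (simp only: integral_abs_bound)
  also have "\<dots> \<le> K / c0 * X"
  proof (rule integral_real_bounded)
    have "(\<integral>\<^sup>+ z. ennreal \<bar>?h z\<bar> \<partial>lborel) \<le> (\<integral>\<^sup>+ (z::'a). ennreal (K / c0) * low_weight (e'\<^sup>2) z \<partial>lborel)"
    proof (rule nn_integral_mono_AE)
      show "AE z in lborel. ennreal \<bar>?h z\<bar> \<le> ennreal (K / c0) * low_weight (e'\<^sup>2) z"
        using heat_tail_AE_finite[of "e\<^sup>2"]
      proof eventually_elim
        case (elim z)
        have "e\<^sup>2 \<le> e'\<^sup>2" using e by (intro power_mono) auto
        then have d: "jump_part \<nu> (e'\<^sup>2) z \<le> jump_part \<nu> (e\<^sup>2) z" using elim by (intro jump_part_diff(1)) auto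
        have "?h z = ((v (x + z) - v x) * a x z) * (jump_part \<nu> (e\<^sup>2) z - jump_part \<nu> (e'\<^sup>2) z)"
          by (simp add: right_diff_distrib)
        then have "\<bar>?h z\<bar> = \<bar>(v (x + z) - v x) * a x z\<bar> * (jump_part \<nu> (e\<^sup>2) z - jump_part \<nu> (e'\<^sup>2) z)"
          using d by (simp only: abs_mult[of _ "jump_part \<nu> (e\<^sup>2) z - jump_part \<nu> (e'\<^sup>2) z"])
        also have "\<dots> \<le> K / c0 * R (max (norm z) e) powr (1 + \<alpha>) * (jump_part \<nu> (e\<^sup>2) z - jump_part \<nu> (e'\<^sup>2) z)"
          using increment_times_coefficient[OF v] d by (intro mult_right_mono) auto
        finally have "ennreal \<bar>?h z\<bar> \<le> ennreal (K / c0) * (ennreal (R (max (norm z) e) powr (1 + \<alpha>)) * ennreal (jump_part \<nu> (e\<^sup>2) z - jump_part \<nu> (e'\<^sup>2) z))"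
          using v c0 by (simp add: ennreal_mult' [symmetric] ennreal_leI mult.assoc)
        also have "\<dots> \<le> ennreal (K / c0) * low_weight (e'\<^sup>2) z"
          by (intro mult_left_mono low_weight_bound e elim) auto
        finally show ?case .
      qed
    qed
    also have "\<dots> = ennreal (K / c0) * (\<integral>\<^sup>+ (z::'a). low_weight (e'\<^sup>2) z \<partial>lborel)"
      by (intro nn_integral_cmult) simp
    also have "\<dots> \<le> ennreal (K / c0) * ennreal X" by (intro mult_left_mono X) auto
    also have "\<dots> = ennreal (K / c0 * X)" using v c0 by (intro ennreal_mult' [symmetric]) auto
    finally show "(\<integral>\<^sup>+ z. ennreal \<bar>?h z\<bar> \<partial>lborel) \<le> ennreal (K / c0 * X)" .
  qed (use v c0 X in auto)
  finally show ?thesis .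
qed

text \<open>
  A solution of the homogeneous equation solves the truncated equations with right-hand sides
  that tend to \<open>0\<close> uniformly, so \<open>resolvent_bound\<close> forces it to vanish.
\<close>

lemma solution_unique:
  assumes v[measurable]: "v \<in> borel_measurable borel" and bd: "\<And>x. \<bar>v x\<bar> \<le> B"
    and inc: "increments K 0 v" "K \<ge> 0" and l: "l \<ge> 2 * (2 / c0 * far_bound TYPE('a) \<rho>0 + 1)"
    and eq: "\<And>x. l * v x - L 0 v x = 0"
  shows "v x = 0"
proof -
  have "l > 0" using resolvent_parameter_ge_2[OF l] by simp
  have "\<bar>v x\<bar> \<le> 0 + \<epsilon>" if \<epsilon>: "\<epsilon> > 0" for \<epsilon>
  proof -
    \<comment> \<open>\<open>K + 1\<close> instead of \<open>K\<close>, which may be \<open>0\<close>\<close>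
    define X where "X = \<epsilon> * l * c0 / (2 * (K + 1))"
    have X: "X > 0" using \<epsilon> \<open>l > 0\<close> c0 inc by (simp add: X_def)
    obtain s0 where s0: "s0 > 0" "\<And>s. s \<le> s0 \<Longrightarrow> (\<integral>\<^sup>+ (z::'a). low_weight s z \<partial>lborel) \<le> ennreal X"
      using small_low_weight[OF X, where 'a='a] by blast
    define e where "e = sqrt s0"
    have e: "e > 0" "e\<^sup>2 = s0" using s0 by (auto simp: e_def)
    interpret g: bounded_generator "jump_part \<nu> (e\<^sup>2)" a c0 \<rho>0 "far_bound TYPE('a) \<rho>0" using e by (intro generator)
    have "\<bar>v x\<bar> \<le> 2 * (K / c0 * X) / l"
    proof (rule g.resolvent_bound[OF v bd l])
      fix y
      have "\<bar>L 0 v y - L e v y\<bar> \<le> K / c0 * X"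
        using s0(2)[of s0] X e by (intro truncation_error v inc) auto
      then show "\<bar>l * v y - L e v y\<bar> \<le> K / c0 * X" using eq[of y] by simp
    qed
    also have "\<dots> \<le> \<epsilon>" unfolding X_def by (rule tolerance_bound) (use inc c0 \<open>l > 0\<close> \<epsilon> in auto)
    finally show ?thesis by simp
  qed
  then have "\<bar>v x\<bar> \<le> 0" by (rule field_le_epsilon)
  then show ?thesis by simp
qed

lemma truncated_solution:
  assumes e: "0 < e" "e \<le> r0" and \<beta>: "0 \<le> \<beta>" "\<beta> \<le> \<alpha>" and l: "l \<ge> 2 * (2 / c0 * far_bound TYPE('a) \<rho>0 + 1)"
    and fm: "f \<in> borel_measurable borel" and F: "\<And>x. \<bar>f x\<bar> \<le> F"
    and f: "\<And>x y. x \<noteq> y \<Longrightarrow> \<bar>f x - f y\<bar> \<le> F * rho \<nu> (norm (x - y)) powr \<beta>"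
  shows "\<exists>u. u \<in> borel_measurable borel \<and> (\<forall>x. \<bar>u x\<bar> \<le> 2 * F / l) \<and>
    (\<forall>x. l * u x - L e u x = f x) \<and> has_modulus (barrier (F * M0) l e \<beta>) u"
proof -
  interpret g: bounded_generator "jump_part \<nu> (e\<^sup>2)" a c0 \<rho>0 "far_bound TYPE('a) \<rho>0" using e by (intro generator)
  have F0: "F \<ge> 0" using F[of 0] by linarith
  have l2: "l \<ge> 2" by (rule resolvent_parameter_ge_2[OF l])
  have "admissible_modulus (barrier (F * M0) l e \<beta>)"
    using F0 M0 l2 e \<beta> by (intro barrier_admissible) auto
  moreover have "supersolution (jump_part \<nu> (e\<^sup>2)) a c0 (far_bound TYPE('a) \<rho>0) l f (2 * F / l) (barrier (F * M0) l e \<beta>)"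
    using uniform[unfolded uniform_barrier_def, rule_format, OF e \<beta> l2 F0 order.trans[OF abs_ge_self f]] .
  ultimately show ?thesis
    by (rule g.bounded_solution[OF l fm F]) blast
qed

lemma truncated_unique:
  assumes e: "e > 0" and l: "l \<ge> 2 * (2 / c0 * far_bound TYPE('a) \<rho>0 + 1)"
    and u[measurable]: "u \<in> borel_measurable borel" "u' \<in> borel_measurable borel"
    and bd: "\<And>x. \<bar>u x\<bar> \<le> B" "\<And>x. \<bar>u' x\<bar> \<le> B"
    and d: "\<And>x. \<bar>(l * u x - L e u x) - (l * u' x - L e u' x)\<bar> \<le> D"
  shows "\<bar>u x - u' x\<bar> \<le> 2 * D / l"
proof -
  interpret g: bounded_generator "jump_part \<nu> (e\<^sup>2)" a c0 \<rho>0 "far_bound TYPE('a) \<rho>0" using e by (intro generator)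
  show ?thesis
  proof (rule g.resolvent_bound[of "\<lambda>x. u x - u' x" "2 * B", OF _ _ l])
    show "\<bar>u x - u' x\<bar> \<le> 2 * B" for x using bd[of x] by linarith
    show "\<bar>l * (u x - u' x) - L e (\<lambda>x. u x - u' x) x\<bar> \<le> D" for x
      using d[of x] unfolding g.jump_op_diff[OF u bd] by (simp add: algebra_simps)
  qed simp
qed

lemma barrier_increments:
  assumes "has_modulus (barrier M l e \<alpha>) u" "M \<ge> 0" "l > 0" "e > 0"
  shows "increments M e u"
  unfolding increments_def
proof (intro allI)
  fix p q :: 'a
  let ?r = "norm (p - q)"
  have "\<bar>u p - u q\<bar> \<le> barrier M l e \<alpha> ?r" by (rule has_modulus_abs[OF assms(1)])
  also have "\<dots> \<le> M * R ?r powr \<alpha> * R (max ?r e)" using assms \<alpha> by (intro barrier_le2) auto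
  also have "\<dots> \<le> M * R (max ?r e) powr \<alpha> * R (max ?r e)"
    using assms \<alpha> by (intro mult_left_mono mult_right_mono powr_mono2 R_mono) auto
  also have "\<dots> = M * R (max ?r e) powr (1 + \<alpha>)"
    using R_pos[of "max ?r e"] assms by (simp add: powr_add)
  finally show "\<bar>u p - u q\<bar> \<le> M * R (max ?r e) powr (1 + \<alpha>)" .
qed

text \<open>
  The truncated solutions are built with the exponent \<open>\<alpha>\<close>. The estimate for another exponent \<open>\<beta>\<close>
  holds for the same functions, since the solutions with barriers for \<open>\<alpha>\<close> and \<open>\<beta>\<close> coincide by
  \<open>truncated_unique\<close>.
\<close>

theorem solution_exists:
  assumes l: "l \<ge> 2 * (2 / c0 * far_bound TYPE('a) \<rho>0 + 1)"
    and fm: "f \<in> borel_measurable borel" and F: "\<And>x. \<bar>f x\<bar> \<le> F"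
    and f: "\<And>x y. x \<noteq> y \<Longrightarrow> \<bar>f x - f y\<bar> \<le> F * rho \<nu> (norm (x - y)) powr \<alpha>"
  shows "\<exists>u. u \<in> borel_measurable borel \<and> (\<forall>x. l * u x - L 0 u x = f x) \<and>
    (\<forall>x. integrable lborel (\<lambda>z. (u (x + z) - u x) * a x z * jump_part \<nu> 0 z)) \<and>
    (\<forall>\<beta> F. 0 \<le> \<beta> \<longrightarrow> \<beta> \<le> \<alpha> \<longrightarrow> (\<forall>x. \<bar>f x\<bar> \<le> F) \<longrightarrow>
       (\<forall>x y. x \<noteq> y \<longrightarrow> \<bar>f x - f y\<bar> \<le> F * rho \<nu> (norm (x - y)) powr \<beta>) \<longrightarrow>
       (\<forall>x y. \<bar>u x\<bar> \<le> 2 * F / l \<and>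
          (x \<noteq> y \<longrightarrow> \<bar>u x - u y\<bar> \<le> F * M0 * R (norm (x - y)) powr \<beta> / (l + 1 / R (norm (x - y))))))"
proof -
  have F0: "F \<ge> 0" using F[of 0] by linarith
  have l2: "l \<ge> 2" by (rule resolvent_parameter_ge_2[OF l])
  then have l0: "l > 0" by simp
  define M where "M = F * M0"
  have M: "M \<ge> 0" using F0 M0 by (simp add: M_def)
  define e where "e = (\<lambda>n. r0 / real (Suc n))"
  have e: "0 < e n" "e n \<le> r0" for n using r0 by (auto simp: e_def field_simps)
  have e_dec: "n \<le> m \<Longrightarrow> e m \<le> e n" for n m
    unfolding e_def using r0 by (intro divide_left_mono) auto
  have e_lim: "e \<longlonglongrightarrow> 0"
    unfolding e_def by (rule LIMSEQ_Suc[OF lim_const_over_n])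
  have "\<forall>n. \<exists>u. u \<in> borel_measurable borel \<and> (\<forall>x. \<bar>u x\<bar> \<le> 2 * F / l) \<and>
    (\<forall>x. l * u x - L (e n) u x = f x) \<and> has_modulus (barrier M l (e n) \<alpha>) u"
    unfolding M_def using \<alpha> by (intro allI truncated_solution e l fm F f) auto
  then obtain u where u: "\<And>n. u n \<in> borel_measurable borel" "\<And>n x. \<bar>u n x\<bar> \<le> 2 * F / l"
    "\<And>n x. l * u n x - L (e n) (u n) x = f x" "\<And>n. has_modulus (barrier M l (e n) \<alpha>) (u n)"
    by metis
  note [measurable] = u(1)
  have inc: "increments M (e n) (u n)" for n
    by (rule barrier_increments[OF u(4) M l0 e(1)])
  have cauchy: "\<exists>N. \<forall>n\<ge>N. \<forall>m\<ge>n. \<forall>x. \<bar>u n x - u m x\<bar> \<le> \<epsilon>" if \<epsilon>: "\<epsilon> > 0" for \<epsilon>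
  proof -
    define X where "X = \<epsilon> * l * c0 / (2 * (M + 1))"
    have X: "X > 0" using \<epsilon> l0 c0 M by (simp add: X_def)
    obtain s0 where s0: "s0 > 0" "\<And>s. s \<le> s0 \<Longrightarrow> (\<integral>\<^sup>+ (z::'a). low_weight s z \<partial>lborel) \<le> ennreal X"
      using small_low_weight[OF X, where 'a='a] by blast
    have "eventually (\<lambda>n. e n < sqrt s0) sequentially"
      using s0 by (intro order_tendstoD(2)[OF e_lim]) simp
    then obtain N where N: "\<And>n. n \<ge> N \<Longrightarrow> e n < sqrt s0" by (auto simp: eventually_sequentially)
    have "\<bar>u n x - u m x\<bar> \<le> \<epsilon>" if n: "n \<ge> N" and m: "m \<ge> n" for n m x
    proof -
      have "(e n)\<^sup>2 \<le> (sqrt s0)\<^sup>2" using N[OF n] e(1)[of n] by (intro power_mono) auto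
      then have s: "(e n)\<^sup>2 \<le> s0" using s0 by simp
      have "\<bar>u n x - u m x\<bar> \<le> 2 * (M / c0 * X) / l"
      proof (rule truncated_unique[OF e(1)[of n] l u(1) u(1) u(2) u(2)])
        fix y
        have "\<bar>L (e m) (u m) y - L (e n) (u m) y\<bar> \<le> M / c0 * X"
          using e(1)[of m] e_dec[OF m] X s0(2)[OF s] by (intro truncation_error u inc M) auto
        then show "\<bar>l * u n y - L (e n) (u n) y - (l * u m y - L (e n) (u m) y)\<bar> \<le> M / c0 * X"
          using u(3)[of n y] u(3)[of m y] by linarith
      qed
      also have "\<dots> \<le> \<epsilon>" unfolding X_def by (rule tolerance_bound) (use M c0 l0 \<epsilon> in auto)
      finally show ?thesis by simp
    qed
    then show ?thesis by blast
  qed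
  have "Cauchy (\<lambda>n. u n x)" for x
  proof (rule CauchyI')
    fix \<epsilon> :: real assume \<epsilon>: "\<epsilon> > 0"
    then obtain N where N: "\<forall>n\<ge>N. \<forall>m\<ge>n. \<forall>x. \<bar>u n x - u m x\<bar> \<le> \<epsilon> / 2" using cauchy[of "\<epsilon> / 2"] by auto
    show "\<exists>M. \<forall>m\<ge>M. \<forall>n>m. dist (u m x) (u n x) < \<epsilon>"
    proof (intro exI allI impI)
      fix m n assume "m \<ge> N" "n > m"
      then have "\<bar>u m x - u n x\<bar> \<le> \<epsilon> / 2" using N by simp
      also have "\<dots> < \<epsilon>" using \<epsilon> by simp
      finally show "dist (u m x) (u n x) < \<epsilon>" by (simp add: dist_real_def)
    qed
  qed
  then obtain w where w: "\<And>x. (\<lambda>n. u n x) \<longlonglongrightarrow> w x"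
    unfolding Cauchy_convergent_iff convergent_def by metis
  have w_meas[measurable]: "w \<in> borel_measurable borel"
    by (rule borel_measurable_LIMSEQ_real[OF w u(1)])
  have estimates: "\<bar>w x\<bar> \<le> 2 * G / l \<and> (x \<noteq> y \<longrightarrow> \<bar>w x - w y\<bar> \<le> G * M0 * R (norm (x - y)) powr \<beta> / (l + 1 / R (norm (x - y))))"
    if \<beta>: "0 \<le> \<beta>" "\<beta> \<le> \<alpha>" and G: "\<And>x. \<bar>f x\<bar> \<le> G"
      and fG: "\<And>x y. x \<noteq> y \<Longrightarrow> \<bar>f x - f y\<bar> \<le> G * rho \<nu> (norm (x - y)) powr \<beta>" for \<beta> G x y
  proof -
    have un: "(\<forall>x. \<bar>u n x\<bar> \<le> 2 * G / l) \<and> has_modulus (barrier (G * M0) l (e n) \<beta>) (u n)" for n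
    proof -
      obtain v where v: "v \<in> borel_measurable borel" "\<And>x. \<bar>v x\<bar> \<le> 2 * G / l"
        "\<And>x. l * v x - L (e n) v x = f x" "has_modulus (barrier (G * M0) l (e n) \<beta>) v"
        using truncated_solution[OF e[of n] \<beta> l fm G fG] by blast
      have "\<bar>u n x - v x\<bar> \<le> 2 * 0 / l" for x
      proof (rule truncated_unique[OF e(1)[of n] l u(1) v(1)])
        show "\<bar>u n x\<bar> \<le> max (2 * F / l) (2 * G / l)" "\<bar>v x\<bar> \<le> max (2 * F / l) (2 * G / l)" for x
          using u(2)[of n x] v(2)[of x] by auto
        show "\<bar>l * u n x - L (e n) (u n) x - (l * v x - L (e n) v x)\<bar> \<le> 0" for x
          using u(3)[of n x] v(3)[of x] by simp
      qed
      then have "u n = v" by (auto simp: fun_eq_iff)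
      then show ?thesis using v by simp
    qed
    have "\<bar>w x\<bar> \<le> 2 * G / l"
      by (rule LIMSEQ_le_const2[OF tendsto_rabs[OF w]]) (use un in blast)
    moreover have "\<bar>w x - w y\<bar> \<le> G * M0 * R (norm (x - y)) powr \<beta> / (l + 1 / R (norm (x - y)))" if "x \<noteq> y"
    proof (rule LIMSEQ_le_const2[OF tendsto_rabs[OF tendsto_diff[OF w w]]])
      have "eventually (\<lambda>n. e n < norm (x - y)) sequentially"
        using that by (intro order_tendstoD(2)[OF e_lim]) simp
      then obtain N where N: "\<And>n. n \<ge> N \<Longrightarrow> e n < norm (x - y)" by (auto simp: eventually_sequentially)
      show "\<exists>N. \<forall>n\<ge>N. \<bar>u n x - u n y\<bar> \<le> G * M0 * R (norm (x - y)) powr \<beta> / (l + 1 / R (norm (x - y)))"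
      proof (intro exI allI impI)
        fix n assume "n \<ge> N"
        then have "max (norm (x - y)) (e n) = norm (x - y)" using N[of n] by simp
        then show "\<bar>u n x - u n y\<bar> \<le> G * M0 * R (norm (x - y)) powr \<beta> / (l + 1 / R (norm (x - y)))"
          using has_modulus_abs[of "barrier (G * M0) l (e n) \<beta>" "u n" x y] un[of n] by (simp add: barrier_def)
      qed
    qed
    ultimately show ?thesis by blast
  qed
  have inc_w: "increments M 0 w"
    unfolding increments_def
  proof (intro allI)
    fix p q :: 'a
    show "\<bar>w p - w q\<bar> \<le> M * R (max (norm (p - q)) 0) powr (1 + \<alpha>)"
    proof (cases "p = q")
      case False
      let ?r = "norm (p - q)"
      have Rp: "R ?r > 0" using False by (intro R_pos) simp
      have "\<bar>w p - w q\<bar> \<le> M * R ?r powr \<alpha> / (l + 1 / R ?r)"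
        using estimates[of \<alpha> F p q] \<alpha> F f False by (simp add: M_def)
      also have "\<dots> \<le> M * R ?r powr \<alpha> / (1 / R ?r)"
        using M l0 Rp by (intro frac_le) auto
      also have "\<dots> = M * R ?r powr (1 + \<alpha>)" using Rp by (simp add: powr_add)
      finally show ?thesis by (simp add: max_def)
    qed simp
  qed
  have int_w: "integrable lborel (\<lambda>z. (w (x + z) - w x) * a x z * jump_part \<nu> 0 z)" for x
    using integrand_integrable[OF w_meas inc_w M, of x] by simp
  have "(\<lambda>n. L (e n) (u n) x) \<longlonglongrightarrow> L 0 w x" for x
    unfolding jump_op_def
  proof (rule integral_dominated_convergence[where w = "\<lambda>z. M / c0 * enn2real (weight z)"])
    have fin: "AE z::'a in lborel. weight z \<noteq> \<infinity>"
      using nn_integral_weight_finite[where 'a='a] by (intro nn_integral_noteq_infinite) auto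
    show "integrable lborel (\<lambda>z::'a. M / c0 * enn2real (weight z))"
    proof (rule integrable_mult_right, rule integrableI_nonneg)
      have "(\<integral>\<^sup>+ (z::'a). ennreal (enn2real (weight z)) \<partial>lborel) \<le> (\<integral>\<^sup>+ (z::'a). weight z \<partial>lborel)"
        by (intro nn_integral_mono) (simp add: ennreal_enn2real_if)
      then show "(\<integral>\<^sup>+ (z::'a). ennreal (enn2real (weight z)) \<partial>lborel) < \<infinity>"
        using nn_integral_weight_finite[where 'a='a] by (rule le_less_trans)
    qed auto
    show "AE z in lborel. norm ((u n (x + z) - u n x) * a x z * jump_part \<nu> ((e n)\<^sup>2) z) \<le> M / c0 * enn2real (weight z)" for n
      using fin
    proof eventually_elim
      case (elim z)
      have "ennreal \<bar>(u n (x + z) - u n x) * a x z * jump_part \<nu> ((e n)\<^sup>2) z\<bar> \<le> ennreal (M / c0) * weight z"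
        using e(1)[of n] by (intro integrand_le_weight inc M) auto
      also have "weight z = ennreal (enn2real (weight z))" using elim by (simp add: less_top)
      also have "ennreal (M / c0) * \<dots> = ennreal (M / c0 * enn2real (weight z))"
        using M c0 by (intro ennreal_mult' [symmetric]) auto
      finally show ?case using M c0 by (simp add: ennreal_le_iff)
    qed
    show "AE z in lborel. (\<lambda>n. (u n (x + z) - u n x) * a x z * jump_part \<nu> ((e n)\<^sup>2) z) \<longlonglongrightarrow> (w (x + z) - w x) * a x z * jump_part \<nu> (0\<^sup>2) z"
      using heat_tail_AE_finite[of 0]
    proof eventually_elim
      case (elim z)
      have "(\<lambda>n. jump_part \<nu> ((e n)\<^sup>2) z) \<longlonglongrightarrow> jump_part \<nu> 0 z"
      proof (rule jump_part_tendsto[OF elim])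
        show "(\<lambda>n. (e n)\<^sup>2) \<longlonglongrightarrow> 0" using tendsto_power[OF e_lim, of 2] by simp
        show "0 < (e n)\<^sup>2" for n using e(1)[of n] by (rule zero_less_power)
      qed
      then show ?case by (auto intro!: tendsto_intros w)
    qed
  qed simp_all
  then have "(\<lambda>n. l * u n x - L (e n) (u n) x) \<longlonglongrightarrow> l * w x - L 0 w x" for x
    by (intro tendsto_intros w)
  then have "l * w x - L 0 w x = f x" for x
    unfolding u(3) using LIMSEQ_unique[OF tendsto_const] by metis
  then show ?thesis using w_meas int_w estimates by (intro exI[of _ w]) simp
qed

end

section \<open>The Poisson equation in generalized Hoelder spaces\<close>

lemma holder_norm_leD:
  assumes "holder_norm \<rho> s f \<le> ennreal F" "F \<ge> 0"
  shows "\<bar>f x\<bar> \<le> F" and "x \<noteq> y \<Longrightarrow> \<bar>f x - f y\<bar> / \<rho> (norm (x - y)) powr s \<le> F"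
proof -
  have "ennreal \<bar>f x\<bar> \<le> (SUP x. ennreal \<bar>f x\<bar>)" by (rule SUP_upper) simp
  also have "\<dots> \<le> holder_norm \<rho> s f" unfolding holder_norm_def by simp
  also have "\<dots> \<le> ennreal F" by (rule assms)
  finally show "\<bar>f x\<bar> \<le> F" using assms(2) by simp
  assume xy: "x \<noteq> y"
  let ?g = "\<lambda>(x, y). ennreal (\<bar>f x - f y\<bar> / \<rho> (norm (x - y)) powr s)"
  have "?g (x, y) \<le> (SUP p\<in>{(x, y). x \<noteq> y}. ?g p)" by (rule SUP_upper) (use xy in simp)
  also have "\<dots> \<le> holder_norm \<rho> s f" unfolding holder_norm_def by simp
  also have "\<dots> \<le> ennreal F" by (rule assms)
  finally show "\<bar>f x - f y\<bar> / \<rho> (norm (x - y)) powr s \<le> F" using assms(2) by simp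
qed

lemma holder_norm_leI:
  assumes "\<And>x. \<bar>f x\<bar> \<le> A" "\<And>x y. x \<noteq> y \<Longrightarrow> \<bar>f x - f y\<bar> / \<rho> (norm (x - y)) powr s \<le> B"
  shows "holder_norm \<rho> s f \<le> ennreal A + ennreal B"
  unfolding holder_norm_def using assms by (intro add_mono SUP_least) (auto intro!: ennreal_leI)

theorem theorem1p1:
  fixes \<nu> :: "real measure" and \<rho>0 c0 \<alpha> :: real
  assumes "levy_measure \<nu>"
    and "slowly_varying_at_infinity (laplace_exponent \<nu>)"
    and "filterlim (laplace_exponent \<nu>) at_top at_top"
    and "\<rho>0 \<in> {0<..<1}" and "c0 \<in> {0<..<1}" and "\<alpha> > 0"
  shows "\<exists>C :: real \<Rightarrow> real. (\<forall>\<beta>\<in>{0..\<alpha>}. C \<beta> > 0) \<and>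
    (\<forall>a :: 'a::euclidean_space \<Rightarrow> 'a \<Rightarrow> real.
       admissible_coefficient (rho \<nu>) \<rho>0 c0 \<alpha> a \<longrightarrow>
       (\<exists>l0>0. \<forall>l\<ge>2 * l0. \<forall>f\<in>holder_space (rho \<nu>) \<alpha>.
          (\<exists>!u. u \<in> holder_space (rho \<nu>) (1 + \<alpha>) \<and> poisson_solution \<nu> a l f u) \<and>
          (\<forall>u. u \<in> holder_space (rho \<nu>) (1 + \<alpha>) \<and> poisson_solution \<nu> a l f u \<longrightarrow>
             (\<forall>\<beta>\<in>{0..\<alpha>}.
                ennreal l * holder_norm (rho \<nu>) \<beta> u + holder_norm (rho \<nu>) (1 + \<beta>) u
                  \<le> ennreal (C \<beta>) * holder_norm (rho \<nu>) \<beta> f))))"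
proof -
  have \<alpha>: "\<alpha> > 0" and c0: "0 < c0" "c0 < 1" and \<rho>0: "\<rho>0 > 0" using assms by auto
  interpret slowly_varying_levy \<nu> using assms by unfold_locales
  define q :: real where "q = 2 powr (1 / (2 * (1 + \<alpha>)))"
  have q: "q > 1" unfolding q_def using \<alpha> by simp
  have q_power: "q powr (1 + \<alpha>) \<le> sqrt 2"
  proof -
    have "1 / (2 * (1 + \<alpha>)) * (1 + \<alpha>) = 1 / 2" using \<alpha> by (simp add: field_simps)
    then have "q powr (1 + \<alpha>) = 2 powr (1 / 2)" unfolding q_def powr_powr by (simp only:)
    also have "\<dots> = sqrt 2" by (simp add: powr_half_sqrt)
    finally show ?thesis by simp
  qed
  obtain r1 where r1: "r1 > 0" "r1 \<le> 1" "H r1 \<ge> 1" "\<And>r. 0 < r \<Longrightarrow> r \<le> r1 \<Longrightarrow> H (r / 2) \<le> q * H r"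
    using H_doubling[OF q] by blast
  interpret capped_levy \<nu> r1 q \<alpha> using r1 q \<alpha> q_power by unfold_locales
  obtain M0 r0 where M0: "M0 > 0" and r0: "0 < r0" "r0 \<le> r1"
    and super: "\<And>a :: 'a \<Rightarrow> 'a \<Rightarrow> real.
       (\<And>x y z. x \<noteq> y \<Longrightarrow> \<bar>a x z - a y z\<bar> \<le> rho \<nu> (norm (x - y)) powr \<alpha> / c0) \<Longrightarrow>
       uniform_barrier a c0 \<rho>0 M0 r0"
    using uniform_barrier_exists[OF c0 \<rho>0, where 'a='a] by blast
  have rho_powr_pos: "rho \<nu> (norm (x - y)) powr s > 0" if "x \<noteq> y" for x y :: 'a and s
    using rho_pos[of "norm (x - y)"] that by simp
  \<comment> \<open>\<open>l\<close> times the first norm gives \<open>2 + M0\<close>, the second norm at most \<open>1 + M0\<close>, as \<open>2 / l \<le> 1\<close>\<close>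
  define C where "C = 3 + 2 * M0"
  define l0 where "l0 = 2 / c0 * far_bound TYPE('a) \<rho>0 + 1"
  have l0: "l0 > 0"
    using far_bound_nonneg[where 'a='a, of \<rho>0] c0 unfolding l0_def by (intro add_nonneg_pos mult_nonneg_nonneg) auto
  have main: "(\<exists>!u. u \<in> holder_space (rho \<nu>) (1 + \<alpha>) \<and> poisson_solution \<nu> a l f u) \<and>
     (\<forall>u. u \<in> holder_space (rho \<nu>) (1 + \<alpha>) \<and> poisson_solution \<nu> a l f u \<longrightarrow>
       (\<forall>\<beta>\<in>{0..\<alpha>}. ennreal l * holder_norm (rho \<nu>) \<beta> u + holder_norm (rho \<nu>) (1 + \<beta>) u
                  \<le> ennreal C * holder_norm (rho \<nu>) \<beta> f))"
    if adm: "admissible_coefficient (rho \<nu>) \<rho>0 c0 \<alpha> a" and l: "l \<ge> 2 * l0" and f: "f \<in> holder_space (rho \<nu>) \<alpha>"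
    for a :: "'a \<Rightarrow> 'a \<Rightarrow> real" and l f
  proof -
    have a_norm: "holder_norm (rho \<nu>) \<alpha> (\<lambda>x. a x z) \<le> ennreal (1 / c0)" for z
      using adm by (simp add: admissible_coefficient_def inverse_eq_divide)
    have c0': "1 / c0 \<ge> 0" using c0 by simp
    have a_holder: "\<bar>a x z - a y z\<bar> \<le> rho \<nu> (norm (x - y)) powr \<alpha> / c0" if "x \<noteq> y" for x y z
      using holder_norm_leD(2)[OF a_norm c0' that] rho_powr_pos[OF that, of \<alpha>] by (simp add: field_simps)
    interpret poisson_setting \<nu> r1 q \<alpha> a c0 \<rho>0 M0 r0
    proof unfold_locales
      show "\<bar>a x z\<bar> \<le> 1 / c0" for x z by (rule holder_norm_leD(1)[OF a_norm c0'])
      show "uniform_barrier a c0 \<rho>0 M0 r0" using a_holder by (rule super)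
    qed (use adm c0 \<rho>0 M0 r0 in \<open>auto simp: admissible_coefficient_def\<close>)
    have l': "l \<ge> 2 * (2 / c0 * far_bound TYPE('a) \<rho>0 + 1)" using l by (simp add: l0_def)
    have l2: "l \<ge> 2" by (rule resolvent_parameter_ge_2[OF l'])
    have sol_iff: "poisson_solution \<nu> a l f u \<longleftrightarrow>
       (\<forall>x. integrable lborel (\<lambda>z. (u (x + z) - u x) * a x z * jump_part \<nu> 0 z) \<and> l * u x - L 0 u x = f x)" for u
      unfolding poisson_solution_def nonlocal_op_def nonlocal_integrand_def[abs_def] jump_op_def jump_kernel_eq by simp
    have norm_eq: "\<exists>F\<ge>0. holder_norm (rho \<nu>) s g = ennreal F \<and> (\<forall>x. \<bar>g x\<bar> \<le> F) \<and>
        (\<forall>x y. x \<noteq> y \<longrightarrow> \<bar>g x - g y\<bar> \<le> F * rho \<nu> (norm (x - y)) powr s)"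
      if fin: "holder_norm (rho \<nu>) s g < \<infinity>" for s and g :: "'a \<Rightarrow> real"
    proof -
      obtain F where F: "F \<ge> 0" "holder_norm (rho \<nu>) s g = ennreal F"
        using fin by (cases "holder_norm (rho \<nu>) s g") auto
      have "\<bar>g x - g y\<bar> \<le> F * rho \<nu> (norm (x - y)) powr s" if "x \<noteq> y" for x y
        using holder_norm_leD(2)[of "rho \<nu>" s g F, OF _ F(1) that] F(2) rho_powr_pos[OF that, of s]
        by (simp add: field_simps)
      then show ?thesis using F holder_norm_leD(1)[of "rho \<nu>" s g F] by auto
    qed
    have fm: "f \<in> borel_measurable borel" and f_fin: "holder_norm (rho \<nu>) \<alpha> f < \<infinity>"
      using f by (auto simp: holder_space_def)
    obtain F where F: "F \<ge> 0" "holder_norm (rho \<nu>) \<alpha> f = ennreal F" "\<And>x. \<bar>f x\<bar> \<le> F"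
      "\<And>x y. x \<noteq> y \<Longrightarrow> \<bar>f x - f y\<bar> \<le> F * rho \<nu> (norm (x - y)) powr \<alpha>"
      using norm_eq[OF f_fin] by blast
    obtain u where u: "u \<in> borel_measurable borel" "\<And>x. l * u x - L 0 u x = f x"
      "\<And>x. integrable lborel (\<lambda>z. (u (x + z) - u x) * a x z * jump_part \<nu> 0 z)"
      and u_est: "\<forall>\<beta> F. 0 \<le> \<beta> \<longrightarrow> \<beta> \<le> \<alpha> \<longrightarrow> (\<forall>x. \<bar>f x\<bar> \<le> F) \<longrightarrow>
       (\<forall>x y. x \<noteq> y \<longrightarrow> \<bar>f x - f y\<bar> \<le> F * rho \<nu> (norm (x - y)) powr \<beta>) \<longrightarrow>
       (\<forall>x y. \<bar>u x\<bar> \<le> 2 * F / l \<and>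
          (x \<noteq> y \<longrightarrow> \<bar>u x - u y\<bar> \<le> F * M0 * R (norm (x - y)) powr \<beta> / (l + 1 / R (norm (x - y)))))"
      using solution_exists[OF l' fm F(3,4)] by blast
    have estimate: "ennreal l * holder_norm (rho \<nu>) \<beta> u + holder_norm (rho \<nu>) (1 + \<beta>) u \<le> ennreal C * holder_norm (rho \<nu>) \<beta> f"
      if \<beta>: "0 \<le> \<beta>" "\<beta> \<le> \<alpha>" for \<beta>
    proof (cases "holder_norm (rho \<nu>) \<beta> f < \<infinity>")
      case False
      then have "ennreal C * holder_norm (rho \<nu>) \<beta> f = \<infinity>"
        using M0 by (simp add: C_def not_less top_unique ennreal_mult_eq_top_iff)
      then show ?thesis by simp
    next
      case True
      obtain G where G: "G \<ge> 0" "holder_norm (rho \<nu>) \<beta> f = ennreal G" "\<And>x. \<bar>f x\<bar> \<le> G"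
        "\<And>x y. x \<noteq> y \<Longrightarrow> \<bar>f x - f y\<bar> \<le> G * rho \<nu> (norm (x - y)) powr \<beta>"
        using norm_eq[OF True] by blast
      have est: "\<bar>u x\<bar> \<le> 2 * G / l \<and>
          (x \<noteq> y \<longrightarrow> \<bar>u x - u y\<bar> \<le> G * M0 * R (norm (x - y)) powr \<beta> / (l + 1 / R (norm (x - y))))" for x y
        using u_est \<beta> G(3,4) by simp
      have GM: "G * M0 \<ge> 0" using G M0 by simp
      have 1: "holder_norm (rho \<nu>) \<beta> u \<le> ennreal (2 * G / l) + ennreal (G * M0 / l)"
      proof (rule holder_norm_leI)
        show "\<bar>u x\<bar> \<le> 2 * G / l" for x using est by blast
        fix x y :: 'a assume xy: "x \<noteq> y"
        let ?r = "norm (x - y)"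
        have r: "?r > 0" using xy by simp
        have "\<bar>u x - u y\<bar> \<le> G * M0 * R ?r powr \<beta> / (l + 1 / R ?r)" using est xy by blast
        also have "\<dots> \<le> G * M0 * rho \<nu> ?r powr \<beta> / l"
          using GM l2 R_pos[OF r] R_le_rho[OF r] \<beta> by (intro frac_le mult_left_mono powr_mono2) auto
        finally show "\<bar>u x - u y\<bar> / rho \<nu> ?r powr \<beta> \<le> G * M0 / l"
          using rho_powr_pos[OF xy, of \<beta>] by (simp add: divide_le_eq field_simps)
      qed
      have 2: "holder_norm (rho \<nu>) (1 + \<beta>) u \<le> ennreal (2 * G / l) + ennreal (G * M0)"
      proof (rule holder_norm_leI)
        show "\<bar>u x\<bar> \<le> 2 * G / l" for x using est by blast
        fix x y :: 'a assume xy: "x \<noteq> y"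
        let ?r = "norm (x - y)"
        have r: "?r > 0" using xy by simp
        have "\<bar>u x - u y\<bar> \<le> G * M0 * R ?r powr \<beta> / (l + 1 / R ?r)" using est xy by blast
        also have "\<dots> \<le> G * M0 * R ?r powr \<beta> / (1 / R ?r)"
          using GM l2 R_pos[OF r] by (intro frac_le) auto
        also have "\<dots> = G * M0 * R ?r powr (1 + \<beta>)" using R_pos[OF r] by (simp add: powr_add)
        also have "\<dots> \<le> G * M0 * rho \<nu> ?r powr (1 + \<beta>)"
          using GM R_le_rho[OF r] \<beta> by (intro mult_left_mono powr_mono2) auto
        finally show "\<bar>u x - u y\<bar> / rho \<nu> ?r powr (1 + \<beta>) \<le> G * M0"
          using rho_powr_pos[OF xy, of "1 + \<beta>"] by (simp add: divide_le_eq)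
      qed
      have "ennreal l * holder_norm (rho \<nu>) \<beta> u + holder_norm (rho \<nu>) (1 + \<beta>) u \<le>
         ennreal l * (ennreal (2 * G / l) + ennreal (G * M0 / l)) + (ennreal (2 * G / l) + ennreal (G * M0))"
        using 1 2 by (intro add_mono mult_left_mono) auto
      also have "\<dots> = ennreal (l * (2 * G / l + G * M0 / l) + (2 * G / l + G * M0))"
        using G M0 l2 by (simp add: ennreal_plus [symmetric] ennreal_mult' [symmetric] del: ennreal_plus)
      also have "\<dots> \<le> ennreal (C * G)"
      proof (rule ennreal_leI)
        have "l * (2 * G / l + G * M0 / l) = 2 * G + G * M0" using l2 by (simp add: field_simps)
        moreover have "2 * G / l \<le> G" using l2 G mult_left_mono[of 2 l G] by (simp add: field_simps)
        moreover have "C * G = 3 * G + 2 * (G * M0)" by (simp add: C_def algebra_simps)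
        moreover have "a + (b + m) \<le> c" if "a = 2 * G + m" "b \<le> G" "c = 3 * G + 2 * m" for a b c m
          using that by linarith
        ultimately show "l * (2 * G / l + G * M0 / l) + (2 * G / l + G * M0) \<le> C * G" by blast
      qed
      also have "\<dots> = ennreal C * holder_norm (rho \<nu>) \<beta> f"
        using M0 by (simp add: G(2) C_def ennreal_mult')
      finally show ?thesis .
    qed
    have u_space: "u \<in> holder_space (rho \<nu>) (1 + \<alpha>)"
    proof -
      have "holder_norm (rho \<nu>) (1 + \<alpha>) u \<le> ennreal l * holder_norm (rho \<nu>) \<alpha> u + holder_norm (rho \<nu>) (1 + \<alpha>) u"
        by simp
      also have "\<dots> \<le> ennreal C * holder_norm (rho \<nu>) \<alpha> f" using \<alpha> by (intro estimate) auto
      also have "\<dots> < \<infinity>" using f_fin by (simp add: ennreal_mult_less_top)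
      finally show ?thesis using u by (simp add: holder_space_def)
    qed
    have u_sol: "poisson_solution \<nu> a l f u" using u by (simp add: sol_iff)
    have unique: "v = u" if v: "v \<in> holder_space (rho \<nu>) (1 + \<alpha>)" "poisson_solution \<nu> a l f v" for v
    proof -
      define w where "w = (\<lambda>x. v x - u x)"
      obtain Kv Ku where K: "Kv \<ge> 0" "\<And>x. \<bar>v x\<bar> \<le> Kv" "\<And>x y. x \<noteq> y \<Longrightarrow> \<bar>v x - v y\<bar> \<le> Kv * rho \<nu> (norm (x - y)) powr (1 + \<alpha>)"
        "Ku \<ge> 0" "\<And>x. \<bar>u x\<bar> \<le> Ku" "\<And>x y. x \<noteq> y \<Longrightarrow> \<bar>u x - u y\<bar> \<le> Ku * rho \<nu> (norm (x - y)) powr (1 + \<alpha>)"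
        using v(1) u_space norm_eq[of "1 + \<alpha>" v] norm_eq[of "1 + \<alpha>" u] unfolding holder_space_def by blast
      define B where "B = Kv + Ku"
      have B: "B \<ge> 0" using K by (simp add: B_def)
      have wB: "\<bar>w x\<bar> \<le> B" for x using K(2)[of x] K(5)[of x] by (simp add: w_def B_def)
      have wH: "\<bar>w x - w y\<bar> \<le> B * rho \<nu> (norm (x - y)) powr (1 + \<alpha>)" if "x \<noteq> y" for x y
        using K(3)[OF that] K(6)[OF that] by (simp add: w_def B_def algebra_simps)
      have vm: "v \<in> borel_measurable borel" using v by (simp add: holder_space_def)
      have wm: "w \<in> borel_measurable borel" unfolding w_def by (intro borel_measurable_diff u vm)
      \<comment> \<open>\<open>R\<close> is frozen beyond \<open>r1\<close>, where the supremum bound replaces the Hoelder bound\<close>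
      define K' where "K' = B + 2 * B / R r1 powr (1 + \<alpha>)"
      have Rr1: "R r1 powr (1 + \<alpha>) > 0" using R_pos[of r1] r1 by simp
      have K': "K' \<ge> 0" "B \<le> K'" "2 * B / R r1 powr (1 + \<alpha>) \<le> K'" using B Rr1 by (auto simp: K'_def)
      have "increments K' 0 w"
        unfolding increments_def
      proof (intro allI)
        fix x y :: 'a
        let ?r = "norm (x - y)"
        show "\<bar>w x - w y\<bar> \<le> K' * R (max ?r 0) powr (1 + \<alpha>)"
        proof (cases "x = y")
          case False
          then have r: "?r > 0" by simp
          show ?thesis
          proof (cases "?r \<le> r1")
            case True
            have "\<bar>w x - w y\<bar> \<le> B * R ?r powr (1 + \<alpha>)"
              using wH[OF False] r True by (simp add: R_eq rho_eq)
            also have "\<dots> \<le> K' * R ?r powr (1 + \<alpha>)" using K' by (intro mult_right_mono) auto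
            finally show ?thesis by (simp add: max_def)
          next
            case F: False
            have "\<bar>w x - w y\<bar> \<le> 2 * B" using wB[of x] wB[of y] by linarith
            also have "\<dots> = 2 * B / R r1 powr (1 + \<alpha>) * R r1 powr (1 + \<alpha>)" using Rr1 by simp
            also have "\<dots> \<le> K' * R ?r powr (1 + \<alpha>)"
              using K' F B \<alpha> by (intro mult_mono powr_mono2 R_mono) auto
            finally show ?thesis by (simp add: max_def)
          qed
        qed simp
      qed
      moreover have "l * w x - L 0 w x = 0" for x
      proof -
        have iv: "integrable lborel (\<lambda>z. (v (x + z) - v x) * a x z * jump_part \<nu> 0 z)" and ev: "l * v x - L 0 v x = f x"
          using v(2) by (auto simp: sol_iff)
        have "L 0 v x - L 0 u x = (\<integral>z. (v (x + z) - v x) * a x z * jump_part \<nu> 0 z - (u (x + z) - u x) * a x z * jump_part \<nu> 0 z \<partial>lborel)"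
          unfolding jump_op_def using iv u(3)[of x] by (subst Bochner_Integration.integral_diff) simp_all
        also have "\<dots> = L 0 w x"
          unfolding jump_op_def w_def by (intro Bochner_Integration.integral_cong) (auto simp: algebra_simps)
        finally show ?thesis using ev u(2)[of x] by (simp add: w_def algebra_simps)
      qed
      ultimately have "w x = 0" for x
        by (intro solution_unique[OF wm wB _ K'(1) l'])
      then show ?thesis by (simp add: w_def fun_eq_iff)
    qed
    show ?thesis
    proof (intro conjI)
      show "\<exists>!u. u \<in> holder_space (rho \<nu>) (1 + \<alpha>) \<and> poisson_solution \<nu> a l f u"
        using u_space u_sol unique by blast
      show "\<forall>u. u \<in> holder_space (rho \<nu>) (1 + \<alpha>) \<and> poisson_solution \<nu> a l f u \<longrightarrow>
        (\<forall>\<beta>\<in>{0..\<alpha>}. ennreal l * holder_norm (rho \<nu>) \<beta> u + holder_norm (rho \<nu>) (1 + \<beta>) u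
                  \<le> ennreal C * holder_norm (rho \<nu>) \<beta> f)"
        using unique estimate by auto
    qed
  qed
  have "C > 0" using M0 by (simp add: C_def)
  then show ?thesis using main l0 by (intro exI[of _ "\<lambda>_. C"]) blast
qed

end
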